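(* Let $F_1,\dots,F_k$ be smooth, Lipschitz-continuous vector fields on $\mathbb{R}^n$, let $\mathcal{U}:=L^2([0,1],\mathbb{R}^k)$, and let $\beta>0$. Let $\mu,\nu\in\mathcal{P}(\mathbb{R}^n)$ be probability measures with supports included in a compact set $K\subset\mathbb{R}^n$, with $\mu\ll\mathcal{L}^n$ (Lebesgue measure), and let $(\mu_N)_{N\ge1},(\nu_N)_{N\ge1}\subset\mathcal{P}(K)$ be such that $\mu_N\rightharpoonup^*\mu$ and $\nu_N\rightharpoonup^*\nu$ as $N\to\infty$. For every $N\ge1$ let $\gamma_N\in\mathrm{Opt}(\mu_N,\nu_N)$ and $$\mathcal{F}^{N,\beta}(u):=\int_{\mathbb{R}^n\times\mathbb{R}^n}|\Phi_u(x)-y|_2^2\,d\gamma_N(x,y)+\frac\beta2\|u\|_{L^2}^2,\qquad u\in\mathcal{U}.$$ Let moreover $$\mathcal{F}^{\infty,\beta}(u):=\int_{\mathbb{R}^n}|\Phi_u(x)-T(x)|_2^2\,d\mu(x)+\frac\beta2\|u\|_{L^2}^2,\qquad u\in\mathcal{U},$$ where $T:\mathrm{supp}(\mu)\to\mathrm{supp}(\nu)$ is the optimal transport map between $\mu$ and $\nu$ with respect to the squared Euclidean distance. Then, equipping the bounded set $\mathcal{U}_\beta\subset\mathcal{U}$ with the weak topology of $L^2$, the restrictions to $\mathcal{U}_\beta$ satisfy $\mathcal{F}^{N,\beta}\to_\Gamma\mathcal{F}^{\infty,\beta}$ as $N\to\infty$. Moreover, $$\lim_{N\to\infty}\min_{\mathcal{U}}\mathcal{F}^{N,\beta}=\min_{\mathcal{U}}\mathcal{F}^{\infty,\beta},$$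 and, if $\hat u_N\in\arg\min_{\mathcal{U}}\mathcal{F}^{N,\beta}$ for every $N\ge1$, then the sequence $(\hat u_N)_{N\ge1}$ is pre-compact with respect to the strong topology of $L^2$, and its limiting points are minimizers of $\mathcal{F}^{\infty,\beta}$.
   Context: Flow: for $u=(u_1,\dots,u_k)\in\mathcal{U}$, $\Phi_u:\mathbb{R}^n\to\mathbb{R}^n$ is defined by $\Phi_u(x):=x_u(1)$, where $x_u:[0,1]\to\mathbb{R}^n$ is the absolutely continuous solution of $\dot x_u(t)=\sum_{i=1}^kF_i(x_u(t))u_i(t)$ for a.e. $t\in[0,1]$, $x_u(0)=x$. $\rightharpoonup^*$ denotes convergence of probability measures tested against bounded continuous functions. $\mathrm{Opt}(\mu,\nu)$ is the (non-empty) set of $\gamma\in\mathcal{P}(\mathbb{R}^n\times\mathbb{R}^n)$ with first marginal $\mu$ and second marginal $\nu$ that minimize $\int|x-y|^2\,d\gamma(x,y)$ among all such couplings. An optimal transport map between $\mu$ and $\nu$ is a Borel map $T$ with $(\mathrm{Id},T)_\#\mu\in\mathrm{Opt}(\mu,\nu)$; since $\mu\ll\mathcal{L}^n$, it exists and is unique up to $\mu$-a.e. equality. $\mathcal{U}_\beta:=\{u\in\mathcal{U}:\|u\|_{L^2}^2\le C/\beta\}$, where $C>0$ is a constant such that, for every $N\in\mathbb{N}\cup\{\infty\}$, every minimizer $\hat u$ of $\mathcal{F}^{N,\beta}$ over $\mathcal{U}$ satisfies $\|\hat u\|_{L^2}^2\le C/\beta$ (such a constant exists). The weak topology of $L^2$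 is metrizable on $\mathcal{U}_\beta$. $\Gamma$-convergence: on a metric space $\mathcal{X}$, functionals $\mathcal{G}^N$ $\Gamma$-converge to $\mathcal{G}^\infty$ ($\mathcal{G}^N\to_\Gamma\mathcal{G}^\infty$) if (liminf) for every $u_N\to u$ in $\mathcal{X}$ one has $\mathcal{G}^\infty(u)\le\liminf_N\mathcal{G}^N(u_N)$, and (limsup) for every $u\in\mathcal{X}$ there exists $u_N\to u$ in $\mathcal{X}$ with $\mathcal{G}^\infty(u)\ge\limsup_N\mathcal{G}^N(u_N)$. *)

theory Defs
  imports "HOL-Probability.Probability"
begin

section \<open>The Hilbert space $L^2([0,1])$\<close>

definition L2_functions :: "(real \<Rightarrow> 'b::euclidean_space) set" where
  "L2_functions = {u. u \<in> borel_measurable (lebesgue_on {0..1}) \<and>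
     integrable (lebesgue_on {0..1}) (\<lambda>t. (norm (u t))\<^sup>2)}"

definition L2_rel :: "(real \<Rightarrow> 'b::euclidean_space) \<Rightarrow> (real \<Rightarrow> 'b) \<Rightarrow> bool" where
  "L2_rel u v \<longleftrightarrow> u \<in> L2_functions \<and> v \<in> L2_functions \<and>
     (AE t in lebesgue_on {0..1}. u t = v t)"

lemma L2_functions_0: "(\<lambda>_. 0) \<in> L2_functions"
  by (simp add: L2_functions_def)

lemma L2_functions_add:
  fixes u v :: "real \<Rightarrow> 'b::euclidean_space"
  assumes "u \<in> L2_functions" "v \<in> L2_functions"
  shows "(\<lambda>t. u t + v t) \<in> L2_functions"
proof -
  have le: "(norm (u t + v t))\<^sup>2 \<le> 2 * (norm (u t))\<^sup>2 + 2 * (norm (v t))\<^sup>2" for t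
  proof -
    have "(norm (u t + v t))\<^sup>2 \<le> (norm (u t) + norm (v t))\<^sup>2"
      by (simp add: norm_triangle_ineq power_mono)
    also have "\<dots> \<le> 2 * (norm (u t))\<^sup>2 + 2 * (norm (v t))\<^sup>2"
      using sum_squares_bound[of "norm (u t)" "norm (v t)"] by (simp add: power2_sum)
    finally show ?thesis .
  qed
  have [measurable]: "u \<in> borel_measurable (lebesgue_on {0..1})"
      "v \<in> borel_measurable (lebesgue_on {0..1})"
    using assms by (auto simp: L2_functions_def)
  have "integrable (lebesgue_on {0..1}) (\<lambda>t. 2 * (norm (u t))\<^sup>2 + 2 * (norm (v t))\<^sup>2)"
    using assms by (auto simp: L2_functions_def)
  then have "integrable (lebesgue_on {0..1}) (\<lambda>t. (norm (u t + v t))\<^sup>2)"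
    by (rule Bochner_Integration.integrable_bound) (use le in \<open>auto intro!: AE_I2\<close>)
  then show ?thesis by (simp add: L2_functions_def)
qed

lemma L2_functions_scaleR:
  "u \<in> L2_functions \<Longrightarrow> (\<lambda>t. c *\<^sub>R u t) \<in> L2_functions"
  by (auto simp: L2_functions_def power_mult_distrib)

lemma L2_functions_minus: "u \<in> L2_functions \<Longrightarrow> (\<lambda>t. - u t) \<in> L2_functions"
  by (auto simp: L2_functions_def)

lemma L2_functions_diff:
  "u \<in> L2_functions \<Longrightarrow> v \<in> L2_functions \<Longrightarrow> (\<lambda>t. u t - v t) \<in> L2_functions"
  using L2_functions_add[OF _ L2_functions_minus] by fastforce

lemma L2_functions_inner_integrable:
  fixes u v :: "real \<Rightarrow> 'b::euclidean_space"
  assumes "u \<in> L2_functions" "v \<in> L2_functions"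
  shows "integrable (lebesgue_on {0..1}) (\<lambda>t. u t \<bullet> v t)"
proof -
  have [measurable]: "u \<in> borel_measurable (lebesgue_on {0..1})"
      "v \<in> borel_measurable (lebesgue_on {0..1})"
    using assms by (auto simp: L2_functions_def)
  have le: "\<bar>u t \<bullet> v t\<bar> \<le> (norm (u t))\<^sup>2 + (norm (v t))\<^sup>2" for t
  proof -
    have "\<bar>u t \<bullet> v t\<bar> \<le> norm (u t) * norm (v t)" by (rule Cauchy_Schwarz_ineq2)
    also have "\<dots> \<le> 2 * norm (u t) * norm (v t)" by (simp add: mult_le_cancel_right1)
    also have "\<dots> \<le> (norm (u t))\<^sup>2 + (norm (v t))\<^sup>2" by (rule sum_squares_bound)
    finally show ?thesis .
  qed
  have "integrable (lebesgue_on {0..1}) (\<lambda>t. (norm (u t))\<^sup>2 + (norm (v t))\<^sup>2)"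
    using assms by (auto simp: L2_functions_def)
  then show ?thesis
    by (rule Bochner_Integration.integrable_bound) (use le in \<open>auto intro!: AE_I2\<close>)
qed

text \<open>Elements are classes of a.e. equal functions; \<open>rep_L2 u\<close> is some representative.\<close>

quotient_type (overloaded) 'b L2 = "real \<Rightarrow> 'b::euclidean_space" / partial: L2_rel
proof (rule part_equivpI)
  show "\<exists>u. L2_rel u (u :: real \<Rightarrow> 'b)"
    using L2_functions_0 by (auto simp: L2_rel_def)
  show "symp (L2_rel :: (real \<Rightarrow> 'b) \<Rightarrow> _)"
    by (auto simp: symp_def L2_rel_def elim!: AE_mp)
  show "transp (L2_rel :: (real \<Rightarrow> 'b) \<Rightarrow> _)"
    by (auto simp: transp_def L2_rel_def elim!: AE_mp)
qed

instantiation L2 :: (euclidean_space) real_vector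
begin

lift_definition zero_L2 :: "'a L2" is "\<lambda>_. 0"
  by (simp add: L2_rel_def L2_functions_0)

lift_definition plus_L2 :: "'a L2 \<Rightarrow> 'a L2 \<Rightarrow> 'a L2" is "\<lambda>u v t. u t + v t"
  by (auto simp: L2_rel_def L2_functions_add)

lift_definition minus_L2 :: "'a L2 \<Rightarrow> 'a L2 \<Rightarrow> 'a L2" is "\<lambda>u v t. u t - v t"
  by (auto simp: L2_rel_def L2_functions_diff)

lift_definition uminus_L2 :: "'a L2 \<Rightarrow> 'a L2" is "\<lambda>u t. - u t"
  by (auto simp: L2_rel_def L2_functions_minus)

lift_definition scaleR_L2 :: "real \<Rightarrow> 'a L2 \<Rightarrow> 'a L2" is "\<lambda>c u t. c *\<^sub>R u t"
  by (auto simp: L2_rel_def L2_functions_scaleR)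

instance
  by standard
    (transfer, auto simp: L2_rel_def algebra_simps
      intro!: L2_functions_0 L2_functions_add L2_functions_diff L2_functions_minus
        L2_functions_scaleR)+

end

instantiation L2 :: (euclidean_space) real_inner
begin

lift_definition inner_L2 :: "'a L2 \<Rightarrow> 'a L2 \<Rightarrow> real"
  is "\<lambda>u v. LINT t|lebesgue_on {0..1}. u t \<bullet> v t"
  unfolding L2_rel_def
  by (intro integral_cong_AE)
    (auto intro!: borel_measurable_integrable L2_functions_inner_integrable)

definition norm_L2 :: "'a L2 \<Rightarrow> real" where
  "norm_L2 u = sqrt (u \<bullet> u)"

definition dist_L2 :: "'a L2 \<Rightarrow> 'a L2 \<Rightarrow> real" where
  "dist_L2 u v = norm (u - v)"

definition sgn_L2 :: "'a L2 \<Rightarrow> 'a L2" where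
  "sgn_L2 u = u /\<^sub>R norm u"

definition uniformity_L2 :: "('a L2 \<times> 'a L2) filter" where
  "uniformity_L2 = (INF e\<in>{0<..}. principal {(u, v). dist u v < e})"

definition open_L2 :: "'a L2 set \<Rightarrow> bool" where
  "open_L2 S \<longleftrightarrow> (\<forall>u\<in>S. \<forall>\<^sub>F (u', v) in uniformity. u' = u \<longrightarrow> v \<in> S)"

instance
proof
  fix u v w :: "'a L2" and c :: real and S :: "'a L2 set"
  show "dist u v = norm (u - v)" by (rule dist_L2_def)
  show "sgn u = u /\<^sub>R norm u" by (rule sgn_L2_def)
  show "uniformity = (INF e\<in>{0<..}. principal {(u, v :: 'a L2). dist u v < e})"
    by (rule uniformity_L2_def)
  show "open S = (\<forall>u\<in>S. \<forall>\<^sub>F (u', v) in uniformity. u' = u \<longrightarrow> v \<in> S)"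
    by (rule open_L2_def)
  show "norm u = sqrt (u \<bullet> u)" by (rule norm_L2_def)
  show "u \<bullet> v = v \<bullet> u"
    by transfer (simp add: inner_commute)
  show "(u + v) \<bullet> w = u \<bullet> w + v \<bullet> w"
    by transfer (simp add: L2_rel_def inner_add_left L2_functions_inner_integrable)
  show "(c *\<^sub>R u) \<bullet> v = c * (u \<bullet> v)"
    by transfer simp
  show "0 \<le> u \<bullet> u"
    by transfer simp
  show "u \<bullet> u = 0 \<longleftrightarrow> u = 0"
  proof transfer
    fix f :: "real \<Rightarrow> 'a"
    assume "L2_rel f f"
    then have f: "f \<in> L2_functions" by (simp add: L2_rel_def)
    have "(LINT t|lebesgue_on {0..1}. f t \<bullet> f t) = 0 \<longleftrightarrow>
        (AE t in lebesgue_on {0..1}. f t \<bullet> f t = 0)"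
      by (rule integral_nonneg_eq_0_iff_AE) (auto intro: L2_functions_inner_integrable f)
    then show "(LINT t|lebesgue_on {0..1}. f t \<bullet> f t) = 0 \<longleftrightarrow> L2_rel f (\<lambda>_. 0)"
      by (simp add: L2_rel_def f L2_functions_0)
  qed
qed

end

definition weak_topology :: "'a::real_normed_vector topology" where
  "weak_topology = topology_generated_by
     {f -` S | (f :: 'a \<Rightarrow> real) S. bounded_linear f \<and> open S}"


section \<open>$\Gamma$-convergence\<close>

text \<open>This is the sequential notion; it is meant for metrizable \<open>X\<close>.\<close>

definition Gamma_converges ::
    "'a topology \<Rightarrow> (nat \<Rightarrow> 'a \<Rightarrow> ereal) \<Rightarrow> ('a \<Rightarrow> ereal) \<Rightarrow> bool" where
  "Gamma_converges X G Ginf \<longleftrightarrow>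
     (\<forall>u\<in>topspace X. \<forall>w. (\<forall>N. w N \<in> topspace X) \<and> limitin X w u sequentially \<longrightarrow>
        Ginf u \<le> liminf (\<lambda>N. G N (w N))) \<and>
     (\<forall>u\<in>topspace X. \<exists>w. (\<forall>N. w N \<in> topspace X) \<and> limitin X w u sequentially \<and>
        limsup (\<lambda>N. G N (w N)) \<le> Ginf u)"


section \<open>Flows of control-linear systems\<close>

text \<open>
  On a finite-dimensional space, \<open>C_diff m f\<close> says that \<open>f\<close> is of class $C^m$: all
  directional derivatives of a differentiable \<open>f\<close> are of class $C^{m-1}$.
\<close>

primrec C_diff :: "nat \<Rightarrow> ('a::euclidean_space \<Rightarrow> 'b::real_normed_vector) \<Rightarrow> bool" where
  "C_diff 0 f \<longleftrightarrow> continuous_on UNIV f"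
| "C_diff (Suc m) f \<longleftrightarrow> f differentiable_on UNIV \<and>
     (\<forall>v. C_diff m (\<lambda>x. frechet_derivative f (at x) v))"

definition smooth :: "('a::euclidean_space \<Rightarrow> 'b::real_normed_vector) \<Rightarrow> bool" where
  "smooth f \<longleftrightarrow> (\<forall>m. C_diff m f)"

definition abs_continuous_on_interval ::
    "real \<Rightarrow> real \<Rightarrow> (real \<Rightarrow> 'a::metric_space) \<Rightarrow> bool" where
  "abs_continuous_on_interval a b f \<longleftrightarrow>
     (\<forall>\<epsilon>>0. \<exists>\<delta>>0. \<forall>(m::nat) s t.
        (\<forall>i<m. a \<le> s i \<and> s i \<le> t i \<and> t i \<le> b) \<and>
        disjoint_family_on (\<lambda>i. {s i<..<t i}) {..<m} \<and>
        (\<Sum>i<m. t i - s i) < \<delta> \<longrightarrow>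
        (\<Sum>i<m. dist (f (s i)) (f (t i))) < \<epsilon>)"

definition is_trajectory ::
    "('k::finite \<Rightarrow> real ^ 'n \<Rightarrow> real ^ 'n) \<Rightarrow> (real ^ 'k) L2 \<Rightarrow> real ^ 'n \<Rightarrow>
     (real \<Rightarrow> real ^ 'n) \<Rightarrow> bool" where
  "is_trajectory F u x \<xi> \<longleftrightarrow>
     abs_continuous_on_interval 0 1 \<xi> \<and> \<xi> 0 = x \<and>
     (AE t in lebesgue_on {0..1}.
        (\<xi> has_vector_derivative (\<Sum>i\<in>UNIV. (rep_L2 u t $ i) *\<^sub>R F i (\<xi> t))) (at t within {0..1}))"

definition flow ::
    "('k::finite \<Rightarrow> real ^ 'n \<Rightarrow> real ^ 'n) \<Rightarrow> (real ^ 'k) L2 \<Rightarrow> real ^ 'n \<Rightarrow> real ^ 'n" where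
  "flow F u x = (THE y. \<exists>\<xi>. is_trajectory F u x \<xi> \<and> y = \<xi> 1)"


section \<open>Optimal transport\<close>

definition prob_measures :: "'a::topological_space measure set" where
  "prob_measures = {M. prob_space M \<and> sets M = sets borel}"

definition supp :: "'a::topological_space measure \<Rightarrow> 'a set" where
  "supp M = {x. \<forall>U. open U \<and> x \<in> U \<longrightarrow> 0 < emeasure M U}"

definition weakly_converges ::
    "(nat \<Rightarrow> 'a::topological_space measure) \<Rightarrow> 'a measure \<Rightarrow> bool" where
  "weakly_converges M Minf \<longleftrightarrow>
     (\<forall>f :: 'a \<Rightarrow> real. continuous_on UNIV f \<and> bounded (range f) \<longrightarrow>
        (\<lambda>N. LINT x|M N. f x) \<longlonglongrightarrow> (LINT x|Minf. f x))"

definition couplings ::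
    "'a::euclidean_space measure \<Rightarrow> 'a measure \<Rightarrow> ('a \<times> 'a) measure set" where
  "couplings \<mu> \<nu> =
     {\<gamma> \<in> prob_measures. distr \<gamma> borel fst = \<mu> \<and> distr \<gamma> borel snd = \<nu>}"

definition transport_cost :: "('a::euclidean_space \<times> 'a) measure \<Rightarrow> ennreal" where
  "transport_cost \<gamma> = (\<integral>\<^sup>+ p. ennreal ((norm (fst p - snd p))\<^sup>2) \<partial>\<gamma>)"

definition Opt ::
    "'a::euclidean_space measure \<Rightarrow> 'a measure \<Rightarrow> ('a \<times> 'a) measure set" where
  "Opt \<mu> \<nu> = {\<gamma> \<in> couplings \<mu> \<nu>.
     \<forall>\<gamma>' \<in> couplings \<mu> \<nu>. transport_cost \<gamma> \<le> transport_cost \<gamma>'}"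

text \<open>
  A map defined on \<open>supp \<mu>\<close> only is represented by any Borel extension to the whole space.
\<close>

definition is_optimal_map ::
    "'a::euclidean_space measure \<Rightarrow> 'a measure \<Rightarrow> ('a \<Rightarrow> 'a) \<Rightarrow> bool" where
  "is_optimal_map \<mu> \<nu> T \<longleftrightarrow> T \<in> borel_measurable borel \<and> T ` supp \<mu> \<subseteq> supp \<nu> \<and>
     distr \<mu> borel (\<lambda>x. (x, T x)) \<in> Opt \<mu> \<nu>"


section \<open>The functionals\<close>

text \<open>
  The Bochner integrals below are meant for compactly supported measures and continuous flows,
  so that the integrands are essentially bounded.
\<close>

definition functional_plan ::
    "('k::finite \<Rightarrow> real ^ 'n \<Rightarrow> real ^ 'n) \<Rightarrow> real \<Rightarrow> ((real ^ 'n) \<times> (real ^ 'n)) measure \<Rightarrow>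
     (real ^ 'k) L2 \<Rightarrow> real" where
  "functional_plan F \<beta> \<gamma> u =
     (LINT p|\<gamma>. (norm (flow F u (fst p) - snd p))\<^sup>2) + \<beta> / 2 * (norm u)\<^sup>2"

definition functional_map ::
    "('k::finite \<Rightarrow> real ^ 'n \<Rightarrow> real ^ 'n) \<Rightarrow> real \<Rightarrow> (real ^ 'n) measure \<Rightarrow>
     (real ^ 'n \<Rightarrow> real ^ 'n) \<Rightarrow> (real ^ 'k) L2 \<Rightarrow> real" where
  "functional_map F \<beta> \<mu> T u =
     (LINT x|\<mu>. (norm (flow F u x - T x))\<^sup>2) + \<beta> / 2 * (norm u)\<^sup>2"

definition minimizers :: "('a \<Rightarrow> real) \<Rightarrow> 'a set" where
  "minimizers G = {u. \<forall>v. G u \<le> G v}"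

definition bounded_controls :: "real \<Rightarrow> real \<Rightarrow> ('b::euclidean_space) L2 set" where
  "bounded_controls C \<beta> = {u. (norm u)\<^sup>2 \<le> C / \<beta>}"

end

theory Submission
  imports Defs "HOL-Complex_Analysis.Great_Picard" "HOL-Number_Theory.Cong"
begin

text \<open>
  Three facts carry the proof. (1) If controls converge weakly, their flows converge uniformly on
  compact sets: by weak convergence the integrals of the fields along a fixed trajectory converge,
  uniformly in time by equicontinuity, and Gronwall's inequality does the rest. (2) The plans
  $\gamma_N$ converge weakly to $(\mathrm{Id},T)_\#\mu$. No compactness of the plans is needed:
  Kantorovich potentials of the $\gamma_N$ are equi-Lipschitz, so by Arzela-Ascoli the optimal costs
  have upper limit at most the limit cost; hence $\int h\,d\gamma_N \to 0$ for
  $h = |x-y|^2 - \phi(x) - \psi(y) \ge 0$ with $\phi, \psi$ the potentials of the limit. The zero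
  set of $h$ is monotone, hence single-valued outside a Lebesgue null set. (3) Bounded sets of $L^2$
  are weakly sequentially compact. The misfit terms therefore converge along weakly convergent
  controls, which gives $\Gamma$-convergence and, by the direct method, convergence of minimizers;
  convergence of the minimal values forces convergence of the norms, which upgrades weak to strong
  convergence.
\<close>

section \<open>Weak sequential compactness in Hilbert spaces\<close>

text \<open>The flow is defined through absolutely continuous curves that solve the equation almost
  everywhere, whereas Gronwall and Picard arguments need integral equations. The passage is made
  both ways: a fundamental theorem for absolutely continuous functions gives uniqueness, Lebesgue
  differentiation of primitives gives existence. Optimality compares couplings only, so cyclical
  monotonicity of the support has to be extracted from a competitor coupling. The potentials built
  from it are infima of functions \<open>sqdist x y + const\<close>; their Lipschitz constant
  \<open>4 * R\<close> therefore depends on \<open>K\<close> alone, which makes them equi-Lipschitz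
  along the sequence. Plans and controls vary at once in the misfit. Uniform convergence of the
  flows on \<open>K\<close> separates the two: changing the control costs little for every measure
  on \<open>K \<times> K\<close>, and then a fixed continuous integrand is tested against the plans.
  The limit functional is itself the functional of a plan, the law of \<open>(x, T x)\<close>, so
  one analysis of \<open>functional_plan\<close> serves all of them. Minimizers are bounded by
  comparison with the zero control.\<close>

lemma riesz_closed_subspace:
  fixes W :: "'a::{real_inner,complete_space} set" and f :: "'a \<Rightarrow> real"
  assumes W: "subspace W" "closed W"
    and add: "\<And>x y. x \<in> W \<Longrightarrow> y \<in> W \<Longrightarrow> f (x + y) = f x + f y"
    and scale: "\<And>c x. x \<in> W \<Longrightarrow> f (c *\<^sub>R x) = c * f x"
    and bound: "\<And>x. x \<in> W \<Longrightarrow> \<bar>f x\<bar> \<le> B * norm x"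
  obtains v where "v \<in> W" "\<And>y. y \<in> W \<Longrightarrow> f y = v \<bullet> y"
proof -
  \<comment> \<open>The representer is the minimizer of this quadratic energy over \<open>W\<close>.
    The bound on \<open>f\<close> bounds \<open>J\<close> from below by completing the square, the
    parallelogram identity (in which the linear part cancels) makes minimizing sequences Cauchy, and
    the first variation at the minimizer is the claimed identity.\<close>
  define J where "J v = (v \<bullet> v) / 2 - f v" for v
  have Jlow: "- (B\<^sup>2 / 2) \<le> J v" if "v \<in> W" for v
  proof -
    have "f v \<le> B * norm v" using bound[OF that] by linarith
    moreover have "(norm v - B)\<^sup>2 \<ge> 0" by simp
    ultimately show ?thesis
      unfolding J_def power2_norm_eq_inner[symmetric] power2_diff by (simp add: field_simps)
  qed
  define m where "m = Inf (J ` W)"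
  have bdd: "bdd_below (J ` W)" using Jlow by (auto intro!: bdd_belowI2)
  have W0: "0 \<in> W" using W(1) by (rule subspace_0)
  have mle: "m \<le> J v" if "v \<in> W" for v
    unfolding m_def using bdd that by (auto intro: cInf_lower)
  have "\<exists>v\<in>W. J v < m + inverse (real (Suc n))" for n
  proof -
    have "Inf (J ` W) < m + inverse (real (Suc n))" by (simp add: m_def)
    then show ?thesis using cInf_lessD[of "J ` W"] W0 by auto
  qed
  then obtain v where vW: "\<And>n. v n \<in> W" and vJ: "\<And>n. J (v n) < m + inverse (real (Suc n))"
    by metis
  have f_diff: "f (x - y) = f x - f y" if "x \<in> W" "y \<in> W" for x y
    using add[OF that(1), of "(-1) *\<^sub>R y"] scale[OF that(2), of "-1"] that W(1)
    by (simp add: subspace_neg)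
  have para: "(dist x y)\<^sup>2 / 4 = J x + J y - 2 * J ((1/2) *\<^sub>R (x + y))" if "x \<in> W" "y \<in> W" for x y
  proof -
    have "f ((1/2) *\<^sub>R (x + y)) = (f x + f y) / 2"
      using scale[of "x + y" "1/2"] add[OF that] that W(1) by (simp add: subspace_add)
    then show ?thesis
      unfolding J_def dist_norm power2_norm_eq_inner
      by (simp add: inner_simps inner_commute field_simps)
  qed
  have dist_le: "(dist (v i) (v j))\<^sup>2 \<le> 4 * (inverse (real (Suc i)) + inverse (real (Suc j)))" for i j
  proof -
    have "(1/2) *\<^sub>R (v i + v j) \<in> W" using vW W(1) by (simp add: subspace_add subspace_scale)
    then have "m \<le> J ((1/2) *\<^sub>R (v i + v j))" by (rule mle)
    moreover have "d \<le> 4 * (a + b)"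
      if "m \<le> M" "d / 4 = p + q - 2 * M" "p < m + a" "q < m + b" for M d p q a b :: real
      using that by argo
    ultimately show ?thesis using para[OF vW vW, of i j] vJ[of i] vJ[of j] by blast
  qed
  have "Cauchy v"
  proof (rule metric_CauchyI)
    fix e :: real assume e: "e > 0"
    then obtain N where N: "inverse (real (Suc N)) < e\<^sup>2 / 8"
      using reals_Archimedean[of "e\<^sup>2 / 8"] by auto
    show "\<exists>M. \<forall>i\<ge>M. \<forall>j\<ge>M. dist (v i) (v j) < e"
    proof (intro exI allI impI)
      fix i j assume "i \<ge> N" "j \<ge> N"
      then have "inverse (real (Suc i)) \<le> inverse (real (Suc N))"
        "inverse (real (Suc j)) \<le> inverse (real (Suc N))"
        by (auto intro!: le_imp_inverse_le)
      then have "(dist (v i) (v j))\<^sup>2 < e\<^sup>2" using dist_le[of i j] N by argo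
      then show "dist (v i) (v j) < e" using e by (simp add: power2_less_imp_less)
    qed
  qed
  then obtain u where u: "v \<longlonglongrightarrow> u" using Cauchy_convergent convergent_def by blast
  have uW: "u \<in> W" using W(2) vW u by (rule closed_sequentially)
  have "(\<lambda>n. f (v n)) \<longlonglongrightarrow> f u"
  proof (rule LIM_zero_cancel, rule Lim_null_comparison)
    show "\<forall>\<^sub>F n in sequentially. norm (f (v n) - f u) \<le> B * norm (v n - u)"
      using f_diff[OF vW uW] bound[of "v _ - u"] vW uW W(1)
      by (auto simp: subspace_diff)
    show "(\<lambda>n. B * norm (v n - u)) \<longlonglongrightarrow> 0"
      using u by (auto intro!: tendsto_mult_right_zero tendsto_norm_zero LIM_zero)
  qed
  then have "(\<lambda>n. J (v n)) \<longlonglongrightarrow> J u"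
    unfolding J_def using u by (intro tendsto_intros) auto
  moreover have "(\<lambda>n. m + inverse (real (Suc n))) \<longlonglongrightarrow> m + 0"
    by (intro tendsto_intros LIMSEQ_inverse_real_of_nat)
  ultimately have Ju: "J u \<le> m"
    using vJ by (intro LIMSEQ_le[of "\<lambda>n. J (v n)" _ "\<lambda>n. m + inverse (real (Suc n))"]) (auto intro: less_imp_le)
  have "f y = u \<bullet> y" if y: "y \<in> W" for y
  proof (cases "y = 0")
    case True
    then show ?thesis using scale[OF y, of 0] by simp
  next
    case False
    define d where "d = u \<bullet> y - f y"
    \<comment> \<open>This \<open>t\<close> minimizes the parabola \<open>J (u + t *\<^sub>R y) - J
      u = t * d + t\<^sup>2 * (y \<bullet> y) / 2\<close>; its minimum is negative unless
      \<open>d = 0\<close>.\<close>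
    define t where "t = - d / (y \<bullet> y)"
    have "u + t *\<^sub>R y \<in> W" using uW y W(1) by (simp add: subspace_add subspace_scale)
    then have "J u \<le> J (u + t *\<^sub>R y)" using Ju mle by fastforce
    moreover have "f (u + t *\<^sub>R y) = f u + t * f y"
      using add[OF uW, of "t *\<^sub>R y"] scale[OF y] y W(1) by (simp add: subspace_scale)
    ultimately have "0 \<le> t * d + t\<^sup>2 * (y \<bullet> y) / 2"
      unfolding J_def d_def by (simp add: inner_simps inner_commute power2_eq_square field_simps)
    also have "\<dots> = - d\<^sup>2 / (2 * (y \<bullet> y))"
      using False unfolding t_def by (simp add: field_simps power2_eq_square)
    finally have "d\<^sup>2 / (2 * (y \<bullet> y)) \<le> 0" by simp
    then have "d = 0" using False
      by (auto simp: divide_le_0_iff dest: antisym[OF _ inner_ge_zero])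
    then show ?thesis by (simp add: d_def)
  qed
  with uW show ?thesis using that by blast
qed

text \<open>A diagonal argument makes the products with the countably many \<open>x m\<close>
  converge. The set \<open>W\<close> of all \<open>y\<close> whose products converge is a closed
  subspace that contains every \<open>x m\<close>, and the limit is a bounded functional on
  \<open>W\<close>, hence represented there. Separability of the space is avoided because everything
  orthogonal to \<open>W\<close> is invisible to the sequence.\<close>

lemma bounded_imp_weakly_convergent_subsequence:
  fixes x :: "nat \<Rightarrow> 'a::{real_inner,complete_space}"
  assumes B: "\<And>n. norm (x n) \<le> B"
  obtains r l where "strict_mono r" "\<And>y. (\<lambda>n. x (r n) \<bullet> y) \<longlonglongrightarrow> l \<bullet> y"
proof -
  have B0: "0 \<le> B" using B[of 0] norm_ge_zero order_trans by blast
  have "norm (x n \<bullet> x m) \<le> B * B" for n m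
    using Cauchy_Schwarz_ineq2[of "x n" "x m"] mult_mono[OF B[of n] B[of m]] B0 by simp
  then obtain r where r: "strict_mono r" "\<And>m. \<exists>l. (\<lambda>n. x (r n) \<bullet> x m) \<longlonglongrightarrow> l"
    by (rule function_convergent_subsequence[of "UNIV::nat set" "\<lambda>n m. x n \<bullet> x m" "B * B", rotated])
      auto
  define W where "W = {y. convergent (\<lambda>n. x (r n) \<bullet> y)}"
  define f where "f y = lim (\<lambda>n. x (r n) \<bullet> y)" for y
  have lim: "(\<lambda>n. x (r n) \<bullet> y) \<longlonglongrightarrow> f y" if "y \<in> W" for y
    using that by (simp add: W_def f_def convergent_LIMSEQ_iff)
  have sub: "subspace W"
    unfolding W_def
    by (rule subspaceI) (auto simp: inner_simps intro: convergent_add convergent_mult convergent_const)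
  have xB: "\<bar>x (r n) \<bullet> y\<bar> \<le> B * norm y" for n y
    using Cauchy_Schwarz_ineq2[of "x (r n)" y] mult_right_mono[OF B[of "r n"] norm_ge_zero[of y]] by linarith
  have "closed W"
  proof (rule closed_sequential_limits[THEN iffD2], intro allI impI, elim conjE)
    fix y l assume y: "\<forall>n. y n \<in> W" and l: "y \<longlonglongrightarrow> l"
    have "Cauchy (\<lambda>n. x (r n) \<bullet> l)"
    proof (rule metric_CauchyI)
      fix e :: real assume e: "e > 0"
      have "(\<lambda>k. B * norm (y k - l)) \<longlonglongrightarrow> 0"
        using l by (auto intro!: tendsto_mult_right_zero tendsto_norm_zero LIM_zero)
      from order_tendstoD(2)[OF this, of "e/3"] e obtain k where k: "B * norm (y k - l) < e/3"
        by (auto simp: eventually_sequentially)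
      have "Cauchy (\<lambda>n. x (r n) \<bullet> y k)" using lim y LIMSEQ_imp_Cauchy by blast
      then obtain M where M: "\<And>i j. i \<ge> M \<Longrightarrow> j \<ge> M \<Longrightarrow> dist (x (r i) \<bullet> y k) (x (r j) \<bullet> y k) < e/3"
        using e metric_CauchyD[of _ "e/3"] by (metis divide_pos_pos zero_less_numeral)
      show "\<exists>M. \<forall>i\<ge>M. \<forall>j\<ge>M. dist (x (r i) \<bullet> l) (x (r j) \<bullet> l) < e"
      proof (intro exI allI impI)
        fix i j assume "i \<ge> M" "j \<ge> M"
        from M[OF this] show "dist (x (r i) \<bullet> l) (x (r j) \<bullet> l) < e"
          using k xB[of i "y k - l"] xB[of j "y k - l"]
          unfolding dist_real_def inner_diff_right by linarith
      qed
    qed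
    then show "l \<in> W" by (simp add: W_def Cauchy_convergent)
  qed
  have xW: "x m \<in> W" for m using r(2) by (auto simp: W_def convergent_def)
  have fB: "\<bar>f y\<bar> \<le> B * norm y" if "y \<in> W" for y
    using tendsto_rabs[OF lim[OF that]] xB by (intro LIMSEQ_le_const2) auto
  obtain l where l: "l \<in> W" "\<And>y. y \<in> W \<Longrightarrow> f y = l \<bullet> y"
  proof (rule riesz_closed_subspace[OF sub \<open>closed W\<close>, of f B])
    show "f (y + z) = f y + f z" if "y \<in> W" "z \<in> W" for y z
      using tendsto_add[OF lim[OF that(1)] lim[OF that(2)]] lim[of "y + z"] that sub
      by (auto simp: inner_simps subspace_add intro: LIMSEQ_unique)
    show "f (c *\<^sub>R y) = c * f y" if "y \<in> W" for c y
      using tendsto_mult_left[OF lim[OF that], of c] lim[of "c *\<^sub>R y"] that sub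
      by (auto simp: inner_simps subspace_scale intro: LIMSEQ_unique)
  qed (use fB in auto)
  have "(\<lambda>n. x (r n) \<bullet> y) \<longlonglongrightarrow> l \<bullet> y" for y
  proof -
    \<comment> \<open>\<open>p\<close> is the orthogonal projection of \<open>y\<close> onto
      \<open>W\<close>, obtained by representing the functional
      \<open>z \<mapsto> y \<bullet> z\<close>; all \<open>x m\<close> and \<open>l\<close> lie in
      \<open>W\<close>, so \<open>y\<close> may be replaced by \<open>p\<close>.\<close>
    obtain p where p: "p \<in> W" "\<And>z. z \<in> W \<Longrightarrow> y \<bullet> z = p \<bullet> z"
      by (rule riesz_closed_subspace[OF sub \<open>closed W\<close>, of "\<lambda>z. y \<bullet> z" "norm y"])
        (auto simp: inner_simps Cauchy_Schwarz_ineq2)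
    have "x m \<bullet> y = x m \<bullet> p" for m using p(2)[OF xW[of m]] by (simp add: inner_commute)
    moreover have "l \<bullet> y = l \<bullet> p" using p(2)[OF l(1)] by (simp add: inner_commute)
    ultimately show ?thesis using lim[OF p(1)] l(2)[OF p(1)] by simp
  qed
  with r(1) show ?thesis using that by blast
qed

text \<open>Weak lower semicontinuity of the squared norm, from expanding
  \<open>0 \<le> (norm (x n - l))\<^sup>2\<close>; testing with the limit itself suffices.\<close>

lemma norm_le_of_weak_limit:
  fixes x :: "nat \<Rightarrow> 'a::real_inner"
  assumes "(\<lambda>n. x n \<bullet> l) \<longlonglongrightarrow> l \<bullet> l" and e: "e > 0"
  shows "\<forall>\<^sub>F n in sequentially. (norm l)\<^sup>2 - e < (norm (x n))\<^sup>2"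
proof -
  have "\<forall>\<^sub>F n in sequentially. l \<bullet> l - e/2 < x n \<bullet> l"
    using order_tendstoD(1)[OF assms(1), of "l \<bullet> l - e/2"] e by simp
  then show ?thesis
  proof eventually_elim
    case (elim n)
    have "0 \<le> (norm (x n - l))\<^sup>2" by simp
    then have "0 \<le> (norm (x n))\<^sup>2 + (norm l)\<^sup>2 - 2 * (x n \<bullet> l)"
      by (simp add: power2_norm_eq_inner inner_simps inner_commute)
    with elim show ?case by (simp add: power2_norm_eq_inner)
  qed
qed

text \<open>The Radon-Riesz property: in the expansion of \<open>(norm (x n - l))\<^sup>2\<close>
  every term converges, and the limits cancel.\<close>

lemma weak_convergence_imp_strong:
  fixes x :: "nat \<Rightarrow> 'a::real_inner"
  assumes w: "(\<lambda>n. x n \<bullet> l) \<longlonglongrightarrow> l \<bullet> l" and n: "(\<lambda>n. (norm (x n))\<^sup>2) \<longlonglongrightarrow> (norm l)\<^sup>2"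
  shows "x \<longlonglongrightarrow> l"
proof -
  have "(\<lambda>n. (norm (x n))\<^sup>2 - 2 * (x n \<bullet> l) + (norm l)\<^sup>2) \<longlonglongrightarrow> (norm l)\<^sup>2 - 2 * (l \<bullet> l) + (norm l)\<^sup>2"
    by (intro tendsto_intros w n)
  moreover have "(norm (x n))\<^sup>2 - 2 * (x n \<bullet> l) + (norm l)\<^sup>2 = (norm (x n - l))\<^sup>2" for n
    by (simp add: power2_norm_eq_inner inner_simps inner_commute)
  ultimately have "(\<lambda>n. (norm (x n - l))\<^sup>2) \<longlonglongrightarrow> 0" by (simp add: power2_norm_eq_inner)
  from tendsto_real_sqrt[OF this] have "(\<lambda>n. norm (x n - l)) \<longlonglongrightarrow> 0" by simp
  then show ?thesis by (simp add: tendsto_norm_zero_iff LIM_zero_iff)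
qed

section \<open>Completeness of $L^2$\<close>

lemma rep_L2_in_L2_functions: "rep_L2 u \<in> L2_functions"
  using Quotient_rep_reflp[OF Quotient_L2, of u] by (simp add: L2_rel_def)

lemma rep_L2_measurable [measurable]: "rep_L2 u \<in> borel_measurable (lebesgue_on {0..1})"
  using rep_L2_in_L2_functions[of u] by (simp add: L2_functions_def)

lemma rep_L2_square_integrable: "integrable (lebesgue_on {0..1}) (\<lambda>t. (norm (rep_L2 u t))\<^sup>2)"
  using rep_L2_in_L2_functions[of u] by (simp add: L2_functions_def)

lemma rep_abs_L2:
  assumes "f \<in> L2_functions"
  shows "AE t in lebesgue_on {0..1}. rep_L2 (abs_L2 f) t = f t"
  using Quotient_rep_abs[OF Quotient_L2, of f] assms by (simp add: L2_rel_def)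

lemma rep_L2_diff: "AE t in lebesgue_on {0..1}. rep_L2 (u - v) t = rep_L2 u t - rep_L2 v t"
  unfolding minus_L2_def map_fun_apply
  by (intro rep_abs_L2 L2_functions_diff rep_L2_in_L2_functions)

lemma inner_L2_eq: "u \<bullet> v = (LINT t|lebesgue_on {0..1}. rep_L2 u t \<bullet> rep_L2 v t)"
  by (rule inner_L2.rep_eq)

lemma inner_abs_L2:
  assumes "f \<in> L2_functions"
  shows "u \<bullet> abs_L2 f = (LINT t|lebesgue_on {0..1}. rep_L2 u t \<bullet> f t)"
  unfolding inner_L2_eq
proof (rule integral_cong_AE)
  show "(\<lambda>t. rep_L2 u t \<bullet> f t) \<in> borel_measurable (lebesgue_on {0..1})"
    by (intro borel_measurable_integrable L2_functions_inner_integrable rep_L2_in_L2_functions assms)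
  show "AE t in lebesgue_on {0..1}. rep_L2 u t \<bullet> rep_L2 (abs_L2 f) t = rep_L2 u t \<bullet> f t"
    using rep_abs_L2[OF assms] by eventually_elim simp
qed measurable

lemma norm_L2_squared: "(norm u)\<^sup>2 = (LINT t|lebesgue_on {0..1}. (norm (rep_L2 u t))\<^sup>2)"
  by (simp only: power2_norm_eq_inner inner_L2_eq)

lemma nn_integral_L2_dist:
  "(\<integral>\<^sup>+t. ennreal ((norm (rep_L2 u t - rep_L2 v t))\<^sup>2) \<partial>lebesgue_on {0..1}) = ennreal ((dist u v)\<^sup>2)"
proof -
  have "(\<integral>\<^sup>+t. ennreal ((norm (rep_L2 u t - rep_L2 v t))\<^sup>2) \<partial>lebesgue_on {0..1}) =
      (\<integral>\<^sup>+t. ennreal ((norm (rep_L2 (u - v) t))\<^sup>2) \<partial>lebesgue_on {0..1})"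
    by (intro nn_integral_cong_AE) (use rep_L2_diff[of u v] in \<open>eventually_elim, simp\<close>)
  also have "\<dots> = ennreal ((norm (u - v))\<^sup>2)"
    unfolding norm_L2_squared by (intro nn_integral_eq_integral rep_L2_square_integrable) auto
  finally show ?thesis by (simp add: dist_norm)
qed

lemma prob_space_lebesgue_on_01: "prob_space (lebesgue_on {0..1::real})"
  by standard (simp add: emeasure_restrict_space)

text \<open>The core of the Riesz-Fischer theorem. The increments are summable in
  \<open>L\<^sup>1\<close>, so the representatives converge almost everywhere; Fatou's lemma then
  shows that the pointwise limit is also the limit in norm.\<close>

lemma L2_rapidly_Cauchy_converges:
  fixes X :: "nat \<Rightarrow> 'b::euclidean_space L2"
  assumes X: "\<And>n. dist (X (Suc n)) (X n) \<le> (1/2) ^ n"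
  shows "\<exists>l. X \<longlonglongrightarrow> l"
proof -
  interpret prob_space "lebesgue_on {0..1::real}" by (rule prob_space_lebesgue_on_01)
  let ?M = "lebesgue_on {0..1::real}"
  define g where "g n = rep_L2 (X n)" for n
  have [measurable]: "g n \<in> borel_measurable ?M" for n by (simp add: g_def)
  have D: "(\<integral>\<^sup>+t. ennreal (norm (g (Suc n) t - g n t)) \<partial>?M) \<le> ennreal ((1/2) ^ n)" for n
  proof -
    \<comment> \<open>Young's inequality with a weight that balances its two halves: a squared
      distance of at most \<open>(1/4) ^ n\<close>, and the constant integrated over a space of mass
      1, contribute \<open>(1/2) ^ n / 2\<close> each.\<close>
    let ?c = "(2::real) ^ n"
    have "norm y \<le> ?c / 2 * (norm y)\<^sup>2 + 1 / (2 * ?c)" for y :: 'b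
    proof -
      have "0 \<le> (?c * norm y - 1)\<^sup>2" by simp
      then show ?thesis by (simp add: power2_diff field_simps power2_eq_square)
    qed
    then have "(\<integral>\<^sup>+t. ennreal (norm (g (Suc n) t - g n t)) \<partial>?M) \<le>
        (\<integral>\<^sup>+t. ennreal (?c / 2) * ennreal ((norm (g (Suc n) t - g n t))\<^sup>2) + ennreal (1 / (2 * ?c)) \<partial>?M)"
      by (intro nn_integral_mono) (simp flip: ennreal_mult ennreal_plus)
    also have "\<dots> = ennreal (?c / 2) * ennreal ((dist (X (Suc n)) (X n))\<^sup>2) + ennreal (1 / (2 * ?c))"
      using emeasure_space_1
      by (subst nn_integral_add) (auto simp: nn_integral_cmult g_def nn_integral_L2_dist)
    also have "\<dots> \<le> ennreal (?c / 2) * ennreal (((1/2) ^ n)\<^sup>2) + ennreal (1 / (2 * ?c))"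
      by (intro add_mono mult_left_mono ennreal_leI power_mono X) auto
    also have "\<dots> = ennreal ((1/2) ^ n)"
      by (simp flip: ennreal_mult ennreal_plus) (simp add: power2_eq_square field_simps)
    finally show ?thesis .
  qed
  have "(\<integral>\<^sup>+t. (\<Sum>n. ennreal (norm (g (Suc n) t - g n t))) \<partial>?M) =
      (\<Sum>n. \<integral>\<^sup>+t. ennreal (norm (g (Suc n) t - g n t)) \<partial>?M)"
    by (rule nn_integral_suminf) measurable
  also have "\<dots> \<le> (\<Sum>n. ennreal ((1/2) ^ n))" by (intro suminf_le D) auto
  also have "\<dots> = ennreal (\<Sum>n. (1/2) ^ n)"
    by (rule suminf_ennreal2) (auto intro: summable_geometric)
  also have "\<dots> < \<infinity>" by simp
  finally have "AE t in ?M. (\<Sum>n. ennreal (norm (g (Suc n) t - g n t))) \<noteq> \<infinity>"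
    by (intro nn_integral_PInf_AE) (auto simp: less_top)
  then have conv: "AE t in ?M. convergent (\<lambda>n. g n t)"
  proof eventually_elim
    case (elim t)
    then have "summable (\<lambda>n. norm (g (Suc n) t - g n t))"
      by (intro summable_suminf_not_top) (auto simp: top_ennreal_def)
    then have "summable (\<lambda>n. g (Suc n) t - g n t)" by (rule summable_norm_cancel)
    then have "convergent (\<lambda>n. \<Sum>i<n. g (Suc i) t - g i t)"
      by (simp add: summable_iff_convergent)
    then have "convergent (\<lambda>n. g n t - g 0 t)" by (subst (asm) sum_lessThan_telescope)
    then have "convergent (\<lambda>n. (g n t - g 0 t) + g 0 t)"
      by (intro convergent_add convergent_const)
    then show ?case by simp
  qed
  define f where "f t = lim (\<lambda>n. g n t)" for t
  have [measurable]: "f \<in> borel_measurable ?M"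
    unfolding f_def by (rule borel_measurable_lim_metric) simp
  have geo: "dist (X (n + m)) (X m) \<le> 2 * (1/2) ^ m" for n m
  proof -
    have "dist (X (n + m)) (X m) \<le> 2 * (1/2) ^ m - 2 * (1/2) ^ (n + m)"
    proof (induction n)
      case (Suc n)
      have "dist (X (Suc n + m)) (X m) \<le> dist (X (Suc (n + m))) (X (n + m)) + dist (X (n + m)) (X m)"
        using dist_triangle by simp
      also have "\<dots> \<le> (1/2) ^ (n + m) + (2 * (1/2) ^ m - 2 * (1/2) ^ (n + m))"
        by (intro add_mono X Suc)
      finally show ?case by simp
    qed simp
    also have "\<dots> \<le> 2 * (1/2) ^ m" by simp
    finally show ?thesis .
  qed
  \<comment> \<open>Letting \<open>n\<close> tend to infinity in the geometric bound serves twice: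
    it shows that \<open>f - g m\<close> is square integrable, and it gives the rate of convergence
    to the class of \<open>f\<close>.\<close>
  have fatou: "(\<integral>\<^sup>+t. ennreal ((norm (f t - g m t))\<^sup>2) \<partial>?M) \<le> ennreal ((2 * (1/2) ^ m)\<^sup>2)" for m
  proof -
    have "(\<integral>\<^sup>+t. ennreal ((norm (f t - g m t))\<^sup>2) \<partial>?M) =
        (\<integral>\<^sup>+t. liminf (\<lambda>n. ennreal ((norm (g n t - g m t))\<^sup>2)) \<partial>?M)"
    proof (rule nn_integral_cong_AE, use conv in eventually_elim)
      case (elim t)
      then have "(\<lambda>n. g n t) \<longlonglongrightarrow> f t" by (simp add: f_def convergent_LIMSEQ_iff)
      then have "(\<lambda>n. ennreal ((norm (g n t - g m t))\<^sup>2)) \<longlonglongrightarrow> ennreal ((norm (f t - g m t))\<^sup>2)"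
        by (intro tendsto_intros)
      then show ?case by (rule lim_imp_Liminf[OF sequentially_bot, symmetric])
    qed
    also have "\<dots> \<le> liminf (\<lambda>n. \<integral>\<^sup>+t. ennreal ((norm (g n t - g m t))\<^sup>2) \<partial>?M)"
      by (rule nn_integral_liminf) measurable
    also have "\<dots> = liminf (\<lambda>n. ennreal ((dist (X n) (X m))\<^sup>2))"
      by (simp add: g_def nn_integral_L2_dist)
    also have "\<dots> \<le> ennreal ((2 * (1/2) ^ m)\<^sup>2)"
    proof (rule Liminf_le)
      show "\<forall>\<^sub>F n in sequentially. ennreal ((dist (X n) (X m))\<^sup>2) \<le> ennreal ((2 * (1/2) ^ m)\<^sup>2)"
        unfolding eventually_sequentially
      proof (intro exI allI impI ennreal_leI power_mono)
        fix n assume "m \<le> n"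
        then show "dist (X n) (X m) \<le> 2 * (1/2) ^ m" using geo[of "n - m" m] by simp
      qed simp
    qed simp
    finally show ?thesis .
  qed
  have diffL2: "(\<lambda>t. f t - g m t) \<in> L2_functions" for m
    unfolding L2_functions_def
  proof (intro CollectI conjI)
    show "integrable ?M (\<lambda>t. (norm (f t - g m t))\<^sup>2)"
      by (rule integrableI_nonneg) (use fatou[of m] in \<open>auto simp: less_top intro: le_less_trans\<close>)
  qed measurable
  then have fL2: "f \<in> L2_functions"
    using L2_functions_add[OF diffL2[of 0], of "g 0"] by (simp add: g_def rep_L2_in_L2_functions)
  define l where "l = abs_L2 f"
  have "dist (X m) l \<le> 2 * (1/2) ^ m" for m
  proof -
    have "ennreal ((dist l (X m))\<^sup>2) = (\<integral>\<^sup>+t. ennreal ((norm (f t - g m t))\<^sup>2) \<partial>?M)"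
      unfolding nn_integral_L2_dist[symmetric]
      by (intro nn_integral_cong_AE, use rep_abs_L2[OF fL2] in eventually_elim) (simp add: l_def g_def)
    then have "ennreal ((dist l (X m))\<^sup>2) \<le> ennreal ((2 * (1/2) ^ m)\<^sup>2)" using fatou by simp
    then have "(dist l (X m))\<^sup>2 \<le> (2 * (1/2) ^ m)\<^sup>2" by (subst (asm) ennreal_le_iff) auto
    then show ?thesis by (subst dist_commute) (rule power2_le_imp_le, auto)
  qed
  moreover have "(\<lambda>m. 2 * (1/2::real) ^ m) \<longlonglongrightarrow> 2 * 0"
    by (intro tendsto_intros LIMSEQ_power_zero) simp
  ultimately have "(\<lambda>m. dist (X m) l) \<longlonglongrightarrow> 0"
    by (intro Lim_null_comparison[of "\<lambda>m. dist (X m) l" "\<lambda>m. 2 * (1/2) ^ m"]) simp_all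
  then show ?thesis using tendsto_dist_iff[of X l sequentially] by blast
qed

instance L2 :: (euclidean_space) complete_space
proof
  fix X :: "nat \<Rightarrow> 'a L2"
  assume C: "Cauchy X"
  have "\<forall>n. \<exists>N. \<forall>i\<ge>N. \<forall>j\<ge>N. dist (X i) (X j) < (1/2) ^ n"
    using metric_CauchyD[OF C] by simp
  then obtain N where N: "\<And>n i j. i \<ge> N n \<Longrightarrow> j \<ge> N n \<Longrightarrow> dist (X i) (X j) < (1/2) ^ n"
    by metis
  \<comment> \<open>The summand \<open>n\<close> makes \<open>r\<close> strictly increasing, and the
    sum makes \<open>r n\<close> at least \<open>N n\<close>.\<close>
  define r where "r n = n + (\<Sum>i\<le>n. N i)" for n
  have r: "strict_mono r" by (rule strict_monoI_Suc) (simp add: r_def)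
  have rN: "N n \<le> r n" for n
    using member_le_sum[of n "{..n}" N] by (simp add: r_def)
  have rm: "r n \<le> r (Suc n)" for n using strict_mono_leD[OF r, of n "Suc n"] by simp
  have "dist ((X \<circ> r) (Suc n)) ((X \<circ> r) n) \<le> (1/2) ^ n" for n
    using N[of n "r (Suc n)" "r n"] rN[of n] rm[of n] by simp
  then obtain l where "(X \<circ> r) \<longlonglongrightarrow> l" using L2_rapidly_Cauchy_converges by blast
  then show "convergent X"
    using Cauchy_converges_subseq[OF C r] by (auto simp: convergent_def)
qed

section \<open>Absolutely continuous functions\<close>

lemma abs_continuous_on_intervalE:
  assumes ac: "abs_continuous_on_interval a b f" and "\<epsilon> > 0"
  obtains \<delta> where "\<delta> > 0" "\<And>(m::nat) s t. \<forall>i<m. a \<le> s i \<and> s i \<le> t i \<and> t i \<le> b \<Longrightarrow>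
        disjoint_family_on (\<lambda>i. {s i<..<t i}) {..<m} \<Longrightarrow>
        (\<Sum>i<m. t i - s i) < \<delta> \<Longrightarrow> (\<Sum>i<m. dist (f (s i)) (f (t i))) < \<epsilon>"
proof -
  from spec[OF ac[unfolded abs_continuous_on_interval_def], of \<epsilon>] \<open>\<epsilon> > 0\<close>
  obtain \<delta> where \<delta>: "\<delta> > 0" and *: "\<forall>(m::nat) s t.
        (\<forall>i<m. a \<le> s i \<and> s i \<le> t i \<and> t i \<le> b) \<and>
        disjoint_family_on (\<lambda>i. {s i<..<t i}) {..<m} \<and>
        (\<Sum>i<m. t i - s i) < \<delta> \<longrightarrow> (\<Sum>i<m. dist (f (s i)) (f (t i))) < \<epsilon>"
    by blast
  show thesis by (rule that[OF \<delta>]) (use * in blast)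
qed

lemma abs_continuous_on_interval_subset:
  assumes ac: "abs_continuous_on_interval a b f" and cd: "a \<le> c" "d \<le> b"
  shows "abs_continuous_on_interval c d f"
  unfolding abs_continuous_on_interval_def
proof (intro allI impI)
  fix e :: real assume "e > 0"
  obtain \<delta> where "\<delta> > 0" and \<delta>: "\<And>(m::nat) s t. \<forall>i<m. a \<le> s i \<and> s i \<le> t i \<and> t i \<le> b \<Longrightarrow>
        disjoint_family_on (\<lambda>i. {s i<..<t i}) {..<m} \<Longrightarrow>
        (\<Sum>i<m. t i - s i) < \<delta> \<Longrightarrow> (\<Sum>i<m. dist (f (s i)) (f (t i))) < e"
    by (rule abs_continuous_on_intervalE[OF ac \<open>e > 0\<close>], rule that)
  have main: "(\<Sum>i<m. dist (f (s i)) (f (t i))) < e"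
    if st: "\<forall>i<m. c \<le> s i \<and> s i \<le> t i \<and> t i \<le> d"
      and d: "disjoint_family_on (\<lambda>i. {s i<..<t i}) {..<m}" "(\<Sum>i<m. t i - s i) < \<delta>" for m :: nat and s t
  proof (rule \<delta>[OF _ d])
    show "\<forall>i<m. a \<le> s i \<and> s i \<le> t i \<and> t i \<le> b"
    proof (intro allI impI)
      fix i assume "i < m"
      with st have "c \<le> s i \<and> s i \<le> t i \<and> t i \<le> d" by simp
      then show "a \<le> s i \<and> s i \<le> t i \<and> t i \<le> b" using cd by linarith
    qed
  qed
  show "\<exists>\<delta>>0. \<forall>(m::nat) s t. (\<forall>i<m. c \<le> s i \<and> s i \<le> t i \<and> t i \<le> d) \<and>
        disjoint_family_on (\<lambda>i. {s i<..<t i}) {..<m} \<and> (\<Sum>i<m. t i - s i) < \<delta> \<longrightarrow>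
        (\<Sum>i<m. dist (f (s i)) (f (t i))) < e"
    by (intro exI[of _ \<delta>] conjI allI impI \<open>\<delta> > 0\<close>, elim conjE, rule main)
qed

lemma abs_continuous_on_interval_imp_continuous_on:
  assumes "abs_continuous_on_interval a b f"
  shows "continuous_on {a..b} f"
  unfolding continuous_on_iff
proof (intro ballI allI impI)
  fix x and e :: real assume x: "x \<in> {a..b}" and "e > 0"
  obtain \<delta> where "\<delta> > 0" and \<delta>: "\<And>(m::nat) s t. \<forall>i<m. a \<le> s i \<and> s i \<le> t i \<and> t i \<le> b \<Longrightarrow>
        disjoint_family_on (\<lambda>i. {s i<..<t i}) {..<m} \<Longrightarrow>
        (\<Sum>i<m. t i - s i) < \<delta> \<Longrightarrow> (\<Sum>i<m. dist (f (s i)) (f (t i))) < e"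
    by (rule abs_continuous_on_intervalE[OF assms \<open>e > 0\<close>], rule that)
  have "dist (f y) (f x) < e" if "y \<in> {a..b}" "dist y x < \<delta>" for y
  proof -
    have "dist (f (min x y)) (f (max x y)) < e"
      using \<delta>[of 1 "\<lambda>_. min x y" "\<lambda>_. max x y"] x that
      by (auto simp: disjoint_family_on_def dist_real_def)
    then show ?thesis by (auto simp: min_def max_def dist_commute split: if_splits)
  qed
  with \<open>\<delta> > 0\<close> show "\<exists>d>0. \<forall>x'\<in>{a..b}. dist x' x < d \<longrightarrow> dist (f x') (f x) < e" by blast
qed

text \<open>The gauge is fine enough around the exceptional null set for absolute continuity to apply
  to the intervals tagged there.\<close>

lemma fundamental_theorem_of_calculus_abs_continuous:
  fixes f :: "real \<Rightarrow> 'a::euclidean_space"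
  assumes ab: "a \<le> b" and ac: "abs_continuous_on_interval a b f" and S: "negligible S"
    and deriv: "\<And>x. x \<in> {a..b} - S \<Longrightarrow> (f has_vector_derivative g x) (at x within {a..b})"
  shows "(g has_integral (f b - f a)) {a..b}"
proof -
  \<comment> \<open>With value 0 on \<open>S\<close>, a subinterval tagged in \<open>S\<close>
    contributes only the increment of \<open>f\<close> to the error, and absolute continuity
    controls the sum of these increments.\<close>
  define h where "h x = (if x \<in> S then 0 else g x)" for x
  have "(h has_integral (f b - f a)) (cbox a b)"
    unfolding has_integral
  proof (intro allI impI)
    fix e :: real assume e: "e > 0"
    \<comment> \<open>The intervals tagged outside \<open>S\<close> contribute at most
      \<open>e' * (b - a) \<le> e / 2\<close>; the added 2 keeps the denominator positive when
      \<open>a = b\<close>.\<close>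
    define e' where "e' = e / (2 * (b - a) + 2)"
    have e': "e' > 0" using e ab by (simp add: e'_def)
    have "\<forall>x. \<exists>d>0. x \<in> {a..b} - S \<longrightarrow>
         (\<forall>y\<in>{a..b}. norm (y-x) < d \<longrightarrow> norm (f y - f x - (y-x) *\<^sub>R g x) \<le> e' * norm (y-x))"
      using deriv[unfolded has_vector_derivative_def has_derivative_within_alt] e' by (meson zero_less_one)
    then obtain d where d: "\<And>x. 0 < d x"
      "\<And>x y. \<lbrakk>x \<in> {a..b} - S; y \<in> {a..b}; norm (y-x) < d x\<rbrakk>
                        \<Longrightarrow> norm (f y - f x - (y-x) *\<^sub>R g x) \<le> e' * norm (y-x)"
      by metis
    obtain \<delta> where "\<delta> > 0" and \<delta>: "\<And>(m::nat) s t. \<forall>i<m. a \<le> s i \<and> s i \<le> t i \<and> t i \<le> b \<Longrightarrow>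
        disjoint_family_on (\<lambda>i. {s i<..<t i}) {..<m} \<Longrightarrow>
        (\<Sum>i<m. t i - s i) < \<delta> \<Longrightarrow> (\<Sum>i<m. dist (f (s i)) (f (t i))) < e / 2"
      by (rule abs_continuous_on_intervalE[OF ac half_gt_zero[OF e]], rule that)
    have Sl: "S \<in> sets lebesgue" using S by (simp add: negligible_imp_sets)
    obtain U where U: "open U" "S \<subseteq> U" "(U - S) \<in> lmeasurable" "emeasure lebesgue (U - S) < ennreal \<delta>"
      using sets_lebesgue_outer_open[OF Sl \<open>\<delta> > 0\<close>] by blast
    have Um: "U \<in> lmeasurable"
      using fmeasurable.Un[OF U(3), of S] S U(2) by (simp add: Un_absorb2 negligible_imp_measurable)
    have Umd: "measure lebesgue U < \<delta>"
    proof -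
      have "measure lebesgue U \<le> measure lebesgue (U - S) + measure lebesgue S"
        using measure_Un_le[of "U - S" lebesgue S] U Sl by (simp add: Un_absorb2)
      also have "\<dots> < \<delta>"
        using U(3,4) S \<open>\<delta> > 0\<close> emeasure_eq_measure2[OF U(3)]
        by (simp add: negligible_imp_measure0 ennreal_less_iff)
      finally show ?thesis .
    qed
    define G where "G x = (if x \<in> S then U else ball x (d x))" for x
    have "gauge G" using U(1,2) d(1) by (auto simp: gauge_def G_def)
    moreover have "norm ((\<Sum>(x,K)\<in>p. measure lborel K *\<^sub>R h x) - (f b - f a)) < e"
      if p: "p tagged_division_of cbox a b" "G fine p" for p
    proof -
      have ptag: "p tagged_division_of {a..b}" using p(1) by simp
      have fin: "finite p" using ptag by auto
      note pD = tagged_division_ofD[OF ptag]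
      have K: "\<exists>u v. K = {u..v} \<and> u \<le> x \<and> x \<le> v \<and> a \<le> u \<and> v \<le> b" if xK: "(x, K) \<in> p" for x K
      proof -
        obtain u v where "K = {u..v}" using pD(4)[OF xK] by auto
        then show ?thesis using pD(2,3)[OF xK] by auto
      qed
      define A where "A = {(x,K) \<in> p. x \<in> S}"
      have A: "A \<subseteq> p" "finite A" using fin by (auto simp: A_def intro: finite_subset)
      define c where "c q = norm (case q of (x,K) \<Rightarrow> measure lborel K *\<^sub>R h x - (f (Sup K) - f (Inf K)))" for q
      have "f b - f a = (\<Sum>(x,K)\<in>p. f(Sup K) - f(Inf K))" and ba: "b - a = (\<Sum>(x,K)\<in>p. Sup K - Inf K)"
        using additive_tagged_division_1[OF ab ptag, of f] additive_tagged_division_1[OF ab ptag, of "\<lambda>x. x"]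
        by auto
      then have "(\<Sum>(x,K)\<in>p. measure lborel K *\<^sub>R h x) - (f b - f a) =
          (\<Sum>(x,K)\<in>p. measure lborel K *\<^sub>R h x - (f (Sup K) - f (Inf K)))"
        by (simp add: sum_subtractf split_def)
      then have "norm ((\<Sum>(x,K)\<in>p. measure lborel K *\<^sub>R h x) - (f b - f a)) \<le> sum c p"
        unfolding c_def by (simp only:) (rule norm_sum)
      also have "\<dots> = sum c (p - A) + sum c A"
        using sum.subset_diff[OF A(1) fin, of c] by simp
      also have "\<dots> < e' * (b - a) + e / 2"
      proof (rule add_le_less_mono)
        have "sum c (p - A) \<le> (\<Sum>(x,K)\<in>p - A. e' * (Sup K - Inf K))"
        proof (rule sum_mono, safe)
          fix x K assume xK: "(x, K) \<in> p" "(x, K) \<notin> A"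
          obtain u v where uv: "K = {u..v}" "u \<le> x" "x \<le> v" "a \<le> u" "v \<le> b" using K[OF xK(1)] by blast
          have xS: "x \<notin> S" using xK by (simp add: A_def)
          then have "K \<subseteq> ball x (d x)" using fineD[OF p(2) xK(1)] by (simp add: G_def)
          then have "norm (u - x) < d x" "norm (v - x) < d x"
            using uv subsetD[of K "ball x (d x)" u] subsetD[of K "ball x (d x)" v]
            by (auto simp: dist_real_def abs_minus_commute)
          then have "norm (f u - f x - (u - x) *\<^sub>R g x) \<le> e' * norm (u - x)"
            "norm (f v - f x - (v - x) *\<^sub>R g x) \<le> e' * norm (v - x)"
            using d(2)[of x u] d(2)[of x v] uv xS by auto
          moreover have "(v - u) *\<^sub>R g x - (f v - f u) =
            (f u - f x - (u - x) *\<^sub>R g x) - (f v - f x - (v - x) *\<^sub>R g x)"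
            by (simp add: algebra_simps)
          ultimately have "norm ((v - u) *\<^sub>R g x - (f v - f u)) \<le> e' * norm (u - x) + e' * norm (v - x)"
            by (simp only:) (rule order_trans[OF norm_triangle_ineq4], rule add_mono)
          also have "\<dots> = e' * (v - u)" using uv by (simp add: algebra_simps)
          finally show "c (x, K) \<le> e' * (Sup K - Inf K)"
            using uv xS by (simp add: c_def h_def)
        qed
        also have "\<dots> \<le> (\<Sum>(x,K)\<in>p. e' * (Sup K - Inf K))"
        proof (rule sum_mono2)
          fix q assume "q \<in> p - (p - A)"
          then show "0 \<le> (case q of (x, K) \<Rightarrow> e' * (Sup K - Inf K))"
            using K e' by (cases q) fastforce
        qed (use fin in auto)
        also have "\<dots> = e' * (b - a)" unfolding ba sum_distrib_left by (simp add: split_def)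
        finally show "sum c (p - A) \<le> e' * (b - a)" .
      next
        \<comment> \<open>Absolute continuity is formulated for families indexed by an initial
          segment of the naturals, so the pairs tagged in \<open>S\<close> are enumerated.\<close>
        obtain \<sigma> where \<sigma>: "bij_betw \<sigma> {..<card A} A"
          using ex_bij_betw_nat_finite[OF A(2)] by (auto simp: atLeast0LessThan)
        define s where "s i = Inf (snd (\<sigma> i))" for i
        define t where "t i = Sup (snd (\<sigma> i))" for i
        have \<sigma>A: "\<sigma> i \<in> A" if "i < card A" for i
          using \<sigma> that by (auto simp: bij_betw_def)
        have st: "snd (\<sigma> i) = {s i..t i} \<and> a \<le> s i \<and> s i \<le> t i \<and> t i \<le> b \<and> {s i..t i} \<subseteq> U"
          if i: "i < card A" for i
        proof -
          obtain x L where xL: "\<sigma> i = (x, L)" by fastforce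
          then have L: "(x, L) \<in> p" "x \<in> S" using \<sigma>A[OF i] by (auto simp: A_def)
          then have "L \<subseteq> U" using fineD[OF p(2) L(1)] by (simp add: G_def)
          with K[OF L(1)] show ?thesis by (auto simp: s_def t_def xL)
        qed
        have disj: "disjoint_family_on (\<lambda>i. {s i<..<t i}) {..<card A}"
          unfolding disjoint_family_on_def
        proof (intro ballI impI)
          fix i j assume ij: "i \<in> {..<card A}" "j \<in> {..<card A}" "i \<noteq> j"
          then have "\<sigma> i \<noteq> \<sigma> j" using \<sigma> by (auto simp: bij_betw_def inj_on_def)
          moreover have "\<sigma> i \<in> p" "\<sigma> j \<in> p" using \<sigma>A ij A(1) by auto
          ultimately have "interior (snd (\<sigma> i)) \<inter> interior (snd (\<sigma> j)) = {}"
            using pD(5)[of "fst (\<sigma> i)" "snd (\<sigma> i)" "fst (\<sigma> j)" "snd (\<sigma> j)"] by simp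
          then show "{s i<..<t i} \<inter> {s j<..<t j} = {}" using st ij by simp
        qed
        have "(\<Sum>i<card A. t i - s i) = (\<Sum>i<card A. measure lebesgue {s i<..<t i})"
          using st by (intro sum.cong) auto
        also have "\<dots> = measure lebesgue (\<Union>i<card A. {s i<..<t i})"
        proof (rule measure_finite_Union[symmetric, OF _ _ disj])
          fix i assume "i \<in> {..<card A}"
          then have "s i \<le> t i" using st by simp
          then show "emeasure lebesgue {s i<..<t i} \<noteq> \<infinity>" by simp
        qed auto
        also have "\<dots> \<le> measure lebesgue U"
          using st Um by (intro measure_mono_fmeasurable) fastforce+
        also have "\<dots> < \<delta>" by (rule Umd)
        finally have "(\<Sum>i<card A. dist (f (s i)) (f (t i))) < e / 2"
          by (intro \<delta> disj) (use st in auto)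
        also have "(\<Sum>i<card A. dist (f (s i)) (f (t i))) = (\<Sum>i<card A. c (\<sigma> i))"
        proof (rule sum.cong[OF refl])
          fix i assume "i \<in> {..<card A}"
          then have "\<sigma> i \<in> A" using \<sigma>A by simp
          then show "dist (f (s i)) (f (t i)) = c (\<sigma> i)"
            by (cases "\<sigma> i") (auto simp: c_def s_def t_def h_def A_def dist_norm norm_minus_commute)
        qed
        also have "\<dots> = sum c A" by (rule sum.reindex_bij_betw[OF \<sigma>])
        finally show "sum c A < e / 2" .
      qed
      also have "e' * (b - a) + e / 2 \<le> e"
        using ab e by (simp add: e'_def field_simps)
      finally show ?thesis .
    qed
    ultimately show "\<exists>\<gamma>. gauge \<gamma> \<and> (\<forall>\<D>. \<D> tagged_division_of cbox a b \<and> \<gamma> fine \<D> \<longrightarrow>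
        norm ((\<Sum>(x,k)\<in>\<D>. measure lborel k *\<^sub>R h x) - (f b - f a)) < e)"
      by (intro exI[of _ G] conjI allI impI) simp_all
  qed
  then have "(h has_integral (f b - f a)) {a..b}" by simp
  then show ?thesis
    by (rule has_integral_spike[OF S, rotated]) (simp add: h_def)
qed

text \<open>Lebesgue differentiation, for any gauge-integrable function. \<open>E k\<close> consists
  of the points whose difference quotient is wrong by more than \<open>1 / Suc k\<close> at
  arbitrarily small scales. Vitali's theorem covers it, up to a null set, by disjoint bad segments;
  each is no longer than \<open>Suc k\<close> times its deviation, and Henstock's lemma makes the
  total deviation arbitrarily small.\<close>

lemma indefinite_integral_has_vector_derivative_ae:
  fixes f :: "real \<Rightarrow> 'a::euclidean_space"
  assumes f: "f integrable_on {a..b}"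
  obtains S where "negligible S"
    "\<And>x. x \<in> {a..b} - S \<Longrightarrow> ((\<lambda>t. integral {a..t} f) has_vector_derivative f x) (at x within {a..b})"
proof -
  define \<Phi> where "\<Phi> t = integral {a..t} f" for t
  define bad where "bad k x y \<longleftrightarrow> x \<in> {a..b} \<and> y \<in> {a..b} \<and> x \<noteq> y \<and>
     norm (\<Phi> y - \<Phi> x - (y - x) *\<^sub>R f x) > \<bar>y - x\<bar> / real (Suc k)" for k x y
  define E where "E k = {x \<in> {a..b}. \<forall>d>0. \<exists>y. bad k x y \<and> \<bar>y - x\<bar> < d}" for k
  have \<Phi>_diff: "\<Phi> (max x y) - \<Phi> (min x y) = integral {min x y .. max x y} f"
    if "x \<in> {a..b}" "y \<in> {a..b}" for x y
  proof -
    have "f integrable_on {a..max x y}"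
      using that by (intro integrable_subinterval_real[OF f]) auto
    then show ?thesis
      unfolding \<Phi>_def using that
        Henstock_Kurzweil_Integration.integral_combine[of a "min x y" "max x y" f]
      by (auto simp: algebra_simps)
  qed
  have neg: "negligible (E k)" for k
    unfolding negligible_outer_le
  proof (intro allI impI)
    fix e :: real assume e: "e > 0"
    have "f integrable_on cbox a b" using f by simp
    \<comment> \<open>The division by \<open>Suc k\<close> offsets the factor between the length of
      a bad segment and its deviation.\<close>
    moreover have "e / real (Suc k) > 0" using e by simp
    ultimately have "\<exists>\<gamma>. gauge \<gamma> \<and> (\<forall>p. p tagged_partial_division_of (cbox a b) \<and> \<gamma> fine p \<longrightarrow>
             (\<Sum>(x,K)\<in>p. norm(measure lborel K *\<^sub>R f x - integral K f)) < e / real (Suc k))"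
      by (rule Henstock_lemma) blast
    then obtain \<gamma> where "gauge \<gamma>"
      and \<gamma>: "\<And>p. \<lbrakk>p tagged_partial_division_of (cbox a b); \<gamma> fine p\<rbrakk> \<Longrightarrow>
             (\<Sum>(x,K)\<in>p. norm(measure lborel K *\<^sub>R f x - integral K f)) < e / real (Suc k)"
      by blast
    define seg where "seg i = {min (fst i) (snd i)..max (fst i) (snd i)}" for i :: "real \<times> real"
    define J where "J = {i. bad k (fst i) (snd i) \<and> seg i \<subseteq> \<gamma> (fst i)}"
    define c where "c i = (fst i + snd i) / 2" for i :: "real \<times> real"
    define r where "r i = \<bar>fst i - snd i\<bar> / 2" for i :: "real \<times> real"
    \<comment> \<open>Vitali's theorem is about balls: a segment is the ball around its midpoint,
      while its tag for Henstock's lemma is the endpoint \<open>fst i\<close>.\<close>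
    have cb: "cball (c i) (r i) = seg i" for i
      by (auto simp: c_def r_def seg_def cball_def dist_real_def min_def max_def abs_if field_simps split: if_splits)
    have rpos: "0 < r i" if "i \<in> J" for i using that by (auto simp: J_def bad_def r_def)
    have cov: "\<exists>i. i \<in> J \<and> x \<in> cball (c i) (r i) \<and> r i < d" if x: "x \<in> E k" and d: "0 < d" for x d
    proof -
      have "open (\<gamma> x)" "x \<in> \<gamma> x" using \<open>gauge \<gamma>\<close> by (auto simp: gauge_def)
      then obtain \<rho> where \<rho>: "\<rho> > 0" "ball x \<rho> \<subseteq> \<gamma> x" by (meson open_contains_ball)
      obtain y where y: "bad k x y" "\<bar>y - x\<bar> < min d \<rho>"
      proof -
        have "0 < min d \<rho>" using d \<rho>(1) by simp
        then show ?thesis using x that unfolding E_def by blast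
      qed
      have "seg (x, y) \<subseteq> ball x \<rho>" using y(2) by (auto simp: seg_def dist_real_def)
      then have "(x, y) \<in> J" using y(1) \<rho>(2) by (auto simp: J_def)
      moreover have "x \<in> cball (c (x,y)) (r (x,y))" unfolding cb by (auto simp: seg_def)
      ultimately show ?thesis using y(2) d by (intro exI[of _ "(x,y)"]) (auto simp: r_def)
    qed
    have "\<exists>C. countable C \<and> C \<subseteq> J \<and>
      pairwise (\<lambda>i j. disjnt (cball (c i) (r i)) (cball (c j) (r j))) C \<and>
      negligible (E k - (\<Union>i\<in>C. cball (c i) (r i)))"
      by (rule Vitali_covering_theorem_cballs[where K=J and r=r and S="E k" and a=c, OF rpos cov]) blast+
    then obtain C where C: "countable C" "C \<subseteq> J"
      "pairwise (\<lambda>i j. disjnt (cball (c i) (r i)) (cball (c j) (r j))) C"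
      "negligible (E k - (\<Union>i\<in>C. cball (c i) (r i)))"
      by blast
    have bound: "measure lebesgue (\<Union>i\<in>D. seg i) \<le> e" if D: "D \<subseteq> C" "finite D" for D
    proof -
      define p where "p = (\<lambda>i. (fst i, seg i)) ` D"
      have DJ: "D \<subseteq> J" using D C by blast
      have disj: "disjnt (seg i) (seg j)" if "i \<in> D" "j \<in> D" "i \<noteq> j" for i j
        using C(3) that D(1) unfolding cb by (auto simp: pairwise_def)
      have "p tagged_partial_division_of (cbox a b)"
        unfolding tagged_partial_division_of_def
      proof (intro conjI allI impI)
        show "finite p" using D by (simp add: p_def)
        fix x K assume "(x, K) \<in> p"
        then obtain i where i: "i \<in> D" "x = fst i" "K = seg i" by (auto simp: p_def)
        show "x \<in> K" using i by (auto simp: seg_def)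
        show "K \<subseteq> cbox a b" using i DJ by (auto simp: seg_def J_def bad_def)
        show "\<exists>a b. K = cbox a b" using i by (auto simp: seg_def)
      next
        fix x1 K1 x2 K2 assume "(x1, K1) \<in> p \<and> (x2, K2) \<in> p \<and> (x1, K1) \<noteq> (x2, K2)"
        then obtain i j where "i \<in> D" "j \<in> D" "i \<noteq> j" "K1 = seg i" "K2 = seg j"
          by (auto simp: p_def)
        then show "interior K1 \<inter> interior K2 = {}"
          using disj[of i j] interior_subset unfolding disjnt_def by blast
      qed
      moreover have "\<gamma> fine p" using DJ by (auto simp: p_def J_def intro!: fineI)
      ultimately have *: "(\<Sum>(x,K)\<in>p. norm (measure lborel K *\<^sub>R f x - integral K f)) < e / real (Suc k)"
        by (rule \<gamma>)
      have inj: "inj_on (\<lambda>i. (fst i, seg i)) D"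
      proof (rule inj_onI, rule ccontr)
        fix i j assume "i \<in> D" "j \<in> D" "(fst i, seg i) = (fst j, seg j)" "i \<noteq> j"
        then have "seg i = {}" using disj[of i j] by (simp add: disjnt_def)
        then show False by (simp add: seg_def)
      qed
      have "measure lebesgue (\<Union>i\<in>D. seg i) = (\<Sum>i\<in>D. measure lebesgue (seg i))"
      proof (rule measure_finite_Union[OF D(2)])
        show "seg ` D \<subseteq> sets lebesgue" by (auto simp: seg_def)
        show "disjoint_family_on seg D"
          unfolding disjoint_family_on_def using disj unfolding disjnt_def by blast
        show "emeasure lebesgue (seg i) \<noteq> \<infinity>" for i by (simp add: seg_def)
      qed
      also have "\<dots> \<le> (\<Sum>i\<in>D. real (Suc k) * norm (measure lborel (seg i) *\<^sub>R f (fst i) - integral (seg i) f))"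
      proof (rule sum_mono)
        fix i assume "i \<in> D"
        then have b: "bad k (fst i) (snd i)" using DJ by (auto simp: J_def)
        have m: "measure lebesgue (seg i) = \<bar>snd i - fst i\<bar>" "measure lborel (seg i) = \<bar>snd i - fst i\<bar>"
          unfolding seg_def by (simp_all add: min_def max_def)
        have "norm (\<Phi> (snd i) - \<Phi> (fst i) - (snd i - fst i) *\<^sub>R f (fst i)) =
            norm (measure lborel (seg i) *\<^sub>R f (fst i) - integral (seg i) f)"
        proof (cases "fst i \<le> snd i")
          case True
          then show ?thesis
            using \<Phi>_diff[of "fst i" "snd i"] b
            by (simp add: m seg_def bad_def norm_minus_commute)
        next
          case False
          then have "\<Phi> (fst i) - \<Phi> (snd i) = integral (seg i) f"
            using \<Phi>_diff[of "fst i" "snd i"] b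
            by (simp add: seg_def bad_def)
          then show ?thesis using False by (simp add: m algebra_simps)
        qed
        with b have "\<bar>snd i - fst i\<bar> / real (Suc k) < norm (measure lborel (seg i) *\<^sub>R f (fst i) - integral (seg i) f)"
          by (simp add: bad_def)
        then show "measure lebesgue (seg i) \<le> real (Suc k) * norm (measure lborel (seg i) *\<^sub>R f (fst i) - integral (seg i) f)"
          unfolding m by (simp add: field_simps)
      qed
      also have "\<dots> = real (Suc k) * (\<Sum>(x,K)\<in>p. norm (measure lborel K *\<^sub>R f x - integral K f))"
        unfolding p_def sum.reindex[OF inj] by (simp add: sum_distrib_left)
      also have "\<dots> \<le> real (Suc k) * (e / real (Suc k))"
        using * by (intro mult_left_mono) auto
      finally show ?thesis by simp
    qed
    have segm: "seg i \<in> lmeasurable" for i by (simp add: seg_def)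
    have T: "(\<Union>i\<in>C. seg i) \<in> lmeasurable" "measure lebesgue (\<Union>i\<in>C. seg i) \<le> e"
      using fmeasurable_UN_bound[OF C(1) segm bound] measure_UN_bound[OF C(1) segm bound] by auto
    show "\<exists>T. E k \<subseteq> T \<and> T \<in> lmeasurable \<and> measure lebesgue T \<le> e"
    proof (intro exI[of _ "(\<Union>i\<in>C. seg i) \<union> (E k - (\<Union>i\<in>C. seg i))"] conjI)
      have n: "negligible (E k - (\<Union>i\<in>C. seg i))" using C(4) by (simp add: cb)
      then show "(\<Union>i\<in>C. seg i) \<union> (E k - (\<Union>i\<in>C. seg i)) \<in> lmeasurable"
        by (intro fmeasurable.Un[OF T(1)] negligible_imp_measurable)
      have "measure lebesgue ((\<Union>i\<in>C. seg i) \<union> (E k - (\<Union>i\<in>C. seg i))) \<le>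
         measure lebesgue (\<Union>i\<in>C. seg i) + measure lebesgue (E k - (\<Union>i\<in>C. seg i))"
        using T n by (intro measure_Un_le) (auto intro: fmeasurableD negligible_imp_sets)
      then show "measure lebesgue ((\<Union>i\<in>C. seg i) \<union> (E k - (\<Union>i\<in>C. seg i))) \<le> e"
        using T n by (simp add: negligible_imp_measure0)
    qed auto
  qed
  show thesis
  proof (rule that[of "\<Union>k. E k"])
    show "negligible (\<Union>k. E k)" using neg by (intro negligible_countable_Union) auto
    fix x assume x: "x \<in> {a..b} - (\<Union>k. E k)"
    have "(\<Phi> has_vector_derivative f x) (at x within {a..b})"
      unfolding has_vector_derivative_def has_derivative_within_alt
    proof (intro conjI allI impI bounded_linear_scaleR_left)
      fix e :: real assume "e > 0"
      then obtain k where k: "inverse (real (Suc k)) < e" using reals_Archimedean by blast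
      from x obtain d where d: "d > 0" "\<And>y. bad k x y \<Longrightarrow> \<not> \<bar>y - x\<bar> < d"
        unfolding E_def by blast
      show "\<exists>d>0. \<forall>y\<in>{a..b}. norm (y - x) < d \<longrightarrow>
          norm (\<Phi> y - \<Phi> x - (y - x) *\<^sub>R f x) \<le> e * norm (y - x)"
      proof (intro exI[of _ d] conjI ballI impI \<open>d > 0\<close>)
        fix y assume y: "y \<in> {a..b}" "norm (y - x) < d"
        then have nb: "\<not> bad k x y" using d(2) by force
        show "norm (\<Phi> y - \<Phi> x - (y - x) *\<^sub>R f x) \<le> e * norm (y - x)"
        proof (cases "x = y")
          case False
          then have "norm (\<Phi> y - \<Phi> x - (y - x) *\<^sub>R f x) \<le> inverse (real (Suc k)) * \<bar>y - x\<bar>"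
            using nb x y by (auto simp: bad_def divide_inverse mult.commute)
          also have "\<dots> \<le> e * \<bar>y - x\<bar>" using k by (intro mult_right_mono) auto
          finally show ?thesis by simp
        qed simp
      qed
    qed
    then show "((\<lambda>t. integral {a..t} f) has_vector_derivative f x) (at x within {a..b})"
      by (simp add: \<Phi>_def[abs_def])
  qed
qed

text \<open>The intervals may share endpoints, so the integrals are restricted to open intervals; at
  each point at most one of the restrictions \<open>\<kappa> i\<close> is then nonzero.\<close>

lemma sum_integral_disjoint_le:
  fixes h :: "real \<Rightarrow> real" and m :: nat
  assumes h: "h integrable_on {a..b}" and h0: "\<And>x. x \<in> {a..b} \<Longrightarrow> 0 \<le> h x"
    and st: "\<And>i. i < m \<Longrightarrow> a \<le> s i \<and> s i \<le> t i \<and> t i \<le> b"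
    and disj: "disjoint_family_on (\<lambda>i. {s i<..<t i}) {..<m}"
  shows "(\<Sum>i<m. integral {s i..t i} h) \<le> integral {a..b} h"
proof -
  define \<kappa> where "\<kappa> i x = (if x \<in> {s i<..<t i} then h x else 0)" for i x
  have sub: "{s i<..<t i} \<inter> {a..b} = {s i<..<t i}" if "i < m" for i using st[OF that] by auto
  have "h integrable_on {s i<..<t i}" if "i < m" for i
    unfolding integrable_on_open_interval_real
    using st[OF that] by (intro integrable_subinterval_real[OF h]) auto
  then have int: "\<kappa> i integrable_on {a..b}" if "i < m" for i
    unfolding \<kappa>_def integrable_restrict_Int using sub[OF that] that by simp
  have "(\<Sum>i<m. integral {s i..t i} h) = (\<Sum>i<m. integral {a..b} (\<kappa> i))"
    unfolding \<kappa>_def Henstock_Kurzweil_Integration.integral_restrict_Int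
    by (intro sum.cong refl) (use sub in \<open>simp add: integral_open_interval_real\<close>)
  also have "\<dots> = integral {a..b} (\<lambda>x. \<Sum>i<m. \<kappa> i x)"
    using int by (intro Henstock_Kurzweil_Integration.integral_sum[symmetric]) auto
  also have "\<dots> \<le> integral {a..b} h"
  proof (rule integral_le)
    show "(\<lambda>x. \<Sum>i<m. \<kappa> i x) integrable_on {a..b}" using int by (intro integrable_sum) auto
    fix x assume x: "x \<in> {a..b}"
    show "(\<Sum>i<m. \<kappa> i x) \<le> h x"
    proof (cases "\<exists>j<m. x \<in> {s j<..<t j}")
      case True
      then obtain j where j: "j < m" "x \<in> {s j<..<t j}" by blast
      then have "\<kappa> i x = (if i = j then h x else 0)" if "i < m" for i
        using disjoint_family_onD[OF disj, of i j] that unfolding \<kappa>_def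
        by (cases "i = j") (simp, force)
      then have "(\<Sum>i<m. \<kappa> i x) = (\<Sum>i<m. if i = j then h x else 0)" by (intro sum.cong) auto
      then show ?thesis using j by simp
    next
      case False
      then have "(\<Sum>i<m. \<kappa> i x) = 0" by (intro sum.neutral) (auto simp: \<kappa>_def)
      then show ?thesis using h0[OF x] by simp
    qed
  qed (rule h)
  finally show ?thesis .
qed

section \<open>Integrability of square-integrable functions and absolute continuity of their
  primitives\<close>

lemma L2_functions_integrable:
  fixes g :: "real \<Rightarrow> 'a::euclidean_space"
  assumes "g \<in> L2_functions"
  shows "integrable (lebesgue_on {0..1}) g"
proof -
  interpret prob_space "lebesgue_on {0..1::real}" by (rule prob_space_lebesgue_on_01)
  have m: "g \<in> borel_measurable (lebesgue_on {0..1})"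
    and sq: "integrable (lebesgue_on {0..1}) (\<lambda>t. (norm (g t))\<^sup>2)"
    using assms by (auto simp: L2_functions_def)
  have le: "norm y \<le> 1 + (norm y)\<^sup>2" for y :: 'a
  proof -
    have "0 \<le> (norm y - 1)\<^sup>2" by simp
    then have "2 * norm y \<le> (norm y)\<^sup>2 + 1" by (simp add: power2_diff)
    with norm_ge_zero[of y] show ?thesis by linarith
  qed
  show ?thesis
  proof (rule Bochner_Integration.integrable_bound[OF _ m])
    show "integrable (lebesgue_on {0..1}) (\<lambda>t. 1 + (norm (g t))\<^sup>2)"
      using sq by (intro Bochner_Integration.integrable_add) simp_all
    show "AE t in lebesgue_on {0..1}. norm (g t) \<le> norm (1 + (norm (g t))\<^sup>2)"
      by (rule AE_I2, rule order_trans[OF le]) simp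
  qed
qed

lemma L2_functions_integrable_on:
  fixes g :: "real \<Rightarrow> 'a::euclidean_space"
  assumes "g \<in> L2_functions" "{s..t} \<subseteq> {0..1}"
  shows "g integrable_on {s..t}" "(\<lambda>x. norm (g x)) integrable_on {s..t}"
    "(\<lambda>x. (norm (g x))\<^sup>2) integrable_on {s..t}"
proof -
  have "integrable (lebesgue_on {0..1}) g" "integrable (lebesgue_on {0..1}) (\<lambda>x. norm (g x))"
    "integrable (lebesgue_on {0..1}) (\<lambda>t. (norm (g t))\<^sup>2)"
    using assms L2_functions_integrable[OF assms(1)] by (auto simp: L2_functions_def)
  from this[THEN integrable_on_lebesgue_on]
  show "g integrable_on {s..t}" "(\<lambda>x. norm (g x)) integrable_on {s..t}"
    "(\<lambda>x. (norm (g x))\<^sup>2) integrable_on {s..t}"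
    using assms(2) by (auto intro: integrable_on_subinterval)
qed

text \<open>Young's inequality with a free weight \<open>\<eta>\<close> takes the place of the
  Cauchy-Schwarz inequality: the bound is additive over disjoint intervals, so it can be summed
  without further estimates.\<close>

lemma norm_integral_L2_le:
  fixes g :: "real \<Rightarrow> 'a::euclidean_space"
  assumes g: "g \<in> L2_functions" and st: "0 \<le> s" "s \<le> t" "t \<le> 1" and "\<eta> > 0"
  shows "norm (integral {s..t} g) \<le> \<eta> / 2 * integral {s..t} (\<lambda>x. (norm (g x))\<^sup>2) + (t - s) / (2 * \<eta>)"
proof -
  have sub: "{s..t} \<subseteq> {0..1}" using st by auto
  note int = L2_functions_integrable_on[OF g sub]
  have le: "norm y \<le> \<eta> / 2 * (norm y)\<^sup>2 + 1 / (2 * \<eta>)" for y :: 'a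
  proof -
    have "0 \<le> (\<eta> * norm y - 1)\<^sup>2" by simp
    then show ?thesis using \<open>\<eta> > 0\<close> by (simp add: power2_diff field_simps power2_eq_square)
  qed
  have q: "(\<lambda>x. \<eta> / 2 * (norm (g x))\<^sup>2) integrable_on {s..t}"
    using integrable_cmul[OF int(3), of "\<eta> / 2"] by simp
  have "norm (integral {s..t} g) \<le> integral {s..t} (\<lambda>x. \<eta> / 2 * (norm (g x))\<^sup>2 + 1 / (2 * \<eta>))"
    by (intro integral_norm_bound_integral int integrable_add q le integrable_const_ivl)
  also have "\<dots> = integral {s..t} (\<lambda>x. \<eta> / 2 * (norm (g x))\<^sup>2) + integral {s..t} (\<lambda>x. 1 / (2 * \<eta>))"
    by (intro Henstock_Kurzweil_Integration.integral_add q integrable_const_ivl)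
  also have "\<dots> = \<eta> / 2 * integral {s..t} (\<lambda>x. (norm (g x))\<^sup>2) + (t - s) / (2 * \<eta>)"
    using st by simp
  finally show ?thesis .
qed

lemma indefinite_integral_L2_abs_continuous:
  fixes g :: "real \<Rightarrow> 'a::euclidean_space"
  assumes g: "g \<in> L2_functions"
  shows "abs_continuous_on_interval 0 1 (\<lambda>t. c + integral {0..t} g)"
  unfolding abs_continuous_on_interval_def
proof (intro allI impI)
  fix e :: real assume e: "e > 0"
  define B where "B = integral {0..1} (\<lambda>x. (norm (g x))\<^sup>2)"
  have B0: "0 \<le> B" unfolding B_def by (intro integral_nonneg L2_functions_integrable_on g) auto
  \<comment> \<open>This weight makes the energy part at most \<open>e / 2\<close>; the admissible
    total length \<open>\<eta> * e\<close> then makes the length part less than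
    \<open>e / 2\<close>.\<close>
  define \<eta> where "\<eta> = e / (B + 1)"
  have \<eta>: "\<eta> > 0" using e B0 by (simp add: \<eta>_def)
  have main: "(\<Sum>i<m. dist (c + integral {0..s i} g) (c + integral {0..t i} g)) < e"
    if st: "\<forall>i<m. 0 \<le> s i \<and> s i \<le> t i \<and> t i \<le> 1"
      and disj: "disjoint_family_on (\<lambda>i. {s i<..<t i}) {..<m}"
      and len: "(\<Sum>i<m. t i - s i) < \<eta> * e" for m :: nat and s t
  proof -
    have "(\<Sum>i<m. dist (c + integral {0..s i} g) (c + integral {0..t i} g)) \<le>
        (\<Sum>i<m. \<eta> / 2 * integral {s i..t i} (\<lambda>x. (norm (g x))\<^sup>2) + (t i - s i) / (2 * \<eta>))"
    proof (rule sum_mono)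
      fix i assume "i \<in> {..<m}"
      then have i: "0 \<le> s i" "s i \<le> t i" "t i \<le> 1" using st by auto
      then have "integral {0..s i} g + integral {s i..t i} g = integral {0..t i} g"
        by (intro Henstock_Kurzweil_Integration.integral_combine L2_functions_integrable_on g) auto
      then have "dist (c + integral {0..s i} g) (c + integral {0..t i} g) = norm (integral {s i..t i} g)"
        by (metis add_diff_cancel_left' dist_add_cancel dist_commute dist_norm)
      then show "dist (c + integral {0..s i} g) (c + integral {0..t i} g) \<le>
          \<eta> / 2 * integral {s i..t i} (\<lambda>x. (norm (g x))\<^sup>2) + (t i - s i) / (2 * \<eta>)"
        using norm_integral_L2_le[OF g i \<eta>] by simp
    qed
    also have "\<dots> = \<eta> / 2 * (\<Sum>i<m. integral {s i..t i} (\<lambda>x. (norm (g x))\<^sup>2)) + (\<Sum>i<m. t i - s i) / (2 * \<eta>)"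
      by (simp add: sum.distrib sum_distrib_left sum_divide_distrib)
    also have "\<dots> < \<eta> / 2 * B + \<eta> * e / (2 * \<eta>)"
    proof (rule add_le_less_mono)
      have "(\<Sum>i<m. integral {s i..t i} (\<lambda>x. (norm (g x))\<^sup>2)) \<le> B"
        unfolding B_def
        by (intro sum_integral_disjoint_le L2_functions_integrable_on g disj) (use st in auto)
      then show "\<eta> / 2 * (\<Sum>i<m. integral {s i..t i} (\<lambda>x. (norm (g x))\<^sup>2)) \<le> \<eta> / 2 * B"
        using \<eta> by (intro mult_left_mono) auto
      show "(\<Sum>i<m. t i - s i) / (2 * \<eta>) < \<eta> * e / (2 * \<eta>)"
        using len \<eta> by (intro divide_strict_right_mono) auto
    qed
    also have "\<dots> \<le> e"
    proof -
      have "\<eta> * B \<le> e" using e B0 by (simp add: \<eta>_def field_simps)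
      moreover have "\<eta> * e / (2 * \<eta>) = e / 2" using \<eta> by simp
      ultimately show ?thesis by linarith
    qed
    finally show ?thesis .
  qed
  have pos: "\<eta> * e > 0" using \<eta> e by simp
  show "\<exists>\<delta>>0. \<forall>(m::nat) s t. (\<forall>i<m. 0 \<le> s i \<and> s i \<le> t i \<and> t i \<le> 1) \<and>
      disjoint_family_on (\<lambda>i. {s i<..<t i}) {..<m} \<and> (\<Sum>i<m. t i - s i) < \<delta> \<longrightarrow>
      (\<Sum>i<m. dist (c + integral {0..s i} g) (c + integral {0..t i} g)) < e"
    by (intro exI[of _ "\<eta> * e"] conjI allI impI pos, elim conjE, rule main)
qed

section \<open>Integrals of $L^2$ functions\<close>

lemma L2_functions_restrict:
  fixes f :: "real \<Rightarrow> 'a::euclidean_space"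
  assumes "f \<in> L2_functions"
  shows "(\<lambda>x. if x \<in> {s..t} then f x else 0) \<in> L2_functions"
  unfolding L2_functions_def
proof (intro CollectI conjI)
  have [measurable]: "f \<in> borel_measurable (lebesgue_on {0..1})"
    and sq: "integrable (lebesgue_on {0..1}) (\<lambda>t. (norm (f t))\<^sup>2)"
    using assms by (auto simp: L2_functions_def)
  have [measurable]: "{s..t} \<inter> {0..1} \<in> sets (lebesgue_on {0..1})"
    by (simp add: sets_restrict_space_iff)
  have "Measurable.pred (lebesgue_on {0..1}) (\<lambda>x. x \<in> {s..t} \<inter> {0..1})" by measurable
  then have [measurable]: "Measurable.pred (lebesgue_on {0..1}) (\<lambda>x. x \<in> {s..t})"
    by (rule measurable_cong[THEN iffD1, rotated]) simp
  show "(\<lambda>x. if x \<in> {s..t} then f x else 0) \<in> borel_measurable (lebesgue_on {0..1})"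
    by measurable
  then show "integrable (lebesgue_on {0..1}) (\<lambda>x. (norm (if x \<in> {s..t} then f x else 0))\<^sup>2)"
    by (intro Bochner_Integration.integrable_bound[OF sq]) auto
qed

lemma integral_eq_lebesgue_on:
  fixes h :: "real \<Rightarrow> real"
  assumes "integrable (lebesgue_on {0..1}) (\<lambda>x. if x \<in> {s..t} then h x else 0)" "{s..t} \<subseteq> {0..1}"
  shows "(LINT x|lebesgue_on {0..1}. (if x \<in> {s..t} then h x else 0)) = integral {s..t} h"
proof -
  have "{s..t} \<inter> {0..1} = {s..t}" using assms(2) by blast
  then show ?thesis
    using lebesgue_integral_eq_integral[OF assms(1)]
    by (simp only: Henstock_Kurzweil_Integration.integral_restrict_Int) simp
qed

text \<open>Turns an integral over a time interval into a product of the control with one fixed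
  element of the Hilbert space, which is the form that weak convergence can be applied to.\<close>

lemma inner_abs_L2_restrict:
  assumes "f \<in> L2_functions" "{s..t} \<subseteq> {0..1}"
  shows "u \<bullet> abs_L2 (\<lambda>x. if x \<in> {s..t} then f x else 0) = integral {s..t} (\<lambda>x. rep_L2 u x \<bullet> f x)"
proof -
  note r = L2_functions_restrict[OF assms(1), of s t]
  have eq: "rep_L2 u x \<bullet> (if x \<in> {s..t} then f x else 0) = (if x \<in> {s..t} then rep_L2 u x \<bullet> f x else 0)" for x
    by simp
  show ?thesis
    using integral_eq_lebesgue_on[of s t "\<lambda>x. rep_L2 u x \<bullet> f x"] assms(2)
      L2_functions_inner_integrable[OF rep_L2_in_L2_functions r, of u]
    unfolding inner_abs_L2[OF r] eq by simp
qed

text \<open>The Cauchy-Schwarz inequality of the Hilbert space for the two functions cut off outside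
  \<open>{s..t}\<close>. The work lies in the passage to classes, whose representatives agree with
  the functions only almost everywhere.\<close>

lemma integral_Cauchy_Schwarz:
  fixes f g :: "real \<Rightarrow> real"
  assumes f: "f \<in> L2_functions" and g: "g \<in> L2_functions" and st: "{s..t} \<subseteq> {0..1}"
  shows "(integral {s..t} (\<lambda>x. f x * g x))\<^sup>2 \<le> integral {s..t} (\<lambda>x. (f x)\<^sup>2) * integral {s..t} (\<lambda>x. (g x)\<^sup>2)"
proof -
  define R where "R h = abs_L2 (\<lambda>x::real. if x \<in> {s..t} then h x else (0::real))" for h
  have R: "R h \<bullet> R k = integral {s..t} (\<lambda>x. h x * k x)"
    if h: "h \<in> L2_functions" and k: "k \<in> L2_functions" for h k
  proof -
    note hr = L2_functions_restrict[OF h, of s t] and kr = L2_functions_restrict[OF k, of s t]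
    have "R h \<bullet> R k = (LINT x|lebesgue_on {0..1}. rep_L2 (R h) x \<bullet> (if x \<in> {s..t} then k x else 0))"
      unfolding R_def by (rule inner_abs_L2[OF kr])
    also have "\<dots> = (LINT x|lebesgue_on {0..1}. (if x \<in> {s..t} then h x * k x else 0))"
    proof (rule integral_cong_AE)
      show "(\<lambda>x. rep_L2 (R h) x \<bullet> (if x \<in> {s..t} then k x else 0)) \<in> borel_measurable (lebesgue_on {0..1})"
        by (intro borel_measurable_integrable L2_functions_inner_integrable rep_L2_in_L2_functions kr)
      show "(\<lambda>x. if x \<in> {s..t} then h x * k x else 0) \<in> borel_measurable (lebesgue_on {0..1})"
        using borel_measurable_integrable[OF L2_functions_inner_integrable[OF hr kr]]
        by (rule measurable_cong[THEN iffD1, rotated]) simp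
      show "AE x in lebesgue_on {0..1}. rep_L2 (R h) x \<bullet> (if x \<in> {s..t} then k x else 0) =
          (if x \<in> {s..t} then h x * k x else 0)"
        using rep_abs_L2[OF hr] unfolding R_def by eventually_elim simp
    qed
    also have "\<dots> = integral {s..t} (\<lambda>x. h x * k x)"
    proof (rule integral_eq_lebesgue_on[OF _ st])
      show "integrable (lebesgue_on {0..1}) (\<lambda>x. if x \<in> {s..t} then h x * k x else 0)"
        using L2_functions_inner_integrable[OF hr kr]
        by (rule Bochner_Integration.integrable_cong[THEN iffD1, rotated -1]) auto
    qed
    finally show ?thesis .
  qed
  show ?thesis
    using Cauchy_Schwarz_ineq[of "R f" "R g"] by (simp add: R f g power2_eq_square)
qed

lemma integral_norm_rep_L2:
  "integral {0..1} (\<lambda>s. (norm (rep_L2 u s))\<^sup>2) = (norm u)\<^sup>2"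
  unfolding norm_L2_squared
  by (rule lebesgue_integral_eq_integral[symmetric, OF rep_L2_square_integrable]) simp

lemma continuous_on_imp_L2_functions:
  fixes d :: "real \<Rightarrow> 'a::euclidean_space"
  assumes "continuous_on {0..1} d"
  shows "d \<in> L2_functions"
proof -
  interpret prob_space "lebesgue_on {0..1::real}" by (rule prob_space_lebesgue_on_01)
  have m: "d \<in> borel_measurable (lebesgue_on {0..1})"
    using assms by (intro continuous_imp_measurable_on_sets_lebesgue) auto
  obtain B where B: "\<And>t. t \<in> {0..1} \<Longrightarrow> norm (d t) \<le> B"
    using compact_continuous_image[OF assms compact_Icc] by (meson bounded_iff compact_imp_bounded imageI)
  have "AE t in lebesgue_on {0..1}. norm ((norm (d t))\<^sup>2) \<le> B\<^sup>2"
    by (rule AE_I2) (use B in \<open>auto intro: power_mono\<close>)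
  then show ?thesis using m by (auto simp: L2_functions_def intro!: integrable_const_bound)
qed

lemma L2_functions_mult_continuous:
  fixes g :: "real \<Rightarrow> real" and d :: "real \<Rightarrow> 'a::euclidean_space"
  assumes g: "g \<in> L2_functions" and d: "continuous_on {0..1} d"
  shows "(\<lambda>t. g t *\<^sub>R d t) \<in> L2_functions"
proof -
  have m: "d \<in> borel_measurable (lebesgue_on {0..1})" "g \<in> borel_measurable (lebesgue_on {0..1})"
    and sq: "integrable (lebesgue_on {0..1}) (\<lambda>t. (norm (g t))\<^sup>2)"
    using continuous_on_imp_L2_functions[OF d] g by (auto simp: L2_functions_def)
  obtain B where B: "\<And>t. t \<in> {0..1} \<Longrightarrow> norm (d t) \<le> B"
    using compact_continuous_image[OF d compact_Icc] by (meson bounded_iff compact_imp_bounded imageI)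
  have "integrable (lebesgue_on {0..1}) (\<lambda>t. B\<^sup>2 * (norm (g t))\<^sup>2)" using sq by simp
  then have "integrable (lebesgue_on {0..1}) (\<lambda>t. (norm (g t *\<^sub>R d t))\<^sup>2)"
  proof (rule Bochner_Integration.integrable_bound)
    show "AE t in lebesgue_on {0..1}. norm ((norm (g t *\<^sub>R d t))\<^sup>2) \<le> norm (B\<^sup>2 * (norm (g t))\<^sup>2)"
    proof (rule AE_I2)
      fix t assume "t \<in> space (lebesgue_on {0..1::real})"
      then have "(norm (d t))\<^sup>2 \<le> B\<^sup>2" using B by (auto intro: power_mono)
      then show "norm ((norm (g t *\<^sub>R d t))\<^sup>2) \<le> norm (B\<^sup>2 * (norm (g t))\<^sup>2)"
        using mult_right_mono[of "(norm (d t))\<^sup>2" "B\<^sup>2" "(g t)\<^sup>2"]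
        by (simp add: power_mult_distrib mult.commute)
    qed
  qed (use m in measurable)
  then show ?thesis using m by (simp add: L2_functions_def)
qed

lemma L2_functions_norm: "f \<in> L2_functions \<Longrightarrow> (\<lambda>t. norm (f t)) \<in> L2_functions"
  by (auto simp: L2_functions_def)

text \<open>By the Cauchy-Schwarz inequality \<open>d\<^sup>2 \<le> 2 c\<^sup>2 + 2 A \<integral> d\<^sup>2\<close> with \<open>A = \<integral> a\<^sup>2\<close>, which is Gronwall's
  inequality with constant coefficients: no chain rule for absolutely continuous functions is needed.\<close>

lemma gronwall_L2:
  fixes a d :: "real \<Rightarrow> real"
  assumes a: "a \<in> L2_functions" and d: "continuous_on {0..1} d" "\<And>t. t \<in> {0..1} \<Longrightarrow> 0 \<le> d t"
    and c: "0 \<le> c" and le: "\<And>t. t \<in> {0..1} \<Longrightarrow> d t \<le> c + integral {0..t} (\<lambda>s. a s * d s)"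
    and A: "integral {0..1} (\<lambda>s. (a s)\<^sup>2) \<le> A" and t: "t \<in> {0..1}"
  shows "d t \<le> sqrt 2 * exp A * c"
proof -
  define D where "D t = integral {0..t} (\<lambda>s. (d s)\<^sup>2)" for t
  have dd: "continuous_on {0..1} (\<lambda>s. (d s)\<^sup>2)" using d(1) by (intro continuous_intros)
  have dL: "d \<in> L2_functions" by (rule continuous_on_imp_L2_functions[OF d(1)])
  have a2: "(\<lambda>s. (a s)\<^sup>2) integrable_on {s..t}" if "{s..t} \<subseteq> {0..1}" for s t
    using L2_functions_integrable_on(3)[OF a that] by simp
  have A0: "0 \<le> A"
    using A a2[of 0 1] by (intro order_trans[OF _ A] Henstock_Kurzweil_Integration.integral_nonneg) auto
  have D0: "0 \<le> D t" if "t \<in> {0..1}" for t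
    unfolding D_def using that
    by (intro Henstock_Kurzweil_Integration.integral_nonneg integrable_continuous_real continuous_on_subset[OF dd]) auto
  have sq: "(d t)\<^sup>2 \<le> 2 * c\<^sup>2 + 2 * A * D t" if t: "t \<in> {0..1}" for t
  proof -
    have sub: "{0..t} \<subseteq> {0..1}" using t by auto
    have "(integral {0..t} (\<lambda>s. a s * d s))\<^sup>2 \<le> integral {0..t} (\<lambda>s. (a s)\<^sup>2) * D t"
      unfolding D_def by (rule integral_Cauchy_Schwarz[OF a dL sub])
    also have "\<dots> \<le> A * D t"
    proof (rule mult_right_mono[OF _ D0[OF t]])
      have "integral {0..t} (\<lambda>s. (a s)\<^sup>2) \<le> integral {0..1} (\<lambda>s. (a s)\<^sup>2)"
        by (rule integral_subset_le[OF sub a2[OF sub] a2]) auto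
      then show "integral {0..t} (\<lambda>s. (a s)\<^sup>2) \<le> A" using A by linarith
    qed
    finally have I: "(integral {0..t} (\<lambda>s. a s * d s))\<^sup>2 \<le> A * D t" .
    have "(d t)\<^sup>2 \<le> (c + integral {0..t} (\<lambda>s. a s * d s))\<^sup>2"
      using le[OF t] d(2)[OF t] by (intro power_mono)
    also have "\<dots> \<le> 2 * c\<^sup>2 + 2 * (integral {0..t} (\<lambda>s. a s * d s))\<^sup>2"
      using sum_squares_bound[of c "integral {0..t} (\<lambda>s. a s * d s)"] by (simp add: power2_sum)
    finally show ?thesis using I by simp
  qed
  \<comment> \<open>Since \<open>D\<close> has derivative
    \<open>(d t)\<^sup>2 \<le> 2 * c\<^sup>2 + 2 * A * D t\<close>, the exponential is the
    integrating factor that makes \<open>\<phi>\<close> nonincreasing, with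
    \<open>\<phi> 0 = 2 * c\<^sup>2\<close>.\<close>
  define \<phi> where "\<phi> t = (2 * c\<^sup>2 + 2 * A * D t) * exp (- (2 * A * t))" for t
  have Dc: "continuous_on {0..1} D"
    unfolding D_def by (rule indefinite_integral_continuous_1[OF integrable_continuous_real[OF dd]])
  have "\<phi> t \<le> \<phi> 0"
  proof (rule DERIV_nonpos_imp_decreasing_open[where f=\<phi> and a=0 and b=t])
    show "0 \<le> t" using t by simp
    show "continuous_on {0..t} \<phi>"
      unfolding \<phi>_def using t by (intro continuous_intros continuous_on_subset[OF Dc]) auto
    fix x assume x: "0 < x" "x < t"
    then have x1: "x \<in> {0..1}" using t by auto
    have "(D has_real_derivative (d x)\<^sup>2) (at x within {0..1})"
      unfolding D_def by (rule integral_has_real_derivative[OF dd x1])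
    then have "(D has_real_derivative (d x)\<^sup>2) (at x)"
      using x t by (subst (asm) at_within_interior) auto
    then have "(\<phi> has_real_derivative (2 * A * (d x)\<^sup>2) * exp (- (2 * A * x)) +
        (exp (- (2 * A * x)) * (- (2 * A))) * (2 * c\<^sup>2 + 2 * A * D x)) (at x)"
      unfolding \<phi>_def by (auto intro!: derivative_eq_intros)
    moreover have "(2 * A * (d x)\<^sup>2) * exp (- (2 * A * x)) +
        (exp (- (2 * A * x)) * (- (2 * A))) * (2 * c\<^sup>2 + 2 * A * D x) \<le> 0"
    proof -
      have "(2 * A) * (d x)\<^sup>2 \<le> (2 * A) * (2 * c\<^sup>2 + 2 * A * D x)"
        using sq[OF x1] A0 by (intro mult_left_mono) auto
      then have "exp (- (2 * A * x)) * ((2 * A) * (d x)\<^sup>2 - (2 * A) * (2 * c\<^sup>2 + 2 * A * D x)) \<le> 0"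
        by (intro mult_nonneg_nonpos) auto
      then show ?thesis by (simp add: algebra_simps)
    qed
    ultimately show "\<exists>y. (\<phi> has_real_derivative y) (at x) \<and> y \<le> 0" by blast
  qed
  then have "(2 * c\<^sup>2 + 2 * A * D t) * exp (- (2 * A * t)) \<le> 2 * c\<^sup>2"
    by (simp add: \<phi>_def D_def)
  then have "2 * c\<^sup>2 + 2 * A * D t \<le> 2 * c\<^sup>2 * exp (2 * A * t)"
    by (simp add: exp_minus field_simps)
  also have "\<dots> \<le> 2 * c\<^sup>2 * exp (2 * A)"
    using A0 t by (intro mult_left_mono) (auto simp: mult_left_le)
  also have "\<dots> = (sqrt 2 * exp A * c)\<^sup>2"
    unfolding exp_double power_mult_distrib by simp
  finally have "(d t)\<^sup>2 \<le> (sqrt 2 * exp A * c)\<^sup>2" by (rule order_trans[OF sq[OF t]])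
  then show ?thesis by (rule power2_le_imp_le) (use c in simp)
qed

text \<open>The nonstrict modulus passes to the limit \<open>g\<close>, and a finite net of
  \<open>S\<close> then reduces uniform convergence to finitely many points. It is applied to
  primitives in time and to flows in space.\<close>

lemma equicontinuous_pointwise_imp_uniform:
  fixes f :: "nat \<Rightarrow> 'a::metric_space \<Rightarrow> 'b::metric_space"
  assumes S: "compact S"
    and eq: "\<And>e. e > 0 \<Longrightarrow> \<exists>d>0. \<forall>n. \<forall>x\<in>S. \<forall>y\<in>S. dist x y < d \<longrightarrow> dist (f n x) (f n y) \<le> e"
    and lim: "\<And>x. x \<in> S \<Longrightarrow> (\<lambda>n. f n x) \<longlonglongrightarrow> g x" and "e > 0"
  shows "\<forall>\<^sub>F n in sequentially. \<forall>x\<in>S. dist (f n x) (g x) < e"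
proof -
  obtain d where d: "d > 0" "\<And>n x y. x \<in> S \<Longrightarrow> y \<in> S \<Longrightarrow> dist x y < d \<Longrightarrow> dist (f n x) (f n y) \<le> e / 4"
    using eq[of "e / 4"] \<open>e > 0\<close> by auto
  have g: "dist (g x) (g y) \<le> e / 4" if "x \<in> S" "y \<in> S" "dist x y < d" for x y
    using tendsto_dist[OF lim[OF that(1)] lim[OF that(2)]] d(2)[OF that]
    by (intro LIMSEQ_le_const2) auto
  obtain k where k: "finite k" "k \<subseteq> S" "S \<subseteq> (\<Union>x\<in>k. ball x d)"
    using seq_compact_imp_totally_bounded[OF compact_imp_seq_compact[OF S]] d(1) by metis
  have "\<forall>\<^sub>F n in sequentially. \<forall>x\<in>k. dist (f n x) (g x) < e / 4"
    unfolding eventually_ball_finite_distrib[OF k(1)]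
    using k(2) tendstoD[OF lim, of _ "e / 4"] \<open>e > 0\<close> by (metis subsetD zero_less_divide_iff zero_less_numeral)
  then show ?thesis
  proof eventually_elim
    case (elim n)
    show ?case
    proof
      fix x assume x: "x \<in> S"
      then obtain y where y: "y \<in> k" "dist y x < d" using k(3) by auto
      then have "y \<in> S" using k(2) by blast
      have "dist (f n x) (g x) \<le> dist (f n x) (f n y) + (dist (f n y) (g y) + dist (g y) (g x))"
        using dist_triangle[of "f n x" "g x" "f n y"] dist_triangle[of "f n y" "g x" "g y"] by linarith
      also have "\<dots> < e / 4 + (e / 4 + e / 4) + e / 4"
        using d(2)[OF x \<open>y \<in> S\<close>, of n] g[OF \<open>y \<in> S\<close> x y(2)] elim y \<open>e > 0\<close>
        by (auto simp: dist_commute intro!: add_le_less_mono)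
      finally show "dist (f n x) (g x) < e" by simp
    qed
  qed
qed

section \<open>Flows of control-linear systems\<close>

text \<open>One Lipschitz estimate for the whole control-linear field. The factor
  \<open>norm w\<close> is kept separate because along a control it is only square integrable in
  time.\<close>

locale lipschitz_control_system =
  fixes F :: "'k::finite \<Rightarrow> real ^ 'n \<Rightarrow> real ^ 'n" and \<Lambda> :: real
  assumes \<Lambda>_nonneg: "0 \<le> \<Lambda>"
    and F_lipschitz: "norm (\<Sum>i\<in>UNIV. (w $ i) *\<^sub>R (F i x - F i y)) \<le> \<Lambda> * norm w * norm (x - y)"
    and F_continuous: "continuous_on UNIV (F i)"
begin

definition velocity :: "(real ^ 'k) L2 \<Rightarrow> (real \<Rightarrow> real ^ 'n) \<Rightarrow> real \<Rightarrow> real ^ 'n" where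
  "velocity u \<xi> t = (\<Sum>i\<in>UNIV. (rep_L2 u t $ i) *\<^sub>R F i (\<xi> t))"

text \<open>The Volterra form of the equation, for curves that are merely continuous; the next
  lemmas show that it is equivalent to \<open>is_trajectory\<close>.\<close>

definition integral_trajectory :: "(real ^ 'k) L2 \<Rightarrow> real ^ 'n \<Rightarrow> (real \<Rightarrow> real ^ 'n) \<Rightarrow> bool" where
  "integral_trajectory u x \<xi> \<longleftrightarrow> continuous_on {0..1} \<xi> \<and>
     (\<forall>t\<in>{0..1}. \<xi> t = x + integral {0..t} (velocity u \<xi>))"

lemma velocity_L2:
  assumes "continuous_on {0..1} \<xi>"
  shows "velocity u \<xi> \<in> L2_functions"
proof -
  have comp: "(\<lambda>t. rep_L2 u t $ i) \<in> L2_functions" for i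
    unfolding L2_functions_def
  proof (intro CollectI conjI)
    have "(\<lambda>t. rep_L2 u t $ i) = (\<lambda>t. rep_L2 u t \<bullet> axis i 1)" by (simp add: inner_axis)
    then show "(\<lambda>t. rep_L2 u t $ i) \<in> borel_measurable (lebesgue_on {0..1})" by simp
    then show "integrable (lebesgue_on {0..1}) (\<lambda>t. (norm (rep_L2 u t $ i))\<^sup>2)"
      by (intro Bochner_Integration.integrable_bound[OF rep_L2_square_integrable[of u]])
        (auto intro!: AE_I2 power_mono component_le_norm_cart simp: abs_le_square_iff[symmetric])
  qed
  have summand: "(\<lambda>t. (rep_L2 u t $ i) *\<^sub>R F i (\<xi> t)) \<in> L2_functions" for i
    by (intro L2_functions_mult_continuous comp continuous_on_compose2[OF F_continuous assms]) auto
  have "(\<lambda>t. \<Sum>i\<in>I. (rep_L2 u t $ i) *\<^sub>R F i (\<xi> t)) \<in> L2_functions" if "finite I" for I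
    using that by (induction I rule: finite_induct) (auto simp: L2_functions_0 intro: L2_functions_add summand)
  then show ?thesis unfolding velocity_def[abs_def] by simp
qed

lemma velocity_diff: "norm (velocity u \<xi> t - velocity u \<eta> t) \<le> \<Lambda> * norm (rep_L2 u t) * norm (\<xi> t - \<eta> t)"
  using F_lipschitz[of "rep_L2 u t" "\<xi> t" "\<eta> t"]
  by (simp add: velocity_def scaleR_diff_right sum_subtractf)

text \<open>The fundamental theorem for absolutely continuous functions on each
  \<open>{0..t}\<close>, with the exceptional null set of the almost everywhere equation.\<close>

lemma is_trajectory_imp_integral:
  assumes "is_trajectory F u x \<xi>"
  shows "integral_trajectory u x \<xi>"
proof -
  have ac: "abs_continuous_on_interval 0 1 \<xi>" and x: "\<xi> 0 = x"
    and ae: "AE t in lebesgue_on {0..1}. (\<xi> has_vector_derivative velocity u \<xi> t) (at t within {0..1})"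
    using assms by (auto simp: is_trajectory_def velocity_def)
  from ae have "AE t in lebesgue. t \<in> {0..1} \<longrightarrow> (\<xi> has_vector_derivative velocity u \<xi> t) (at t within {0..1})"
    by (subst (asm) AE_restrict_space_iff) auto
  then obtain S where S: "S \<in> null_sets lebesgue"
    "{t. \<not> (t \<in> {0..1} \<longrightarrow> (\<xi> has_vector_derivative velocity u \<xi> t) (at t within {0..1}))} \<subseteq> S"
    by (auto simp: eventually_ae_filter)
  have "\<xi> t = x + integral {0..t} (velocity u \<xi>)" if t: "t \<in> {0..1}" for t
  proof -
    have "(velocity u \<xi> has_integral (\<xi> t - \<xi> 0)) {0..t}"
    proof (rule fundamental_theorem_of_calculus_abs_continuous)
      show "0 \<le> t" using t by simp
      show "abs_continuous_on_interval 0 t \<xi>"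
        using t by (intro abs_continuous_on_interval_subset[OF ac]) auto
      show "negligible S" using S(1) by (simp add: negligible_iff_null_sets)
      fix s assume "s \<in> {0..t} - S"
      then have "(\<xi> has_vector_derivative velocity u \<xi> s) (at s within {0..1})" using S(2) t by auto
      then show "(\<xi> has_vector_derivative velocity u \<xi> s) (at s within {0..t})"
        by (rule has_vector_derivative_within_subset) (use t in auto)
    qed
    then show ?thesis using x by (simp add: integral_unique)
  qed
  then show ?thesis
    unfolding integral_trajectory_def using abs_continuous_on_interval_imp_continuous_on[OF ac] by blast
qed

text \<open>The velocity along a continuous curve is square integrable, so its primitive is
  absolutely continuous, and Lebesgue differentiation recovers the equation almost
  everywhere.\<close>

lemma integral_imp_is_trajectory:
  assumes "integral_trajectory u x \<xi>"
  shows "is_trajectory F u x \<xi>"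
proof -
  have c: "continuous_on {0..1} \<xi>" and eq: "\<And>t. t \<in> {0..1} \<Longrightarrow> \<xi> t = x + integral {0..t} (velocity u \<xi>)"
    using assms by (auto simp: integral_trajectory_def)
  note vL = velocity_L2[OF c, of u]
  have "abs_continuous_on_interval 0 1 \<xi>"
    unfolding abs_continuous_on_interval_def
  proof (intro allI impI)
    fix e :: real assume "e > 0"
    obtain \<delta> where "\<delta> > 0" and \<delta>: "\<And>(m::nat) s t. \<forall>i<m. 0 \<le> s i \<and> s i \<le> t i \<and> t i \<le> 1 \<Longrightarrow>
        disjoint_family_on (\<lambda>i. {s i<..<t i}) {..<m} \<Longrightarrow> (\<Sum>i<m. t i - s i) < \<delta> \<Longrightarrow>
        (\<Sum>i<m. dist (x + integral {0..s i} (velocity u \<xi>)) (x + integral {0..t i} (velocity u \<xi>))) < e"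
      by (rule abs_continuous_on_intervalE[OF indefinite_integral_L2_abs_continuous[OF vL] \<open>e > 0\<close>, of x], rule that)
    have "(\<Sum>i<m. dist (\<xi> (s i)) (\<xi> (t i))) < e"
      if st: "\<forall>i<m. 0 \<le> s i \<and> s i \<le> t i \<and> t i \<le> 1"
        and d: "disjoint_family_on (\<lambda>i. {s i<..<t i}) {..<m}" "(\<Sum>i<m. t i - s i) < \<delta>" for m :: nat and s t
    proof -
      have "(\<Sum>i<m. dist (\<xi> (s i)) (\<xi> (t i))) =
          (\<Sum>i<m. dist (x + integral {0..s i} (velocity u \<xi>)) (x + integral {0..t i} (velocity u \<xi>)))"
      proof (intro sum.cong refl)
        fix i assume "i \<in> {..<m}"
        then have "s i \<in> {0..1}" "t i \<in> {0..1}" using st by force+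
        then show "dist (\<xi> (s i)) (\<xi> (t i)) =
            dist (x + integral {0..s i} (velocity u \<xi>)) (x + integral {0..t i} (velocity u \<xi>))"
          using eq by metis
      qed
      also have "\<dots> < e" by (rule \<delta>[OF st d])
      finally show ?thesis .
    qed
    then show "\<exists>\<delta>>0. \<forall>(m::nat) s t. (\<forall>i<m. 0 \<le> s i \<and> s i \<le> t i \<and> t i \<le> 1) \<and>
        disjoint_family_on (\<lambda>i. {s i<..<t i}) {..<m} \<and> (\<Sum>i<m. t i - s i) < \<delta> \<longrightarrow>
        (\<Sum>i<m. dist (\<xi> (s i)) (\<xi> (t i))) < e"
      using \<open>\<delta> > 0\<close> by (intro exI[of _ \<delta>]) simp
  qed
  moreover have "\<xi> 0 = x" using eq[of 0] by simp
  moreover have "AE t in lebesgue_on {0..1}. (\<xi> has_vector_derivative velocity u \<xi> t) (at t within {0..1})"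
  proof -
    obtain S where S: "negligible S"
      "\<And>t. t \<in> {0..1} - S \<Longrightarrow>
        ((\<lambda>t. integral {0..t} (velocity u \<xi>)) has_vector_derivative velocity u \<xi> t) (at t within {0..1})"
      using indefinite_integral_has_vector_derivative_ae[OF L2_functions_integrable_on(1)[OF vL order_refl]] by blast
    have "AE t in lebesgue. t \<notin> S"
      using S(1) by (intro AE_not_in) (simp add: negligible_iff_null_sets)
    then have "AE t in lebesgue. t \<in> {0..1} \<longrightarrow> (\<xi> has_vector_derivative velocity u \<xi> t) (at t within {0..1})"
    proof eventually_elim
      case (elim t)
      show ?case
      proof
        assume t: "t \<in> {0..1}"
        then have "((\<lambda>t. x + integral {0..t} (velocity u \<xi>)) has_vector_derivative 0 + velocity u \<xi> t) (at t within {0..1})"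
          using S(2)[of t] elim by (intro has_vector_derivative_add has_vector_derivative_const) auto
        then show "(\<xi> has_vector_derivative velocity u \<xi> t) (at t within {0..1})"
          using has_vector_derivative_transform[OF t eq] by simp
      qed
    qed
    then show ?thesis by (subst AE_restrict_space_iff) auto
  qed
  ultimately show ?thesis by (simp add: is_trajectory_def velocity_def)
qed

text \<open>The constant \<open>c\<close> collects every error other than the difference of
  velocities under the same control: the distance of the initial points for stability, the effect of
  changing the control for weak continuity. The factor depends on \<open>u\<close> through its norm
  only, hence is uniform over bounded sets of controls.\<close>

lemma trajectory_gronwall:
  assumes \<xi>: "continuous_on {0..1} \<xi>" and \<eta>: "continuous_on {0..1} \<eta>" and c: "0 \<le> c"
    and le: "\<And>t. t \<in> {0..1} \<Longrightarrow>
      norm (\<xi> t - \<eta> t) \<le> c + norm (integral {0..t} (\<lambda>s. velocity u \<xi> s - velocity u \<eta> s))"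
    and t: "t \<in> {0..1}"
  shows "norm (\<xi> t - \<eta> t) \<le> sqrt 2 * exp (\<Lambda>\<^sup>2 * (norm u)\<^sup>2) * c"
proof (rule gronwall_L2[where a="\<lambda>s. \<Lambda> * norm (rep_L2 u s)" and d="\<lambda>t. norm (\<xi> t - \<eta> t)"
      and A="\<Lambda>\<^sup>2 * (norm u)\<^sup>2", OF _ _ _ c])
  have aL: "(\<lambda>s. \<Lambda> * norm (rep_L2 u s)) \<in> L2_functions"
    using L2_functions_scaleR[OF L2_functions_norm[OF rep_L2_in_L2_functions], of \<Lambda> u] by simp
  then show "(\<lambda>s. \<Lambda> * norm (rep_L2 u s)) \<in> L2_functions" .
  show dc: "continuous_on {0..1} (\<lambda>t. norm (\<xi> t - \<eta> t))" using \<xi> \<eta> by (intro continuous_intros)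
  show "integral {0..1} (\<lambda>s. (\<Lambda> * norm (rep_L2 u s))\<^sup>2) \<le> \<Lambda>\<^sup>2 * (norm u)\<^sup>2"
    by (simp add: power_mult_distrib integral_norm_rep_L2)
  fix t :: real assume t: "t \<in> {0..1}"
  then have sub: "{0..t} \<subseteq> {0..1}" by auto
  have "norm (integral {0..t} (\<lambda>s. velocity u \<xi> s - velocity u \<eta> s)) \<le>
      integral {0..t} (\<lambda>s. \<Lambda> * norm (rep_L2 u s) * norm (\<xi> s - \<eta> s))"
  proof (rule integral_norm_bound_integral)
    show "(\<lambda>s. velocity u \<xi> s - velocity u \<eta> s) integrable_on {0..t}"
      by (intro L2_functions_integrable_on(1)[OF _ sub] L2_functions_diff velocity_L2 \<xi> \<eta>)
    show "(\<lambda>s. \<Lambda> * norm (rep_L2 u s) * norm (\<xi> s - \<eta> s)) integrable_on {0..t}"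
      using L2_functions_integrable_on(1)[OF L2_functions_mult_continuous[OF aL dc] sub] by simp
  qed (rule velocity_diff)
  then show "norm (\<xi> t - \<eta> t) \<le> c + integral {0..t} (\<lambda>s. \<Lambda> * norm (rep_L2 u s) * norm (\<xi> s - \<eta> s))"
    using le[OF t] by linarith
qed (use t in auto)

lemma integral_trajectory_stable:
  assumes "integral_trajectory u x \<xi>" "integral_trajectory u y \<eta>" "t \<in> {0..1}"
  shows "norm (\<xi> t - \<eta> t) \<le> sqrt 2 * exp (\<Lambda>\<^sup>2 * (norm u)\<^sup>2) * norm (x - y)"
proof (rule trajectory_gronwall[where c="norm (x - y)", OF _ _ _ _ assms(3)])
  show c: "continuous_on {0..1} \<xi>" "continuous_on {0..1} \<eta>"
    using assms by (auto simp: integral_trajectory_def)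
  fix t :: real assume t: "t \<in> {0..1}"
  then have sub: "{0..t} \<subseteq> {0..1}" by auto
  have "integral {0..t} (\<lambda>s. velocity u \<xi> s - velocity u \<eta> s) =
      integral {0..t} (velocity u \<xi>) - integral {0..t} (velocity u \<eta>)"
    by (intro Henstock_Kurzweil_Integration.integral_diff L2_functions_integrable_on(1)[OF _ sub] velocity_L2 c)
  then have "\<xi> t - \<eta> t = (x - y) + integral {0..t} (\<lambda>s. velocity u \<xi> s - velocity u \<eta> s)"
    using assms t by (simp add: integral_trajectory_def)
  then show "norm (\<xi> t - \<eta> t) \<le> norm (x - y) + norm (integral {0..t} (\<lambda>s. velocity u \<xi> s - velocity u \<eta> s))"
    by (simp only: norm_triangle_ineq)
qed simp

text \<open>The order of quantifiers matters: \<open>B\<close> depends on the curve and not on the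
  control, so it serves a whole sequence of controls.\<close>

lemma velocity_bound:
  assumes "continuous_on {0..1} \<xi>"
  obtains B where "0 \<le> B" "\<And>u t. t \<in> {0..1} \<Longrightarrow> norm (velocity u \<xi> t) \<le> B * norm (rep_L2 u t)"
proof -
  have "continuous_on {0..1} (\<lambda>t. \<Sum>i\<in>UNIV. norm (F i (\<xi> t)))"
    by (intro continuous_intros continuous_on_compose2[OF F_continuous assms]) auto
  from compact_continuous_image[OF this compact_Icc]
  obtain B where B: "\<And>t. t \<in> {0..1} \<Longrightarrow> norm (\<Sum>i\<in>UNIV. norm (F i (\<xi> t))) \<le> B"
    by (meson bounded_iff compact_imp_bounded imageI)
  have "norm (velocity u \<xi> t) \<le> B * norm (rep_L2 u t)" if "t \<in> {0..1}" for u t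
  proof -
    have "norm (velocity u \<xi> t) \<le> (\<Sum>i\<in>UNIV. norm (rep_L2 u t) * norm (F i (\<xi> t)))"
      unfolding velocity_def
      by (intro sum_norm_le) (simp add: mult_right_mono component_le_norm_cart)
    also have "\<dots> = norm (rep_L2 u t) * (\<Sum>i\<in>UNIV. norm (F i (\<xi> t)))"
      by (simp add: sum_distrib_left)
    also have "\<dots> \<le> norm (rep_L2 u t) * B" using B[OF that] by (intro mult_left_mono) auto
    finally show ?thesis by (simp add: mult.commute)
  qed
  moreover have "0 \<le> B" using B[of 0] norm_ge_zero order_trans by fastforce
  ultimately show thesis using that by blast
qed

text \<open>Picard's operator is a contraction for the norm weighted by \<open>exp (- \<rho> t)\<close>; it is written for
  \<open>\<eta> t = exp (- \<rho> t) \<xi> t\<close>, and \<open>\<tau>\<close> clamps the time to the unit interval.\<close>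

lemma integral_trajectory_exists: "\<exists>\<xi>. integral_trajectory u x \<xi>"
proof -
  define W where "W = \<Lambda>\<^sup>2 * (norm u)\<^sup>2"
  \<comment> \<open>Chosen so that \<open>W / (2 * \<rho>) \<le> 1/4\<close>, which yields the
    contraction factor 1/2; the added 1 keeps \<open>\<rho>\<close> positive when
    \<open>W = 0\<close>.\<close>
  define \<rho> where "\<rho> = 2 * W + 1"
  have W0: "0 \<le> W" by (simp add: W_def)
  have lp: "\<rho> > 0" using W0 by (simp add: \<rho>_def)
  define \<zeta> where "\<zeta> \<eta> s = exp (\<rho> * s) *\<^sub>R apply_bcontfun \<eta> s" for \<eta> :: "real \<Rightarrow>\<^sub>C (real ^ 'n)" and s
  define h where "h \<eta> r = exp (- (\<rho> * r)) *\<^sub>R (x + integral {0..r} (velocity u (\<zeta> \<eta>)))" for \<eta> r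
  define \<tau> :: "real \<Rightarrow> real" where "\<tau> t = max 0 (min 1 t)" for t
  have \<zeta>c: "continuous_on {0..1} (\<zeta> \<eta>)" for \<eta>
    unfolding \<zeta>_def by (intro continuous_intros) auto
  have hc: "continuous_on {0..1} (h \<eta>)" for \<eta>
    unfolding h_def
    by (intro continuous_intros indefinite_integral_continuous_1 L2_functions_integrable_on(1)[OF velocity_L2[OF \<zeta>c]]) auto
  have \<tau>: "\<tau> t \<in> {0..1}" for t by (auto simp: \<tau>_def)
  have \<tau>c: "continuous_on UNIV \<tau>" unfolding \<tau>_def by (intro continuous_intros)
  have bc: "(\<lambda>t. h \<eta> (\<tau> t)) \<in> bcontfun" for \<eta>
    unfolding bcontfun_def
  proof (intro CollectI conjI)
    show "continuous_on UNIV (\<lambda>t. h \<eta> (\<tau> t))"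
      using \<tau> by (intro continuous_on_compose2[OF hc \<tau>c]) auto
    have "range (\<lambda>t. h \<eta> (\<tau> t)) \<subseteq> h \<eta> ` {0..1}" using \<tau> by auto
    then show "bounded (range (\<lambda>t. h \<eta> (\<tau> t)))"
      using compact_continuous_image[OF hc compact_Icc] by (meson bounded_subset compact_imp_bounded)
  qed
  define P where "P \<eta> = Bcontfun (\<lambda>t. h \<eta> (\<tau> t))" for \<eta>
  have P: "apply_bcontfun (P \<eta>) = (\<lambda>t. h \<eta> (\<tau> t))" for \<eta>
    unfolding P_def by (rule Bcontfun_inverse[OF bc])
  have aL: "(\<lambda>s. \<Lambda> * norm (rep_L2 u s)) \<in> L2_functions"
    using L2_functions_scaleR[OF L2_functions_norm[OF rep_L2_in_L2_functions], of \<Lambda> u] by simp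
  have contr: "norm (h \<eta> r - h \<kappa> r) \<le> 1/2 * dist \<eta> \<kappa>" if r: "r \<in> {0..1}" for \<eta> \<kappa> r
  proof -
    define D where "D = dist \<eta> \<kappa>"
    have sub: "{0..r} \<subseteq> {0..1}" using r by auto
    have ec: "continuous_on {0..1} (\<lambda>s. exp (\<rho> * s) * D)" by (intro continuous_intros)
    have vint: "velocity u (\<zeta> \<eta>) integrable_on {0..r}" for \<eta>
      by (rule L2_functions_integrable_on(1)[OF velocity_L2[OF \<zeta>c] sub])
    have "norm (integral {0..r} (\<lambda>s. velocity u (\<zeta> \<eta>) s - velocity u (\<zeta> \<kappa>) s)) \<le>
        integral {0..r} (\<lambda>s. \<Lambda> * norm (rep_L2 u s) * (exp (\<rho> * s) * D))"
    proof (rule integral_norm_bound_integral)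
      show "(\<lambda>s. velocity u (\<zeta> \<eta>) s - velocity u (\<zeta> \<kappa>) s) integrable_on {0..r}"
        by (intro Henstock_Kurzweil_Integration.integrable_diff vint)
      show "(\<lambda>s. \<Lambda> * norm (rep_L2 u s) * (exp (\<rho> * s) * D)) integrable_on {0..r}"
        using L2_functions_integrable_on(1)[OF L2_functions_mult_continuous[OF aL ec] sub] by simp
      fix s
      have "norm (\<zeta> \<eta> s - \<zeta> \<kappa> s) = exp (\<rho> * s) * dist (apply_bcontfun \<eta> s) (apply_bcontfun \<kappa> s)"
        by (simp add: \<zeta>_def dist_norm flip: scaleR_diff_right)
      also have "\<dots> \<le> exp (\<rho> * s) * D"
        unfolding D_def by (intro mult_left_mono dist_bounded) auto
      finally have "norm (\<zeta> \<eta> s - \<zeta> \<kappa> s) \<le> exp (\<rho> * s) * D" .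
      then show "norm (velocity u (\<zeta> \<eta>) s - velocity u (\<zeta> \<kappa>) s) \<le> \<Lambda> * norm (rep_L2 u s) * (exp (\<rho> * s) * D)"
        using \<Lambda>_nonneg by (intro order_trans[OF velocity_diff] mult_left_mono) auto
    qed
    also have "\<dots> \<le> 1/2 * D * exp (\<rho> * r)"
    proof (rule power2_le_imp_le)
      have "(integral {0..r} (\<lambda>s. \<Lambda> * norm (rep_L2 u s) * (exp (\<rho> * s) * D)))\<^sup>2 \<le>
          integral {0..r} (\<lambda>s. (\<Lambda> * norm (rep_L2 u s))\<^sup>2) * integral {0..r} (\<lambda>s. (exp (\<rho> * s) * D)\<^sup>2)"
        by (rule integral_Cauchy_Schwarz[OF aL continuous_on_imp_L2_functions[OF ec] sub])
      also have "\<dots> \<le> W * (D\<^sup>2 * exp (2 * \<rho> * r) / (2 * \<rho>))"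
      proof (rule mult_mono[OF _ _ W0])
        have i2: "(\<lambda>s. (\<Lambda> * norm (rep_L2 u s))\<^sup>2) integrable_on {a..b}" if "{a..b} \<subseteq> {0..1}" for a b
          using L2_functions_integrable_on(3)[OF aL that] by (simp add: power_mult_distrib)
        have "integral {0..r} (\<lambda>s. (\<Lambda> * norm (rep_L2 u s))\<^sup>2) \<le> integral {0..1} (\<lambda>s. (\<Lambda> * norm (rep_L2 u s))\<^sup>2)"
          by (rule integral_subset_le[OF sub i2[OF sub] i2]) auto
        also have "\<dots> = W" by (simp add: W_def power_mult_distrib integral_norm_rep_L2)
        finally show "integral {0..r} (\<lambda>s. (\<Lambda> * norm (rep_L2 u s))\<^sup>2) \<le> W" .
        have "((\<lambda>s. (exp (\<rho> * s) * D)\<^sup>2) has_integral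
            (D\<^sup>2 * exp (2 * \<rho> * r) / (2 * \<rho>) - D\<^sup>2 * exp (2 * \<rho> * 0) / (2 * \<rho>))) {0..r}"
        proof (rule fundamental_theorem_of_calculus)
          show "0 \<le> r" using r by simp
          fix s :: real
          have "((\<lambda>s. D\<^sup>2 * exp (2 * \<rho> * s) / (2 * \<rho>)) has_real_derivative (D\<^sup>2 * (exp (2 * \<rho> * s) * (2 * \<rho>)) / (2 * \<rho>)))
              (at s within {0..r})"
            by (auto intro!: derivative_eq_intros)
          moreover have "D\<^sup>2 * (exp (2 * \<rho> * s) * (2 * \<rho>)) / (2 * \<rho>) = (exp (\<rho> * s) * D)\<^sup>2"
            using lp exp_double[of "\<rho> * s"] by (simp add: power_mult_distrib mult.assoc)
          ultimately show "((\<lambda>s. D\<^sup>2 * exp (2 * \<rho> * s) / (2 * \<rho>)) has_vector_derivative (exp (\<rho> * s) * D)\<^sup>2)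
              (at s within {0..r})"
            by (simp only: has_real_derivative_iff_has_vector_derivative)
        qed
        then have "integral {0..r} (\<lambda>s. (exp (\<rho> * s) * D)\<^sup>2) =
            D\<^sup>2 * exp (2 * \<rho> * r) / (2 * \<rho>) - D\<^sup>2 * exp (2 * \<rho> * 0) / (2 * \<rho>)"
          by (rule integral_unique)
        also have "\<dots> \<le> D\<^sup>2 * exp (2 * \<rho> * r) / (2 * \<rho>)" using lp by simp
        finally show "integral {0..r} (\<lambda>s. (exp (\<rho> * s) * D)\<^sup>2) \<le> D\<^sup>2 * exp (2 * \<rho> * r) / (2 * \<rho>)" .
        show "0 \<le> integral {0..r} (\<lambda>s. (exp (\<rho> * s) * D)\<^sup>2)"
          by (intro Henstock_Kurzweil_Integration.integral_nonneg integrable_continuous_real continuous_intros) auto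
      qed
      also have "\<dots> = (W / (2 * \<rho>)) * (D\<^sup>2 * exp (2 * \<rho> * r))" by simp
      also have "\<dots> \<le> (1/4) * (D\<^sup>2 * exp (2 * \<rho> * r))"
        using W0 by (intro mult_right_mono) (auto simp: \<rho>_def field_simps)
      also have "\<dots> = (1/2 * D * exp (\<rho> * r))\<^sup>2"
        using exp_double[of "\<rho> * r"] by (simp add: power_mult_distrib mult.assoc power_divide)
      finally show "(integral {0..r} (\<lambda>s. \<Lambda> * norm (rep_L2 u s) * (exp (\<rho> * s) * D)))\<^sup>2 \<le> (1/2 * D * exp (\<rho> * r))\<^sup>2" .
    qed (simp add: D_def)
    finally have I: "norm (integral {0..r} (\<lambda>s. velocity u (\<zeta> \<eta>) s - velocity u (\<zeta> \<kappa>) s)) \<le> 1/2 * D * exp (\<rho> * r)" .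
    have "h \<eta> r - h \<kappa> r = exp (- (\<rho> * r)) *\<^sub>R integral {0..r} (\<lambda>s. velocity u (\<zeta> \<eta>) s - velocity u (\<zeta> \<kappa>) s)"
      unfolding h_def Henstock_Kurzweil_Integration.integral_diff[OF vint vint] by (simp add: algebra_simps)
    then have "norm (h \<eta> r - h \<kappa> r) \<le> exp (- (\<rho> * r)) * (1/2 * D * exp (\<rho> * r))"
      using I by (simp add: mult_left_mono)
    also have "\<dots> = 1/2 * D" by (simp add: exp_minus field_simps)
    finally show ?thesis by (simp add: D_def)
  qed
  have "\<exists>!\<eta>. P \<eta> = \<eta>"
  proof (rule banach_fix_type[of "1/2"])
    show "\<forall>\<eta> \<kappa>. dist (P \<eta>) (P \<kappa>) \<le> 1 / 2 * dist \<eta> \<kappa>"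
      using contr \<tau> by (intro allI dist_bound) (simp add: P dist_norm[of "h _ _"])
  qed auto
  then obtain \<eta> where \<eta>: "P \<eta> = \<eta>" by blast
  have "\<zeta> \<eta> t = x + integral {0..t} (velocity u (\<zeta> \<eta>))" if t: "t \<in> {0..1}" for t
  proof -
    have "\<tau> t = t" using t by (auto simp: \<tau>_def)
    then have "apply_bcontfun \<eta> t = h \<eta> t" using fun_cong[OF P[of \<eta>], of t] \<eta> by simp
    then show ?thesis by (simp add: \<zeta>_def[of \<eta> t] h_def exp_minus)
  qed
  then show ?thesis using \<zeta>c unfolding integral_trajectory_def by blast
qed

lemma flow_eq:
  assumes "integral_trajectory u x \<xi>"
  shows "flow F u x = \<xi> 1"
  unfolding flow_def
proof (rule the_equality)
  show "\<exists>\<xi>'. is_trajectory F u x \<xi>' \<and> \<xi> 1 = \<xi>' 1"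
    using integral_imp_is_trajectory[OF assms] by blast
  fix y assume "\<exists>\<eta>. is_trajectory F u x \<eta> \<and> y = \<eta> 1"
  then obtain \<eta> where "integral_trajectory u x \<eta>" "y = \<eta> 1" using is_trajectory_imp_integral by blast
  then show "y = \<xi> 1" using integral_trajectory_stable[OF _ assms, of x \<eta> 1] by simp
qed

lemma flow_lipschitz:
  "norm (flow F u x - flow F u y) \<le> sqrt 2 * exp (\<Lambda>\<^sup>2 * (norm u)\<^sup>2) * norm (x - y)"
proof -
  obtain \<xi> \<eta> where "integral_trajectory u x \<xi>" "integral_trajectory u y \<eta>"
    using integral_trajectory_exists by metis
  then show ?thesis using integral_trajectory_stable[of u x \<xi> y \<eta> 1] by (simp add: flow_eq)
qed

lemma flow_continuous: "continuous_on UNIV (flow F u)"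
proof (rule lipschitz_on_continuous_on)
  show "(sqrt 2 * exp (\<Lambda>\<^sup>2 * (norm u)\<^sup>2))-lipschitz_on UNIV (flow F u)"
    by (rule lipschitz_onI) (simp_all add: dist_norm flow_lipschitz)
qed

text \<open>A product of two weakly convergent quantities need not converge, so the fields are first
  frozen along the limit trajectory \<open>\<xi>\<close>, where the velocity is linear in the
  control. The discrepancy between \<open>\<Xi> N\<close> and \<open>\<xi>\<close> is left to
  Gronwall's inequality, with a constant uniform in \<open>N\<close>.\<close>

lemma flow_weakly_continuous:
  assumes R: "\<And>N. norm (w N) \<le> R" and weak: "\<And>v. (\<lambda>N. w N \<bullet> v) \<longlonglongrightarrow> u \<bullet> v"
  shows "(\<lambda>N. flow F (w N) x) \<longlonglongrightarrow> flow F u x"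
proof -
  have R0: "0 \<le> R" using R[of 0] norm_ge_zero order_trans by blast
  obtain \<xi> where \<xi>: "integral_trajectory u x \<xi>" using integral_trajectory_exists by blast
  obtain \<Xi> where \<Xi>: "\<And>N. integral_trajectory (w N) x (\<Xi> N)"
    using choice[of "\<lambda>N. integral_trajectory (w N) x"] integral_trajectory_exists by blast
  have c: "continuous_on {0..1} \<xi>" "continuous_on {0..1} (\<Xi> N)" for N
    using \<xi> \<Xi>[of N] by (auto simp: integral_trajectory_def)
  have vint: "velocity v \<xi> integrable_on {s..t}" if "{s..t} \<subseteq> {0..1}" for v s t
    by (rule L2_functions_integrable_on(1)[OF velocity_L2[OF c(1)] that])
  have comp: "integral {0..t} (velocity v \<xi>) $ j = v \<bullet> abs_L2 (\<lambda>s. if s \<in> {0..t} then (\<chi> i. F i (\<xi> s) $ j) else 0)"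
    if t: "t \<in> {0..1}" for t v j
  proof -
    have sub: "{0..t} \<subseteq> {0..1}" using t by auto
    have "(\<lambda>s. \<chi> i. F i (\<xi> s) $ j) \<in> L2_functions"
      by (intro continuous_on_imp_L2_functions continuous_on_vec_lambda continuous_intros
          continuous_on_compose2[OF F_continuous c(1)]) auto
    then have "v \<bullet> abs_L2 (\<lambda>s. if s \<in> {0..t} then (\<chi> i. F i (\<xi> s) $ j) else 0) =
        integral {0..t} (\<lambda>s. rep_L2 v s \<bullet> (\<chi> i. F i (\<xi> s) $ j))"
      by (rule inner_abs_L2_restrict[OF _ sub])
    also have "\<dots> = integral {0..t} (\<lambda>s. velocity v \<xi> s $ j)"
      by (simp add: velocity_def inner_vec_def)
    also have "\<dots> = integral {0..t} (velocity v \<xi>) $ j"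
      by (rule integral_component_eq_cart[OF vint[OF sub]])
    finally show ?thesis by simp
  qed
  obtain B where B: "0 \<le> B" "\<And>v t. t \<in> {0..1} \<Longrightarrow> norm (velocity v \<xi> t) \<le> B * norm (rep_L2 v t)"
    using velocity_bound[OF c(1)] by blast
  have mod: "norm (integral {s..t} (velocity (w N) \<xi>)) \<le> e"
    if st: "0 \<le> s" "s \<le> t" "t \<le> 1" and e: "e > 0" and d: "t - s < e / (B\<^sup>2 * R\<^sup>2 + 1) * e" for N s t e
  proof -
    define \<eta> where "\<eta> = e / (B\<^sup>2 * R\<^sup>2 + 1)"
    have pos: "B\<^sup>2 * R\<^sup>2 + 1 > 0" by (intro add_nonneg_pos) auto
    then have \<eta>: "\<eta> > 0" using e by (simp add: \<eta>_def)
    have d': "t - s \<le> \<eta> * e" using d by (simp add: \<eta>_def)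
    have sub: "{s..t} \<subseteq> {0..1}" using st by auto
    note i2 = L2_functions_integrable_on(3)[OF velocity_L2[OF c(1)]]
    have r2: "(\<lambda>x. B\<^sup>2 * (norm (rep_L2 (w N) x))\<^sup>2) integrable_on {0..1}"
      using integrable_cmul[OF L2_functions_integrable_on(3)[OF rep_L2_in_L2_functions[of "w N"] order_refl], of "B\<^sup>2"]
      by simp
    have "integral {s..t} (\<lambda>x. (norm (velocity (w N) \<xi> x))\<^sup>2) \<le> integral {0..1} (\<lambda>x. (norm (velocity (w N) \<xi> x))\<^sup>2)"
      by (rule integral_subset_le[OF sub i2[OF sub] i2]) auto
    also have "\<dots> \<le> integral {0..1} (\<lambda>x. B\<^sup>2 * (norm (rep_L2 (w N) x))\<^sup>2)"
      using B(2)[of _ "w N"]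
      by (intro integral_le[OF i2 r2]) (auto simp flip: power_mult_distrib intro!: power_mono)
    also have "\<dots> = B\<^sup>2 * (norm (w N))\<^sup>2" by (simp add: integral_norm_rep_L2)
    also have "\<dots> \<le> B\<^sup>2 * R\<^sup>2" using R by (intro mult_left_mono power_mono) auto
    finally have I: "integral {s..t} (\<lambda>x. (norm (velocity (w N) \<xi> x))\<^sup>2) \<le> B\<^sup>2 * R\<^sup>2" .
    have "norm (integral {s..t} (velocity (w N) \<xi>)) \<le>
        \<eta> / 2 * integral {s..t} (\<lambda>x. (norm (velocity (w N) \<xi> x))\<^sup>2) + (t - s) / (2 * \<eta>)"
      by (rule norm_integral_L2_le[OF velocity_L2[OF c(1)] st \<eta>])
    also have "\<dots> \<le> \<eta> / 2 * (B\<^sup>2 * R\<^sup>2) + (\<eta> * e) / (2 * \<eta>)"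
      using I \<eta> d' by (intro add_mono mult_left_mono divide_right_mono) auto
    also have "\<dots> \<le> e"
    proof -
      have "\<eta> * (B\<^sup>2 * R\<^sup>2) \<le> e" using e pos by (simp add: \<eta>_def field_simps)
      moreover have "\<eta> * e / (2 * \<eta>) = e / 2" using \<eta> by simp
      ultimately show ?thesis by linarith
    qed
    finally show ?thesis .
  qed
  have unif: "\<forall>\<^sub>F N in sequentially. \<forall>t\<in>{0..1}.
      dist (integral {0..t} (velocity (w N) \<xi>)) (integral {0..t} (velocity u \<xi>)) < e" if "e > 0" for e
  proof (rule equicontinuous_pointwise_imp_uniform[OF compact_Icc _ _ that])
    fix t :: real assume t: "t \<in> {0..1}"
    show "(\<lambda>N. integral {0..t} (velocity (w N) \<xi>)) \<longlonglongrightarrow> integral {0..t} (velocity u \<xi>)"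
      by (rule vec_tendstoI) (simp add: comp[OF t] weak)
  next
    fix e :: real assume e: "e > 0"
    define d where "d = e / (B\<^sup>2 * R\<^sup>2 + 1) * e"
    have "B\<^sup>2 * R\<^sup>2 + 1 > 0" by (intro add_nonneg_pos) auto
    then have "d > 0" using e by (simp add: d_def)
    moreover have "dist (integral {0..s} (velocity (w N) \<xi>)) (integral {0..t} (velocity (w N) \<xi>)) \<le> e"
      if "s \<le> t" "s \<in> {0..1}" "t \<in> {0..1}" "t - s < d" for s t N
    proof -
      have "integral {0..s} (velocity (w N) \<xi>) + integral {s..t} (velocity (w N) \<xi>) = integral {0..t} (velocity (w N) \<xi>)"
        using that by (intro Henstock_Kurzweil_Integration.integral_combine vint) auto
      then have "dist (integral {0..s} (velocity (w N) \<xi>)) (integral {0..t} (velocity (w N) \<xi>)) =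
          norm (integral {s..t} (velocity (w N) \<xi>))"
        by (metis add_diff_cancel_left' dist_commute dist_norm)
      also have "\<dots> \<le> e" using that e by (intro mod) (auto simp: d_def)
      finally show ?thesis .
    qed
    ultimately have "\<forall>N. \<forall>s\<in>{0..1}. \<forall>t\<in>{0..1}. dist s t < d \<longrightarrow>
        dist (integral {0..s} (velocity (w N) \<xi>)) (integral {0..t} (velocity (w N) \<xi>)) \<le> e"
      by (intro allI ballI impI) (metis abs_less_iff dist_commute dist_real_def linear minus_diff_eq)
    with \<open>d > 0\<close> show "\<exists>d>0. \<forall>N. \<forall>s\<in>{0..1}. \<forall>t\<in>{0..1}. dist s t < d \<longrightarrow>
        dist (integral {0..s} (velocity (w N) \<xi>)) (integral {0..t} (velocity (w N) \<xi>)) \<le> e" by blast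
  qed
  show ?thesis
  proof (rule tendstoI)
    fix e :: real assume e: "e > 0"
    define M where "M = sqrt 2 * exp (\<Lambda>\<^sup>2 * R\<^sup>2)"
    have M: "M > 0" by (simp add: M_def)
    define e' where "e' = e / (2 * M)"
    have e': "e' > 0" using e M by (simp add: e'_def)
    show "\<forall>\<^sub>F N in sequentially. dist (flow F (w N) x) (flow F u x) < e"
      using unif[OF e']
    proof eventually_elim
      case (elim N)
      have "norm (\<Xi> N 1 - \<xi> 1) \<le> sqrt 2 * exp (\<Lambda>\<^sup>2 * (norm (w N))\<^sup>2) * e'"
      proof (rule trajectory_gronwall[OF c(2) c(1)])
        fix t :: real assume t: "t \<in> {0..1}"
        then have sub: "{0..t} \<subseteq> {0..1}" by auto
        have vintN: "velocity (w N) (\<Xi> N) integrable_on {0..t}"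
          by (rule L2_functions_integrable_on(1)[OF velocity_L2[OF c(2)] sub])
        \<comment> \<open>Adding and subtracting the velocity of \<open>w N\<close> along
          \<open>\<xi>\<close> separates the error of the control, small by \<open>elim\<close>,
          from a difference of velocities under one control.\<close>
        have "\<Xi> N t - \<xi> t = (integral {0..t} (velocity (w N) \<xi>) - integral {0..t} (velocity u \<xi>)) +
            integral {0..t} (\<lambda>s. velocity (w N) (\<Xi> N) s - velocity (w N) \<xi> s)"
          unfolding Henstock_Kurzweil_Integration.integral_diff[OF vintN vint[OF sub]]
          using \<xi> \<Xi>[of N] t by (simp add: integral_trajectory_def)
        then have "norm (\<Xi> N t - \<xi> t) \<le> norm (integral {0..t} (velocity (w N) \<xi>) - integral {0..t} (velocity u \<xi>)) +
            norm (integral {0..t} (\<lambda>s. velocity (w N) (\<Xi> N) s - velocity (w N) \<xi> s))"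
          by (simp only: norm_triangle_ineq)
        moreover have "norm (integral {0..t} (velocity (w N) \<xi>) - integral {0..t} (velocity u \<xi>)) \<le> e'"
          using elim t by (auto simp: dist_norm intro: less_imp_le)
        ultimately show "norm (\<Xi> N t - \<xi> t) \<le> e' +
            norm (integral {0..t} (\<lambda>s. velocity (w N) (\<Xi> N) s - velocity (w N) \<xi> s))" by linarith
      qed (use e' in auto)
      also have "\<dots> \<le> M * e'"
        unfolding M_def using R e' by (intro mult_right_mono mult_left_mono) (auto intro!: mult_left_mono power_mono)
      also have "\<dots> < e" using M e by (simp add: e'_def)
      finally show ?case using flow_eq[OF \<xi>] flow_eq[OF \<Xi>] by (simp add: dist_norm)
    qed
  qed
qed

text \<open>The flows of controls of norm at most \<open>R\<close> share a Lipschitz constant, so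
  pointwise convergence is uniform on compact sets.\<close>

lemma flow_weakly_uniformly_continuous:
  assumes K: "compact K" and R: "\<And>N. norm (w N) \<le> R"
    and weak: "\<And>v. (\<lambda>N. w N \<bullet> v) \<longlonglongrightarrow> u \<bullet> v" and "e > 0"
  shows "\<forall>\<^sub>F N in sequentially. \<forall>x\<in>K. dist (flow F (w N) x) (flow F u x) < e"
proof (rule equicontinuous_pointwise_imp_uniform[OF K _ flow_weakly_continuous[OF R weak] \<open>e > 0\<close>])
  fix e :: real assume e: "e > 0"
  define M where "M = sqrt 2 * exp (\<Lambda>\<^sup>2 * R\<^sup>2)"
  have M: "M > 0" by (simp add: M_def)
  have "dist (flow F (w N) x) (flow F (w N) y) \<le> e" if "dist x y < e / M" for N x y
  proof -
    have "dist (flow F (w N) x) (flow F (w N) y) \<le> sqrt 2 * exp (\<Lambda>\<^sup>2 * (norm (w N))\<^sup>2) * dist x y"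
      using flow_lipschitz by (simp add: dist_norm)
    also have "\<dots> \<le> M * dist x y"
      unfolding M_def using R by (intro mult_right_mono mult_left_mono) (auto intro!: mult_left_mono power_mono)
    also have "\<dots> \<le> e" using that M by (simp add: field_simps)
    finally show ?thesis .
  qed
  then show "\<exists>d>0. \<forall>N. \<forall>x\<in>K. \<forall>y\<in>K. dist x y < d \<longrightarrow> dist (flow F (w N) x) (flow F (w N) y) \<le> e"
    using e M by (intro exI[of _ "e / M"]) auto
qed

end

section \<open>Cyclical monotonicity and Kantorovich potentials\<close>

abbreviation sqdist :: "'a::euclidean_space \<Rightarrow> 'a \<Rightarrow> real" where
  "sqdist x y \<equiv> (norm (x - y))\<^sup>2"

lemma borel_measurable_fst_snd [measurable]:
  "fst \<in> borel_measurable (borel :: ('a::second_countable_topology \<times> 'b::second_countable_topology) measure)"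
  "snd \<in> borel_measurable (borel :: ('a::second_countable_topology \<times> 'b::second_countable_topology) measure)"
  by (auto intro!: borel_measurable_continuous_onI continuous_intros)

text \<open>Second countability: the complement of the support is covered by the countably many
  basic open sets of measure 0.\<close>

lemma AE_in_supp:
  fixes M :: "'a::second_countable_topology measure"
  assumes "sets M = sets borel"
  shows "AE x in M. x \<in> supp M"
proof -
  obtain B :: "'a set set" where B: "countable B" "topological_basis B"
    using ex_countable_basis by blast
  define Z where "Z = {U \<in> B. emeasure M U = 0}"
  have "U \<in> sets M" if "U \<in> B" for U
    using topological_basis_open[OF B(2) that] assms by simp
  then have "(\<Union>U\<in>Z. U) \<in> null_sets M"
    using B(1) by (intro null_sets_UN') (auto simp: Z_def intro: countable_subset)
  moreover have "x \<in> (\<Union>U\<in>Z. U)" if "x \<notin> supp M" for x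
  proof -
    from that obtain U where U: "open U" "x \<in> U" "emeasure M U = 0" by (auto simp: supp_def)
    then obtain V where V: "V \<in> B" "x \<in> V" "V \<subseteq> U" using topological_basisE[OF B(2)] by metis
    have "emeasure M V \<le> emeasure M U"
      using V U assms by (intro emeasure_mono) auto
    then show ?thesis using U V by (auto simp: Z_def)
  qed
  ultimately show ?thesis by (auto intro!: AE_I')
qed

lemma couplingsD:
  assumes "\<gamma> \<in> couplings \<mu> \<nu>"
  shows "prob_space \<gamma>" "sets \<gamma> = sets borel" "distr \<gamma> borel fst = \<mu>" "distr \<gamma> borel snd = \<nu>"
  using assms by (auto simp: couplings_def prob_measures_def)

lemma measurable_borel_sets:
  assumes "sets M = sets borel" "f \<in> borel_measurable borel"
  shows "f \<in> borel_measurable M"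
  using assms measurable_cong_sets by blast

lemma supp_coupling_subset:
  fixes \<mu> \<nu> :: "'a::euclidean_space measure"
  assumes \<gamma>: "\<gamma> \<in> couplings \<mu> \<nu>"
  shows "supp \<gamma> \<subseteq> supp \<mu> \<times> supp \<nu>"
proof
  fix p assume p: "p \<in> supp \<gamma>"
  note D = couplingsD[OF \<gamma>]
  have [measurable]: "fst \<in> borel_measurable \<gamma>" "snd \<in> borel_measurable \<gamma>"
    by (intro measurable_borel_sets[OF D(2)]; simp)+
  have sp: "space \<gamma> = UNIV" using sets_eq_imp_space_eq[OF D(2)] by simp
  have "fst p \<in> supp \<mu>"
    unfolding supp_def
  proof (intro CollectI allI impI, elim conjE)
    fix U :: "'a set" assume U: "open U" "fst p \<in> U"
    have "open (fst -` U :: ('a \<times> 'a) set)" using U(1) by (rule open_vimage_fst)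
    then have "0 < emeasure \<gamma> (fst -` U)" using p U by (auto simp: supp_def)
    then show "0 < emeasure \<mu> U" using U unfolding D(3)[symmetric] by (subst emeasure_distr) (auto simp: sp)
  qed
  moreover have "snd p \<in> supp \<nu>"
    unfolding supp_def
  proof (intro CollectI allI impI, elim conjE)
    fix U :: "'a set" assume U: "open U" "snd p \<in> U"
    have "open (snd -` U :: ('a \<times> 'a) set)" using U(1) by (rule open_vimage_snd)
    then have "0 < emeasure \<gamma> (snd -` U)" using p U by (auto simp: supp_def)
    then show "0 < emeasure \<nu> U" using U unfolding D(4)[symmetric] by (subst emeasure_distr) (auto simp: sp)
  qed
  ultimately show "p \<in> supp \<mu> \<times> supp \<nu>" by (auto simp: mem_Times_iff)
qed

lemma inj_on_mod_shift: "inj_on (\<lambda>i. (i + j) mod m) {..<m::nat}"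
proof (rule inj_onI)
  fix a b assume ab: "a \<in> {..<m}" "b \<in> {..<m}" "(a + j) mod m = (b + j) mod m"
  then have "[a + j = b + j] (mod m)" by (simp add: cong_def)
  then have "[a = b] (mod m)" by (simp only: cong_add_rcancel_nat)
  then show "a = b" using ab by (simp add: cong_def)
qed

text \<open>Independent samples of one law may be relabelled by any injection of the index set. The
  function is restricted to \<open>{..<m}\<close> because the product space consists of extensional
  functions.\<close>

lemma distr_PiM_shift:
  assumes M: "prob_space M" and m: "0 < (m::nat)"
  shows "distr (PiM {..<m} (\<lambda>_. M)) (PiM {..<m} (\<lambda>_. M)) (\<lambda>\<omega>. \<lambda>i\<in>{..<m}. \<omega> ((i + j) mod m)) =
    PiM {..<m} (\<lambda>_. M)"
proof (rule distr_PiM_reindex[where f="\<lambda>i. (i + j) mod m" and M="\<lambda>_. M"])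
  show "inj_on (\<lambda>i. (i + j) mod m) {..<m}" by (rule inj_on_mod_shift)
  show "(\<lambda>i. (i + j) mod m) \<in> {..<m} \<rightarrow> {..<m}" using m by auto
qed (rule M)

lemma sum_mod_shift:
  fixes f :: "nat \<Rightarrow> 'b::comm_monoid_add"
  assumes m: "0 < m"
  shows "(\<Sum>i<m. f ((i + j) mod m)) = (\<Sum>i<m. f i)"
proof (rule sum.reindex_bij_betw)
  note inj = inj_on_mod_shift[of j m]
  moreover have "(\<lambda>i. (i + j) mod m) ` {..<m} = {..<m}"
    by (rule endo_inj_surj[OF _ _ inj]) (use m in auto)
  ultimately show "bij_betw (\<lambda>i. (i + j) mod m) {..<m} {..<m}" by (simp add: bij_betw_def)
qed

text \<open>The competitor is the law of \<open>(x\<^sub>1, y\<^sub>0)\<close> on the event that the cyclic permutation lowers the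
  total cost of \<open>m\<close> independent samples, and of \<open>(x\<^sub>0, y\<^sub>0)\<close> elsewhere. That event is invariant under
  cyclic shifts, so the marginals are unchanged and optimality makes it a null event.\<close>

lemma Opt_cyclic_null:
  fixes \<mu> \<nu> :: "'a::euclidean_space measure" and R :: real
  assumes \<gamma>: "\<gamma> \<in> Opt \<mu> \<nu>" and R: "AE p in \<gamma>. norm (fst p) \<le> R \<and> norm (snd p) \<le> R" and m: "0 < m"
  shows "AE \<omega> in PiM {..<m} (\<lambda>_. \<gamma>).
    (\<Sum>i<m. sqdist (fst (\<omega> i)) (snd (\<omega> i))) \<le> (\<Sum>i<m. sqdist (fst (\<omega> (Suc i mod m))) (snd (\<omega> i)))"
proof -
  have coup: "\<gamma> \<in> couplings \<mu> \<nu>" using \<gamma> by (simp add: Opt_def)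
  note D = couplingsD[OF coup]
  have [measurable_cong]: "sets \<gamma> = sets borel" by (rule D(2))
  interpret \<gamma>: prob_space \<gamma> by (rule D(1))
  define P where "P = PiM {..<m} (\<lambda>_. \<gamma>)"
  interpret P: prob_space P unfolding P_def by (rule prob_space_PiM) (rule D(1))
  have coord [measurable]: "(\<lambda>\<omega>. \<omega> i) \<in> measurable P \<gamma>" if "i < m" for i
    unfolding P_def using that by (intro measurable_component_singleton) auto
  have cdist: "distr P \<gamma> (\<lambda>\<omega>. \<omega> i) = \<gamma>" if "i < m" for i
    unfolding P_def using that D(1) by (intro distr_PiM_component) auto
  have mm: "k mod m < m" for k using m by simp
  have cfst: "(\<lambda>\<omega>. fst (\<omega> i)) \<in> borel_measurable P" if "i < m" for i
    by (rule measurable_compose[OF coord[OF that] measurable_borel_sets[OF D(2) borel_measurable_fst_snd(1)]])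
  have csnd: "(\<lambda>\<omega>. snd (\<omega> i)) \<in> borel_measurable P" if "i < m" for i
    by (rule measurable_compose[OF coord[OF that] measurable_borel_sets[OF D(2) borel_measurable_fst_snd(2)]])
  define c where "c i j \<omega> = sqdist (fst (\<omega> i)) (snd (\<omega> j))" for i j and \<omega> :: "nat \<Rightarrow> 'a \<times> 'a"
  have cm: "c i j \<in> borel_measurable P" if "i < m" "j < m" for i j
    unfolding c_def using cfst[OF that(1)] csnd[OF that(2)] by measurable
  have Rc: "AE \<omega> in P. norm (fst (\<omega> i)) \<le> R \<and> norm (snd (\<omega> i)) \<le> R" if "i < m" for i
  proof -
    have "AE p in distr P \<gamma> (\<lambda>\<omega>. \<omega> i). norm (fst p) \<le> R \<and> norm (snd p) \<le> R"
      using R by (simp only: cdist[OF that])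
    then show ?thesis by (rule AE_distrD[OF coord[OF that]])
  qed
  have cb: "AE \<omega> in P. norm (c i j \<omega>) \<le> (2 * R)\<^sup>2" if "i < m" "j < m" for i j
    using Rc[OF that(1)] Rc[OF that(2)]
  proof eventually_elim
    case (elim \<omega>)
    then have "norm (fst (\<omega> i) - snd (\<omega> j)) \<le> 2 * R"
      using norm_triangle_ineq4[of "fst (\<omega> i)" "snd (\<omega> j)"] by linarith
    then show ?case unfolding c_def real_norm_def abs_power2 by (rule power_mono) simp
  qed
  have ci: "integrable P (c i j)" if "i < m" "j < m" for i j
    using cb[OF that] cm[OF that] by (intro P.integrable_const_bound)
  \<comment> \<open>\<open>G\<close> is the change of the total cost under the cyclic permutation;
    the event to be shown null is \<open>G \<omega> < 0\<close>.\<close>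
  define G where "G \<omega> = (\<Sum>i<m. c (Suc i mod m) i \<omega>) - (\<Sum>i<m. c i i \<omega>)" for \<omega>
  have Gm [measurable]: "G \<in> borel_measurable P"
    unfolding G_def using cm mm by (intro borel_measurable_diff borel_measurable_sum) auto
  define \<theta> where "\<theta> j \<omega> = (\<lambda>i\<in>{..<m}. \<omega> ((i + j) mod m))" for j and \<omega> :: "nat \<Rightarrow> 'a \<times> 'a"
  have \<theta>d: "distr P P (\<theta> j) = P" for j
    using distr_PiM_shift[OF D(1) m, of j] by (simp add: P_def \<theta>_def[abs_def])
  have \<theta>m [measurable]: "\<theta> j \<in> measurable P P" for j
    unfolding P_def \<theta>_def[abs_def] using mm by (intro measurable_restrict measurable_component_singleton) auto
  have \<theta>c: "c i k (\<theta> j \<omega>) = c ((i + j) mod m) ((k + j) mod m) \<omega>" if "i < m" "k < m" for i j k \<omega>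
    using that by (simp add: c_def \<theta>_def)
  have \<theta>G: "G (\<theta> j \<omega>) = G \<omega>" for j \<omega>
  proof -
    have "(\<Sum>i<m. c (Suc i mod m) i (\<theta> j \<omega>)) = (\<Sum>i<m. (\<lambda>i. c (Suc i mod m) i \<omega>) ((i + j) mod m))"
      using mm by (intro sum.cong refl) (simp add: \<theta>c mod_simps)
    moreover have "(\<Sum>i<m. c i i (\<theta> j \<omega>)) = (\<Sum>i<m. (\<lambda>i. c i i \<omega>) ((i + j) mod m))"
      by (intro sum.cong refl) (simp add: \<theta>c)
    ultimately show ?thesis
      using sum_mod_shift[OF m, of "\<lambda>i. c (Suc i mod m) i \<omega>" j] sum_mod_shift[OF m, of "\<lambda>i. c i i \<omega>" j]
      by (simp add: G_def)
  qed
  define S where "S \<omega> = (if G \<omega> < 0 then (fst (\<omega> (Suc 0 mod m)), snd (\<omega> 0)) else \<omega> 0)" for \<omega>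
  have Sf: "fst (S \<omega>) = (if G \<omega> < 0 then fst (\<omega> (Suc 0 mod m)) else fst (\<omega> 0))"
    and Ss: "snd (S \<omega>) = snd (\<omega> 0)" for \<omega> by (auto simp: S_def)
  have Sm: "S \<in> borel_measurable P"
  proof -
    have "(\<lambda>\<omega>. (fst (\<omega> (Suc 0 mod m)), snd (\<omega> 0))) \<in> borel_measurable P"
      using cfst[OF mm] csnd[OF m] by measurable
    moreover have "(\<lambda>\<omega>. \<omega> 0) \<in> borel_measurable P" using coord[OF m] measurable_cong_sets[OF refl D(2)] by blast
    ultimately show ?thesis unfolding S_def[abs_def] by measurable
  qed
  define \<gamma>' where "\<gamma>' = distr P borel S"
  have fst_distr: "distr P borel (\<lambda>\<omega>. fst (\<omega> i)) = \<mu>" if "i < m" for i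
  proof -
    have "distr P borel (\<lambda>\<omega>. fst (\<omega> i)) = distr (distr P \<gamma> (\<lambda>\<omega>. \<omega> i)) borel fst"
      by (subst distr_distr) (use coord[OF that] in \<open>auto simp: comp_def\<close>)
    then show ?thesis using cdist[OF that] D(3) by simp
  qed
  have snd_distr: "distr P borel (\<lambda>\<omega>. snd (\<omega> i)) = \<nu>" if "i < m" for i
  proof -
    have "distr P borel (\<lambda>\<omega>. snd (\<omega> i)) = distr (distr P \<gamma> (\<lambda>\<omega>. \<omega> i)) borel snd"
      by (subst distr_distr) (use coord[OF that] in \<open>auto simp: comp_def\<close>)
    then show ?thesis using cdist[OF that] D(4) by simp
  qed
  \<comment> \<open>A shift by one preserves both the law and the event, and carries the sample
    point \<open>\<omega> 0\<close> to \<open>\<omega> (Suc 0 mod m)\<close>. Hence replacing the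
    first coordinate on that event leaves the first marginal unchanged.\<close>
  have swap: "(\<integral>\<^sup>+\<omega>. indicator {\<omega>. G \<omega> < 0} \<omega> * indicator A (fst (\<omega> (Suc 0 mod m))) \<partial>P) =
      (\<integral>\<^sup>+\<omega>. indicator {\<omega>. G \<omega> < 0} \<omega> * indicator A (fst (\<omega> 0)) \<partial>P)" if A: "A \<in> sets borel" for A
  proof -
    have "(\<integral>\<^sup>+\<omega>. indicator {\<omega>. G \<omega> < 0} \<omega> * indicator A (fst (\<omega> 0)) \<partial>P) =
      (\<integral>\<^sup>+\<omega>. indicator {\<omega>. G \<omega> < 0} \<omega> * indicator A (fst (\<omega> 0)) \<partial>distr P P (\<theta> 1))"
      by (simp only: \<theta>d)
    also have "\<dots> = (\<integral>\<^sup>+\<omega>. indicator {\<omega>. G \<omega> < 0} (\<theta> 1 \<omega>) * indicator A (fst (\<theta> 1 \<omega> 0)) \<partial>P)"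
    proof (rule nn_integral_distr[OF \<theta>m, where f="\<lambda>\<omega>. indicator {\<omega>. G \<omega> < 0} \<omega> * indicator A (fst (\<omega> 0))"],
        unfold measurable_distr_eq1)
      have [measurable]: "(\<lambda>\<omega>. fst (\<omega> 0)) \<in> borel_measurable P" "A \<in> sets borel" using cfst[OF m] A by auto
      have "(\<lambda>\<omega>. if G \<omega> < 0 \<and> fst (\<omega> 0) \<in> A then 1 else 0 :: ennreal) \<in> borel_measurable P" by measurable
      then show "(\<lambda>\<omega>. indicator {\<omega>. G \<omega> < 0} \<omega> * indicator A (fst (\<omega> 0)) :: ennreal) \<in> borel_measurable P"
        by (rule measurable_cong[THEN iffD1, rotated]) (simp add: indicator_def)
    qed
    also have "\<dots> = (\<integral>\<^sup>+\<omega>. indicator {\<omega>. G \<omega> < 0} \<omega> * indicator A (fst (\<omega> (Suc 0 mod m))) \<partial>P)"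
      using m by (intro nn_integral_cong) (simp add: indicator_def \<theta>G, simp add: \<theta>_def)
    finally show ?thesis by simp
  qed
  have fst': "distr \<gamma>' borel fst = \<mu>"
  proof -
    have "distr \<gamma>' borel fst = distr P borel (\<lambda>\<omega>. fst (S \<omega>))"
      unfolding \<gamma>'_def by (subst distr_distr) (use Sm in \<open>auto simp: comp_def\<close>)
    also have "\<dots> = distr P borel (\<lambda>\<omega>. fst (\<omega> 0))"
    proof (rule measure_eqI)
      fix A assume "A \<in> sets (distr P borel (\<lambda>\<omega>. fst (S \<omega>)))"
      then have A [measurable]: "A \<in> sets borel" by simp
      have [measurable]: "(\<lambda>\<omega>. fst (\<omega> 0)) \<in> borel_measurable P" "(\<lambda>\<omega>. fst (\<omega> (Suc 0 mod m))) \<in> borel_measurable P"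
        "S \<in> borel_measurable P"
        by (rule cfst[OF m] cfst[OF mm] Sm)+
      have ind: "(\<lambda>\<omega>. indicator {\<omega>. G \<omega> < 0} \<omega> :: ennreal) \<in> borel_measurable P"
        "(\<lambda>\<omega>. indicator {\<omega>. \<not> G \<omega> < 0} \<omega> :: ennreal) \<in> borel_measurable P"
      proof -
        have "(\<lambda>\<omega>. if G \<omega> < 0 then 1 else 0 :: ennreal) \<in> borel_measurable P"
          "(\<lambda>\<omega>. if G \<omega> < 0 then 0 else 1 :: ennreal) \<in> borel_measurable P" by measurable
        then show "(\<lambda>\<omega>. indicator {\<omega>. G \<omega> < 0} \<omega> :: ennreal) \<in> borel_measurable P"
          "(\<lambda>\<omega>. indicator {\<omega>. \<not> G \<omega> < 0} \<omega> :: ennreal) \<in> borel_measurable P"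
          by (auto elim!: measurable_cong[THEN iffD1, rotated] simp: indicator_def)
      qed
      have indic: "(\<integral>\<^sup>+\<omega>. indicator A (g \<omega>) \<partial>P) = emeasure (distr P borel g) A"
        if [measurable]: "g \<in> borel_measurable P" for g :: "(nat \<Rightarrow> 'a \<times> 'a) \<Rightarrow> 'a"
      proof -
        have "(\<integral>\<^sup>+\<omega>. indicator A (g \<omega>) \<partial>P) = (\<integral>\<^sup>+x. indicator A x \<partial>distr P borel g)"
          by (rule nn_integral_distr[symmetric]) measurable
        then show ?thesis using A by simp
      qed
      have "emeasure (distr P borel (\<lambda>\<omega>. fst (S \<omega>))) A = (\<integral>\<^sup>+\<omega>. indicator A (fst (S \<omega>)) \<partial>P)"
        by (rule indic[symmetric]) measurable
      also have "\<dots> = (\<integral>\<^sup>+\<omega>. indicator {\<omega>. G \<omega> < 0} \<omega> * indicator A (fst (\<omega> (Suc 0 mod m))) +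
          indicator {\<omega>. \<not> G \<omega> < 0} \<omega> * indicator A (fst (\<omega> 0)) \<partial>P)"
        by (intro nn_integral_cong) (simp add: Sf indicator_def)
      also have "\<dots> = (\<integral>\<^sup>+\<omega>. indicator {\<omega>. G \<omega> < 0} \<omega> * indicator A (fst (\<omega> (Suc 0 mod m))) \<partial>P) +
          (\<integral>\<^sup>+\<omega>. indicator {\<omega>. \<not> G \<omega> < 0} \<omega> * indicator A (fst (\<omega> 0)) \<partial>P)"
        using ind by (intro nn_integral_add) measurable
      also have "\<dots> = (\<integral>\<^sup>+\<omega>. indicator {\<omega>. G \<omega> < 0} \<omega> * indicator A (fst (\<omega> 0)) \<partial>P) +
          (\<integral>\<^sup>+\<omega>. indicator {\<omega>. \<not> G \<omega> < 0} \<omega> * indicator A (fst (\<omega> 0)) \<partial>P)"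
        by (simp only: swap[OF A])
      also have "\<dots> = (\<integral>\<^sup>+\<omega>. indicator {\<omega>. G \<omega> < 0} \<omega> * indicator A (fst (\<omega> 0)) +
          indicator {\<omega>. \<not> G \<omega> < 0} \<omega> * indicator A (fst (\<omega> 0)) \<partial>P)"
        using ind by (intro nn_integral_add[symmetric]) measurable
      also have "\<dots> = (\<integral>\<^sup>+\<omega>. indicator A (fst (\<omega> 0)) \<partial>P)"
        by (intro nn_integral_cong) (simp add: indicator_def)
      also have "\<dots> = emeasure (distr P borel (\<lambda>\<omega>. fst (\<omega> 0))) A"
        by (rule indic) measurable
      finally show "emeasure (distr P borel (\<lambda>\<omega>. fst (S \<omega>))) A = emeasure (distr P borel (\<lambda>\<omega>. fst (\<omega> 0))) A" .
    qed simp
    finally show ?thesis using fst_distr[OF m] by simp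
  qed
  have snd': "distr \<gamma>' borel snd = \<nu>"
  proof -
    have "distr \<gamma>' borel snd = distr P borel (\<lambda>\<omega>. snd (\<omega> 0))"
      unfolding \<gamma>'_def by (subst distr_distr) (use Sm in \<open>auto simp: comp_def Ss\<close>)
    then show ?thesis using snd_distr[OF m] by simp
  qed
  have "\<gamma>' \<in> couplings \<mu> \<nu>"
    using fst' snd' P.prob_space_distr[OF Sm] by (simp add: couplings_def prob_measures_def \<gamma>'_def)
  then have opt: "transport_cost \<gamma> \<le> transport_cost \<gamma>'" using \<gamma> by (simp add: Opt_def)
  define cS where "cS \<omega> = (if G \<omega> < 0 then c (Suc 0 mod m) 0 \<omega> else c 0 0 \<omega>)" for \<omega>
  have cSm: "cS \<in> borel_measurable P"
    unfolding cS_def using cm[OF mm m] cm[OF m m] by measurable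
  have cSi: "integrable P cS"
  proof (rule P.integrable_const_bound[OF _ cSm])
    show "AE \<omega> in P. norm (cS \<omega>) \<le> (2 * R)\<^sup>2"
      using cb[OF mm m, of "Suc 0"] cb[OF m m] by eventually_elim (simp add: cS_def)
  qed
  have "transport_cost \<gamma> = (\<integral>\<^sup>+\<omega>. ennreal (c 0 0 \<omega>) \<partial>P)"
  proof -
    have "transport_cost \<gamma> = (\<integral>\<^sup>+p. ennreal (sqdist (fst p) (snd p)) \<partial>distr P \<gamma> (\<lambda>\<omega>. \<omega> 0))"
      unfolding cdist[OF m] transport_cost_def ..
    also have "\<dots> = (\<integral>\<^sup>+\<omega>. ennreal (c 0 0 \<omega>) \<partial>P)"
      unfolding c_def by (rule nn_integral_distr[OF coord[OF m]]) measurable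
    finally show ?thesis .
  qed
  also have "\<dots> = ennreal (\<integral>\<omega>. c 0 0 \<omega> \<partial>P)"
    by (rule nn_integral_eq_integral[OF ci[OF m m]]) (simp add: c_def)
  finally have cost: "transport_cost \<gamma> = ennreal (\<integral>\<omega>. c 0 0 \<omega> \<partial>P)" .
  have "transport_cost \<gamma>' = (\<integral>\<^sup>+\<omega>. ennreal (cS \<omega>) \<partial>P)"
    unfolding transport_cost_def \<gamma>'_def
    by (subst nn_integral_distr[OF Sm]) (auto intro!: nn_integral_cong simp: cS_def Sf Ss c_def)
  also have "\<dots> = ennreal (\<integral>\<omega>. cS \<omega> \<partial>P)"
    by (rule nn_integral_eq_integral[OF cSi]) (simp add: cS_def c_def)
  finally have cost': "transport_cost \<gamma>' = ennreal (\<integral>\<omega>. cS \<omega> \<partial>P)" .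
  have "(\<integral>\<omega>. c 0 0 \<omega> \<partial>P) \<le> (\<integral>\<omega>. cS \<omega> \<partial>P)"
  proof -
    have "0 \<le> (\<integral>\<omega>. cS \<omega> \<partial>P)" by (intro integral_nonneg_AE) (simp add: cS_def c_def)
    then show ?thesis using opt unfolding cost cost' by (simp only: ennreal_le_iff)
  qed
  \<comment> \<open>The share of the \<open>j\<close>-th sample in the negative part of
    \<open>G\<close>. All shares have the same integral by shift invariance, and that of
    \<open>f 0\<close> is the cost of the competitor minus the optimal cost, so it is nonnegative.
    Their sum \<open>H\<close> is nonpositive, hence zero almost everywhere.\<close>
  define f where "f j \<omega> = (if G \<omega> < 0 then c (Suc j mod m) j \<omega> - c j j \<omega> else 0)" for j \<omega>
  have fm: "f j \<in> borel_measurable P" if "j < m" for j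
    unfolding f_def using cm[OF mm that] cm[OF that that] by measurable
  have fi: "integrable P (f j)" if "j < m" for j
  proof (rule Bochner_Integration.integrable_bound[OF _ fm[OF that]])
    show "integrable P (\<lambda>\<omega>. \<bar>c (Suc j mod m) j \<omega>\<bar> + \<bar>c j j \<omega>\<bar>)"
      using ci[OF mm that] ci[OF that that] by auto
  qed (rule AE_I2, auto simp: f_def intro: abs_triangle_ineq4)
  have f0: "0 \<le> (\<integral>\<omega>. f 0 \<omega> \<partial>P)"
  proof -
    have "f 0 \<omega> = cS \<omega> - c 0 0 \<omega>" for \<omega> by (simp add: f_def cS_def)
    then have "(\<integral>\<omega>. f 0 \<omega> \<partial>P) = (\<integral>\<omega>. cS \<omega> \<partial>P) - (\<integral>\<omega>. c 0 0 \<omega> \<partial>P)"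
      using cSi ci[OF m m] by simp
    then show ?thesis using \<open>(\<integral>\<omega>. c 0 0 \<omega> \<partial>P) \<le> (\<integral>\<omega>. cS \<omega> \<partial>P)\<close> by simp
  qed
  have fj: "(\<integral>\<omega>. f j \<omega> \<partial>P) = (\<integral>\<omega>. f 0 \<omega> \<partial>P)" if j: "j < m" for j
  proof -
    have "(\<integral>\<omega>. f 0 \<omega> \<partial>P) = (\<integral>\<omega>. f 0 \<omega> \<partial>distr P P (\<theta> j))" by (simp only: \<theta>d)
    also have "\<dots> = (\<integral>\<omega>. f 0 (\<theta> j \<omega>) \<partial>P)"
      by (rule integral_distr[OF \<theta>m fm[OF m]])
    also have "\<dots> = (\<integral>\<omega>. f j \<omega> \<partial>P)"
    proof (rule Bochner_Integration.integral_cong[OF refl])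
      fix \<omega>
      have "(Suc 0 mod m + j) mod m = Suc j mod m" using mod_add_left_eq[of "Suc 0" m j] by simp
      then have "c (Suc 0 mod m) 0 (\<theta> j \<omega>) = c (Suc j mod m) j \<omega>" "c 0 0 (\<theta> j \<omega>) = c j j \<omega>"
        unfolding \<theta>c[OF mm m] \<theta>c[OF m m] using j by (simp_all only: add_0 mod_less)
      then show "f 0 (\<theta> j \<omega>) = f j \<omega>" unfolding f_def \<theta>G by (simp only:)
    qed
    finally show ?thesis by simp
  qed
  define H where "H \<omega> = (if G \<omega> < 0 then G \<omega> else 0)" for \<omega>
  have HG: "H \<omega> = (\<Sum>j<m. f j \<omega>)" for \<omega>
    by (simp add: H_def f_def G_def sum_subtractf)
  have Hi: "integrable P H" unfolding HG[abs_def] using fi by (intro Bochner_Integration.integrable_sum) auto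
  have "(\<integral>\<omega>. H \<omega> \<partial>P) = (\<Sum>j<m. \<integral>\<omega>. f j \<omega> \<partial>P)"
    unfolding HG using fi by (intro Bochner_Integration.integral_sum) auto
  also have "\<dots> = (\<Sum>j<m. \<integral>\<omega>. f 0 \<omega> \<partial>P)" by (intro sum.cong refl, rule fj) simp
  also have "\<dots> = real m * (\<integral>\<omega>. f 0 \<omega> \<partial>P)" by simp
  finally have "0 \<le> (\<integral>\<omega>. H \<omega> \<partial>P)" using f0 by simp
  moreover have "(\<integral>\<omega>. - H \<omega> \<partial>P) = 0 \<longleftrightarrow> (AE \<omega> in P. - H \<omega> = 0)"
    by (intro integral_nonneg_eq_0_iff_AE Bochner_Integration.integrable_minus Hi) (simp add: H_def)
  moreover have "0 \<le> (\<integral>\<omega>. - H \<omega> \<partial>P)" by (intro integral_nonneg_AE) (auto simp: H_def)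
  ultimately have "AE \<omega> in P. - H \<omega> = 0" by simp
  then have "AE \<omega> in P. 0 \<le> G \<omega>" by eventually_elim (simp add: H_def split: if_splits)
  then have "AE \<omega> in P. (\<Sum>i<m. c i i \<omega>) \<le> (\<Sum>i<m. c (Suc i mod m) i \<omega>)"
    by eventually_elim (simp only: G_def diff_ge_0_iff_ge)
  then show ?thesis unfolding P_def c_def .
qed

text \<open>A violation at points of the support persists, by continuity, on a product of open
  neighbourhoods. Each of these has positive measure, so the product has positive probability for
  independent samples, which contradicts \<open>Opt_cyclic_null\<close>.\<close>

lemma Opt_supp_cyclically_monotone:
  fixes \<mu> \<nu> :: "'a::euclidean_space measure" and p :: "nat \<Rightarrow> 'a \<times> 'a"
  assumes \<gamma>: "\<gamma> \<in> Opt \<mu> \<nu>" and R: "AE p in \<gamma>. norm (fst p) \<le> R \<and> norm (snd p) \<le> R" and m: "0 < m"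
    and p: "\<And>i. i < m \<Longrightarrow> p i \<in> supp \<gamma>"
  shows "(\<Sum>i<m. sqdist (fst (p i)) (snd (p i))) \<le> (\<Sum>i<m. sqdist (fst (p (Suc i mod m))) (snd (p i)))"
proof (rule ccontr)
  assume neg: "\<not> ?thesis"
  have coup: "\<gamma> \<in> couplings \<mu> \<nu>" using \<gamma> by (simp add: Opt_def)
  note D = couplingsD[OF coup]
  interpret \<gamma>: prob_space \<gamma> by (rule D(1))
  interpret \<Gamma>: product_prob_space "\<lambda>_::nat. \<gamma>" "{..<m}" by standard
  define G where "G \<omega> = (\<Sum>i<m. sqdist (fst (\<omega> (Suc i mod m))) (snd (\<omega> i))) -
    (\<Sum>i<m. sqdist (fst (\<omega> i)) (snd (\<omega> i)))" for \<omega> :: "nat \<Rightarrow> 'a \<times> 'a"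
  have "continuous_on UNIV G"
    unfolding G_def by (intro continuous_intros continuous_on_product_coordinates)
  then have "open {\<omega>. G \<omega> < 0}" by (intro open_Collect_less continuous_on_const)
  moreover have Gp: "p \<in> {\<omega>. G \<omega> < 0}" using neg by (simp add: G_def)
  ultimately obtain X where X: "p \<in> PiE UNIV X" "\<And>i. openin euclidean (X i)" "PiE UNIV X \<subseteq> {\<omega>. G \<omega> < 0}"
    using product_topology_open_contains_basis[of "\<lambda>_. euclidean" UNIV "{\<omega>. G \<omega> < 0}" p]
    unfolding open_fun_def by blast
  have pos: "0 < emeasure \<gamma> (X i)" if "i < m" for i
  proof -
    have "open (X i)" "p i \<in> X i" using X by (auto simp: PiE_iff)
    then show ?thesis using p[OF that] unfolding supp_def by blast
  qed
  have Xs: "X i \<in> sets \<gamma>" for i using X(2)[of i] D(2) by simp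
  have "emeasure (PiM {..<m} (\<lambda>_. \<gamma>)) (PiE {..<m} X) = (\<Prod>i<m. emeasure \<gamma> (X i))"
    using Xs by (intro \<Gamma>.emeasure_PiM) auto
  moreover have "(\<Prod>i<m. emeasure \<gamma> (X i)) \<noteq> 0"
  proof -
    have "emeasure \<gamma> (X i) \<noteq> 0" if "i < m" for i using pos[OF that] by auto
    then show ?thesis by (simp add: prod_zero_iff)
  qed
  moreover have "emeasure (PiM {..<m} (\<lambda>_. \<gamma>)) (PiE {..<m} X) = 0"
  proof -
    have "AE \<omega> in PiM {..<m} (\<lambda>_. \<gamma>). 0 \<le> G \<omega>"
      using Opt_cyclic_null[OF \<gamma> R m] by (simp add: G_def)
    then have "AE \<omega> in PiM {..<m} (\<lambda>_. \<gamma>). \<omega> \<notin> PiE {..<m} X"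
    proof eventually_elim
      case (elim \<omega>)
      show ?case
      proof
        assume \<omega>: "\<omega> \<in> PiE {..<m} X"
        \<comment> \<open>The open box lives in the product over all naturals, the samples only over
          \<open>{..<m}\<close>; the remaining coordinates are filled with \<open>p\<close>, and
          \<open>G\<close> does not see them.\<close>
        define \<omega>' where "\<omega>' i = (if i < m then \<omega> i else p i)" for i
        have "\<omega>' \<in> PiE UNIV X" using \<omega> X(1) by (auto simp: \<omega>'_def PiE_iff)
        then have "G \<omega>' < 0" using X(3) by blast
        moreover have "G \<omega>' = G \<omega>" using m unfolding G_def \<omega>'_def by simp
        ultimately show False using elim by simp
      qed
    qed
    moreover have "PiE {..<m} X \<in> sets (PiM {..<m} (\<lambda>_. \<gamma>))" using Xs by (intro sets_PiM_I_finite) auto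
    ultimately show ?thesis using AE_iff_null_sets null_setsD1 by blast
  qed
  ultimately show False by simp
qed

section \<open>Kantorovich potentials from cyclical monotonicity\<close>

lemma sqdist_diff: "sqdist x y - sqdist x' y = (x - x') \<bullet> (x + x' - 2 *\<^sub>R y)"
  by (simp add: power2_norm_eq_inner inner_simps inner_commute)

text \<open>Factoring the difference as in \<open>sqdist_diff\<close> gives the constant
  \<open>4 * R\<close>, which all potentials inherit through infima.\<close>

lemma sqdist_lipschitz:
  fixes x x' y :: "'a::euclidean_space"
  assumes "norm x \<le> R" "norm x' \<le> R" "norm y \<le> R"
  shows "\<bar>sqdist x y - sqdist x' y\<bar> \<le> 4 * R * norm (x - x')"
proof -
  have "norm (x + x' - 2 *\<^sub>R y) \<le> 4 * R"
    using norm_triangle_ineq4[of "x + x'" "2 *\<^sub>R y"] norm_triangle_ineq[of x x'] assms by simp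
  then show ?thesis
    unfolding sqdist_diff
    using Cauchy_Schwarz_ineq2[of "x - x'" "x + x' - 2 *\<^sub>R y"] mult_left_mono[of "norm (x + x' - 2 *\<^sub>R y)" "4 * R" "norm (x - x')"]
    by (simp add: mult.commute)
qed

lemma sqdist_le:
  fixes x y :: "'a::euclidean_space"
  assumes "norm x \<le> R" "norm y \<le> R"
  shows "sqdist x y \<le> 4 * R\<^sup>2"
proof -
  have "norm (x - y) \<le> 2 * R" using norm_triangle_ineq4[of x y] assms by linarith
  from power_mono[OF this, of 2] show ?thesis by (simp add: power_mult_distrib)
qed

lemma abs_cINF_diff_le:
  fixes f g :: "'i \<Rightarrow> real"
  assumes "I \<noteq> {}" and f: "bdd_below (f ` I)" and g: "bdd_below (g ` I)"
    and le: "\<And>i. i \<in> I \<Longrightarrow> \<bar>f i - g i\<bar> \<le> d"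
  shows "\<bar>(INF i\<in>I. f i) - (INF i\<in>I. g i)\<bar> \<le> d"
proof -
  have "(INF i\<in>I. f i) - d \<le> (INF i\<in>I. g i)"
  proof (rule cINF_greatest[OF \<open>I \<noteq> {}\<close>])
    fix i assume "i \<in> I"
    then show "(INF i\<in>I. f i) - d \<le> g i" using cINF_lower[OF f \<open>i \<in> I\<close>] le[of i] by linarith
  qed
  moreover have "(INF i\<in>I. g i) - d \<le> (INF i\<in>I. f i)"
  proof (rule cINF_greatest[OF \<open>I \<noteq> {}\<close>])
    fix i assume "i \<in> I"
    then show "(INF i\<in>I. g i) - d \<le> f i" using cINF_lower[OF g \<open>i \<in> I\<close>] le[of i] by linarith
  qed
  ultimately show ?thesis by linarith
qed

text \<open>Rockafellar's construction: \<open>V x\<close> collects the costs of the chains of points of \<open>\<Gamma>\<close> that start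
  at a fixed \<open>x\<^sub>0\<close> and end at \<open>x\<close>; cyclical monotonicity says that chains back to \<open>x\<^sub>0\<close> have
  nonnegative cost.\<close>

lemma kantorovich_potentials:
  fixes \<Gamma> :: "('a::euclidean_space \<times> 'a) set"
  assumes \<Gamma>: "\<Gamma> \<subseteq> K \<times> K" "\<Gamma> \<noteq> {}" and R: "\<And>x. x \<in> K \<Longrightarrow> norm x \<le> R"
    and cyc: "\<And>m p. 0 < m \<Longrightarrow> (\<And>i. i < m \<Longrightarrow> p i \<in> \<Gamma>) \<Longrightarrow>
      (\<Sum>i<m. sqdist (fst (p i)) (snd (p i))) \<le> (\<Sum>i<m. sqdist (fst (p (Suc i mod m))) (snd (p i)))"
  obtains \<phi> \<psi> :: "'a \<Rightarrow> real" where
    "\<And>x x'. x \<in> K \<Longrightarrow> x' \<in> K \<Longrightarrow> \<bar>\<phi> x - \<phi> x'\<bar> \<le> 4 * R * norm (x - x')"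
    "\<And>y y'. y \<in> K \<Longrightarrow> y' \<in> K \<Longrightarrow> \<bar>\<psi> y - \<psi> y'\<bar> \<le> 4 * R * norm (y - y')"
    "\<And>x. x \<in> K \<Longrightarrow> \<bar>\<phi> x\<bar> \<le> 12 * R\<^sup>2" "\<And>y. y \<in> K \<Longrightarrow> \<bar>\<psi> y\<bar> \<le> 12 * R\<^sup>2"
    "\<And>x y. x \<in> K \<Longrightarrow> y \<in> K \<Longrightarrow> \<phi> x + \<psi> y \<le> sqdist x y"
    "\<And>x y. (x, y) \<in> \<Gamma> \<Longrightarrow> \<phi> x + \<psi> y = sqdist x y"
proof -
  obtain x0 y0 where xy0: "(x0, y0) \<in> \<Gamma>" using \<Gamma>(2) by auto
  then have K0: "x0 \<in> K" "y0 \<in> K" using \<Gamma>(1) by auto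
  have R0: "0 \<le> R" using R[OF K0(1)] norm_ge_zero order_trans by blast
  define W where "W m p x = (\<Sum>i<m. sqdist (fst (p (Suc i))) (snd (p i)) - sqdist (fst (p i)) (snd (p i))) +
     (sqdist x (snd (p m)) - sqdist (fst (p m)) (snd (p m)))" for m and p :: "nat \<Rightarrow> 'a \<times> 'a" and x
  define Ch where "Ch = {(m :: nat, p). (\<forall>i\<le>m. p i \<in> \<Gamma>) \<and> fst (p 0) = x0}"
  define V where "V x = (\<lambda>(m, p). W m p x) ` Ch" for x
  have base: "(0, \<lambda>_. (x0, y0)) \<in> Ch" using xy0 by (simp add: Ch_def)
  have chK: "snd (p m) \<in> K" if "(m, p) \<in> Ch" for m p
  proof -
    have "p m \<in> \<Gamma>" using that by (simp add: Ch_def)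
    then show ?thesis using \<Gamma>(1) by (auto simp: mem_Times_iff)
  qed
  \<comment> \<open>A chain that returns to its starting point \<open>x0\<close> is a cycle of
    length \<open>Suc m\<close>, so this is cyclical monotonicity.\<close>
  have closed: "0 \<le> W m p x0" if ch: "(m, p) \<in> Ch" for m p
  proof -
    have p: "p i \<in> \<Gamma>" if "i < Suc m" for i using ch that by (simp add: Ch_def)
    have p0: "fst (p 0) = x0" using ch by (simp add: Ch_def)
    have "(\<Sum>i<m. sqdist (fst (p (Suc i mod Suc m))) (snd (p i))) = (\<Sum>i<m. sqdist (fst (p (Suc i))) (snd (p i)))"
      by (intro sum.cong refl) (simp add: mod_less)
    then show ?thesis
      using cyc[of "Suc m" p, OF _ p] p0 by (simp add: W_def sum_subtractf)
  qed
  have W_lip: "\<bar>W m p x - W m p x'\<bar> \<le> 4 * R * norm (x - x')" if "(m, p) \<in> Ch" "x \<in> K" "x' \<in> K" for m p x x'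
    using sqdist_lipschitz[OF R[OF that(2)] R[OF that(3)] R[OF chK[OF that(1)]]] by (simp add: W_def)
  have W_low: "- (4 * R * norm (x - x0)) \<le> W m p x" if "(m, p) \<in> Ch" "x \<in> K" for m p x
    using W_lip[OF that K0(1)] closed[OF that(1)] by linarith
  have bdd: "bdd_below (V x)" if "x \<in> K" for x
    unfolding V_def using W_low[OF _ that] by (intro bdd_belowI[of _ "- (4 * R * norm (x - x0))"]) auto
  define \<phi> where "\<phi> x = Inf (V x)" for x
  have \<phi>_lip: "\<bar>\<phi> x - \<phi> x'\<bar> \<le> 4 * R * norm (x - x')" if "x \<in> K" "x' \<in> K" for x x'
    unfolding \<phi>_def V_def
    using base bdd[OF that(1)] bdd[OF that(2)] W_lip that
    by (intro abs_cINF_diff_le) (auto simp: V_def)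
  have "\<phi> x0 = 0"
  proof (rule antisym)
    have "W 0 (\<lambda>_. (x0, y0)) x0 \<in> V x0" using base unfolding V_def by force
    then show "\<phi> x0 \<le> 0" using cInf_lower[OF _ bdd[OF K0(1)]] by (fastforce simp: \<phi>_def W_def)
    show "0 \<le> \<phi> x0"
      unfolding \<phi>_def V_def using base closed by (intro cINF_greatest) auto
  qed
  then have \<phi>_bound: "\<bar>\<phi> x\<bar> \<le> 8 * R\<^sup>2" if "x \<in> K" for x
  proof -
    have "norm (x - x0) \<le> 2 * R" using norm_triangle_ineq4[of x x0] R[OF that] R[OF K0(1)] by linarith
    then have "4 * R * norm (x - x0) \<le> 4 * R * (2 * R)" using R0 by (intro mult_left_mono) auto
    then show ?thesis using \<phi>_lip[OF that K0(1)] \<open>\<phi> x0 = 0\<close> by (simp add: power2_eq_square)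
  qed
  \<comment> \<open>Appending \<open>(x, y)\<close> to a chain that ends at \<open>x\<close> gives a
    chain that ends at \<open>x'\<close>, at the displayed extra cost. This is the subgradient
    inequality of \<open>\<phi>\<close> for the quadratic cost.\<close>
  have \<phi>_step: "\<phi> x' \<le> \<phi> x + (sqdist x' y - sqdist x y)" if xy: "(x, y) \<in> \<Gamma>" and x': "x' \<in> K" for x y x'
  proof -
    have "\<phi> x' - (sqdist x' y - sqdist x y) \<le> \<phi> x"
      unfolding \<phi>_def[of x] V_def
    proof (rule cINF_greatest)
      show "Ch \<noteq> {}" using base by auto
      fix c assume c: "c \<in> Ch"
      obtain m p where mp: "c = (m, p)" by fastforce
      define q where "q = p(Suc m := (x, y))"
      have "(Suc m, q) \<in> Ch" using c xy unfolding mp by (auto simp: Ch_def q_def le_Suc_eq)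
      then have "\<phi> x' \<le> W (Suc m) q x'"
        unfolding \<phi>_def using bdd[OF x'] by (intro cInf_lower) (force simp: V_def)+
      also have "W (Suc m) q x' = W m p x + (sqdist x' y - sqdist x y)"
      proof -
        have "(\<Sum>i<m. sqdist (fst (q (Suc i))) (snd (q i)) - sqdist (fst (q i)) (snd (q i))) =
            (\<Sum>i<m. sqdist (fst (p (Suc i))) (snd (p i)) - sqdist (fst (p i)) (snd (p i)))"
          by (intro sum.cong refl) (auto simp: q_def)
        then show ?thesis by (simp add: W_def q_def)
      qed
      finally show "\<phi> x' - (sqdist x' y - sqdist x y) \<le> (case c of (m, p) \<Rightarrow> W m p x)"
        unfolding mp by simp
    qed
    then show ?thesis by linarith
  qed
  \<comment> \<open>The conjugate of \<open>\<phi>\<close> for the cost \<open>sqdist\<close>;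
    \<open>\<phi>_step\<close> says that for \<open>(x, y) \<in> \<Gamma>\<close> the infimum is
    attained at \<open>x\<close>.\<close>
  define \<psi> where "\<psi> y = (INF x\<in>K. sqdist x y - \<phi> x)" for y
  have low: "- (8 * R\<^sup>2) \<le> sqdist x y - \<phi> x" if "x \<in> K" for x y
    using \<phi>_bound[OF that] zero_le_power2[of "norm (x - y)"] by linarith
  have bdd2: "bdd_below ((\<lambda>x. sqdist x y - \<phi> x) ` K)" for y
    using low by (intro bdd_belowI2[of _ "- (8 * R\<^sup>2)"])
  have \<psi>_le: "\<phi> x + \<psi> y \<le> sqdist x y" if "x \<in> K" for x y
    using cINF_lower[OF bdd2 that, of y] by (simp add: \<psi>_def)
  show thesis
  proof (rule that)
    show "\<bar>\<phi> x - \<phi> x'\<bar> \<le> 4 * R * norm (x - x')" if "x \<in> K" "x' \<in> K" for x x' by (rule \<phi>_lip[OF that])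
    show "\<bar>\<psi> y - \<psi> y'\<bar> \<le> 4 * R * norm (y - y')" if "y \<in> K" "y' \<in> K" for y y'
      unfolding \<psi>_def
    proof (rule abs_cINF_diff_le[OF _ bdd2 bdd2])
      show "K \<noteq> {}" using K0 by auto
      fix x assume "x \<in> K"
      then show "\<bar>sqdist x y - \<phi> x - (sqdist x y' - \<phi> x)\<bar> \<le> 4 * R * norm (y - y')"
        using sqdist_lipschitz[of y R y' x] R that by (simp add: norm_minus_commute[of x])
    qed
    have "R\<^sup>2 \<ge> 0" by simp
    then show "\<bar>\<phi> x\<bar> \<le> 12 * R\<^sup>2" if "x \<in> K" for x using \<phi>_bound[OF that] by linarith
    show "\<bar>\<psi> y\<bar> \<le> 12 * R\<^sup>2" if "y \<in> K" for y
    proof -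
      have "\<psi> y \<le> 4 * R\<^sup>2"
        using \<psi>_le[OF K0(1), of y] \<open>\<phi> x0 = 0\<close> sqdist_le[OF R[OF K0(1)] R[OF that]] by linarith
      moreover have "- (8 * R\<^sup>2) \<le> \<psi> y"
        unfolding \<psi>_def using K0 low by (intro cINF_greatest) auto
      ultimately show ?thesis using \<open>R\<^sup>2 \<ge> 0\<close> by linarith
    qed
    show "\<phi> x + \<psi> y \<le> sqdist x y" if "x \<in> K" "y \<in> K" for x y by (rule \<psi>_le[OF that(1)])
    show "\<phi> x + \<psi> y = sqdist x y" if xy: "(x, y) \<in> \<Gamma>" for x y
    proof (rule antisym)
      have "x \<in> K" using xy \<Gamma>(1) by auto
      then show "\<phi> x + \<psi> y \<le> sqdist x y" by (rule \<psi>_le)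
      have "sqdist x y - \<phi> x \<le> \<psi> y"
        unfolding \<psi>_def
      proof (rule cINF_greatest)
        show "K \<noteq> {}" using K0 by auto
        fix x' assume "x' \<in> K"
        then show "sqdist x y - \<phi> x \<le> sqdist x' y - \<phi> x'" using \<phi>_step[OF xy, of x'] by linarith
      qed
      then show "sqdist x y \<le> \<phi> x + \<psi> y" by linarith
    qed
  qed
qed

section \<open>Monotone sets are almost everywhere single-valued\<close>

text \<open>A difference of two points of \<open>C\<close> is never a nonzero multiple of
  \<open>w\<close>, so the translates of \<open>C\<close> along \<open>w\<close> are pairwise
  disjoint. Arbitrarily many of them, all of equal measure, fit into one ball, which forces measure
  0.\<close>

lemma negligible_narrow_cone:
  fixes C :: "'a::euclidean_space set"
  assumes "bounded C" and w: "w \<noteq> 0" and \<kappa>: "\<kappa> < 1"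
    and cone: "\<And>x x'. x \<in> C \<Longrightarrow> x' \<in> C \<Longrightarrow> \<bar>(x - x') \<bullet> w\<bar> \<le> \<kappa> * norm w * norm (x - x')"
  shows "negligible C"
proof -
  \<comment> \<open>The cone condition is closed, so \<open>C\<close> may be replaced by its
    closure, which is compact and in particular measurable.\<close>
  have cone': "\<bar>(x - x') \<bullet> w\<bar> \<le> \<kappa> * norm w * norm (x - x')" if x: "x \<in> closure C" and x': "x' \<in> closure C" for x x'
  proof -
    obtain s s' where s: "\<And>n. s n \<in> C" "s \<longlonglongrightarrow> x" and s': "\<And>n. s' n \<in> C" "s' \<longlonglongrightarrow> x'"
      using x x' unfolding closure_sequential by blast
    show ?thesis
    proof (rule LIMSEQ_le)
      show "(\<lambda>n. \<bar>(s n - s' n) \<bullet> w\<bar>) \<longlonglongrightarrow> \<bar>(x - x') \<bullet> w\<bar>" by (intro tendsto_intros s s')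
      show "(\<lambda>n. \<kappa> * norm w * norm (s n - s' n)) \<longlonglongrightarrow> \<kappa> * norm w * norm (x - x')" by (intro tendsto_intros s s')
    qed (use cone s s' in auto)
  qed
  have cC: "compact (closure C)" using \<open>bounded C\<close> by (simp add: compact_closure)
  then obtain B where B: "\<And>x. x \<in> closure C \<Longrightarrow> norm x \<le> B"
    using compact_imp_bounded bounded_iff by metis
  \<comment> \<open>The shifts \<open>inverse (real (Suc k))\<close> are distinct and at most 1, so
    every translate stays in the ball of radius \<open>norm w + B\<close>.\<close>
  define A where "A k = (+) (inverse (real (Suc k)) *\<^sub>R w) ` closure C" for k
  have Am: "A k \<in> lmeasurable" for k
    unfolding A_def using cC by (intro lmeasurable_compact compact_translation)
  have "measure lebesgue (closure C) = 0"
  proof (rule ccontr)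
    assume "measure lebesgue (closure C) \<noteq> 0"
    then have pos: "0 < measure lebesgue (closure C)" by (simp add: zero_less_measure_iff)
    define Q where "Q = measure lebesgue (cball (0::'a) (norm w + B))"
    obtain m :: nat where m: "Q < real m * measure lebesgue (closure C)"
      using reals_Archimedean3[OF pos] by blast
    have disj: "disjoint_family_on A {..<m}"
      unfolding disjoint_family_on_def
    proof (intro ballI impI)
      fix i j :: nat assume ij: "i \<noteq> j"
      show "A i \<inter> A j = {}"
      proof (rule ccontr)
        assume "A i \<inter> A j \<noteq> {}"
        then obtain x x' where x: "x \<in> closure C" "x' \<in> closure C"
          "inverse (real (Suc i)) *\<^sub>R w + x = inverse (real (Suc j)) *\<^sub>R w + x'"
          unfolding A_def by blast
        define t where "t = inverse (real (Suc j)) - inverse (real (Suc i))"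
        have xt: "x - x' = t *\<^sub>R w" using x(3) by (simp add: t_def scaleR_diff_left algebra_simps)
        have "t \<noteq> 0" using ij by (simp add: t_def)
        have "\<bar>t\<bar> * (norm w * norm w) \<le> \<kappa> * (\<bar>t\<bar> * (norm w * norm w))"
          using cone'[OF x(1,2)] unfolding xt
          by (simp add: abs_mult power2_norm_eq_inner[symmetric] power2_eq_square mult_ac)
        moreover have "0 < \<bar>t\<bar> * (norm w * norm w)" using \<open>t \<noteq> 0\<close> w by simp
        ultimately show False using \<kappa> by (simp add: mult_le_cancel_right1)
      qed
    qed
    have "real m * measure lebesgue (closure C) = (\<Sum>k<m. measure lebesgue (A k))"
      by (simp add: A_def measure_translation)
    also have "\<dots> = measure lebesgue (\<Union>k<m. A k)"
    proof (rule measure_finite_Union[symmetric, OF _ _ disj])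
      show "A ` {..<m} \<subseteq> sets lebesgue" using Am fmeasurableD by blast
      show "emeasure lebesgue (A i) \<noteq> \<infinity>" for i using fmeasurableD2[OF Am] by simp
    qed simp
    also have "\<dots> \<le> Q"
      unfolding Q_def
    proof (rule measure_mono_fmeasurable)
      show "(\<Union>k<m. A k) \<subseteq> cball 0 (norm w + B)"
      proof
        fix z assume "z \<in> (\<Union>k<m. A k)"
        then obtain k x where z: "x \<in> closure C" "z = inverse (real (Suc k)) *\<^sub>R w + x" by (auto simp: A_def)
        have "norm (inverse (real (Suc k)) *\<^sub>R w) \<le> 1 * norm w"
          unfolding norm_scaleR by (intro mult_right_mono) (auto simp: field_simps)
        then have "norm z \<le> norm w + B"
          using norm_triangle_ineq[of "inverse (real (Suc k)) *\<^sub>R w" x] B[OF z(1)] unfolding z(2) by linarith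
        then show "z \<in> cball 0 (norm w + B)" by simp
      qed
      show "(\<Union>k<m. A k) \<in> sets lebesgue" using Am by (intro sets.finite_UN) (auto simp: fmeasurableD)
    qed simp
    finally show False using m by simp
  qed
  then have "negligible (closure C)" using lmeasurable_compact[OF cC] by (simp add: negligible_iff_measure0)
  then show ?thesis using closure_subset negligible_subset by blast
qed

text \<open>Where two values lie close to \<open>a\<close> and to \<open>b\<close> respectively, monotonicity forces the domain into a
  Lipschitz graph over the hyperplane orthogonal to \<open>b - a\<close>.\<close>

lemma negligible_multivalued_monotone:
  fixes \<Gamma> :: "('a::euclidean_space \<times> 'a) set"
  assumes bdd: "bounded (fst ` \<Gamma>)"
    and mono: "\<And>x y x' y'. (x, y) \<in> \<Gamma> \<Longrightarrow> (x', y') \<in> \<Gamma> \<Longrightarrow> 0 \<le> (x - x') \<bullet> (y - y')"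
  shows "negligible {x. \<exists>y1 y2. (x, y1) \<in> \<Gamma> \<and> (x, y2) \<in> \<Gamma> \<and> y1 \<noteq> y2}"
proof -
  \<comment> \<open>With \<open>a\<close> and \<open>b\<close> from a countable dense set these sets
    exhaust the multivalued points. Two errors of at most one sixth of \<open>norm (b - a)\<close>
    enter the cross inequality, whence the aperture 1/3.\<close>
  define E where "E a b = {x. \<exists>y1 y2. (x, y1) \<in> \<Gamma> \<and> (x, y2) \<in> \<Gamma> \<and>
    norm (y1 - a) \<le> norm (b - a) / 6 \<and> norm (y2 - b) \<le> norm (b - a) / 6}" for a b
  obtain D :: "'a set" where D: "countable D" "\<And>X. open X \<Longrightarrow> X \<noteq> {} \<Longrightarrow> \<exists>d\<in>D. d \<in> X"
    using countable_dense_setE by blast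
  have neg: "negligible (E a b)" if "a \<noteq> b" for a b
  proof (rule negligible_narrow_cone[where w="b - a" and \<kappa>="1/3"])
    show "bounded (E a b)"
      by (rule bounded_subset[OF bdd]) (force simp: E_def)
    fix x x' assume "x \<in> E a b" "x' \<in> E a b"
    then obtain y1 y2 y1' y2' where y: "(x, y1) \<in> \<Gamma>" "(x, y2) \<in> \<Gamma>" "(x', y1') \<in> \<Gamma>" "(x', y2') \<in> \<Gamma>"
      "norm (y1 - a) \<le> norm (b - a) / 6" "norm (y2 - b) \<le> norm (b - a) / 6"
      "norm (y1' - a) \<le> norm (b - a) / 6" "norm (y2' - b) \<le> norm (b - a) / 6"
      by (auto simp: E_def)
    have cs: "(x - x') \<bullet> (p - q) \<le> norm (x - x') * (norm (b - a) / 3)"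
      if "norm p \<le> norm (b - a) / 6" "norm q \<le> norm (b - a) / 6" for p q
    proof -
      have "norm (p - q) \<le> norm (b - a) / 3" using norm_triangle_ineq4[of p q] that by linarith
      then show ?thesis
        using norm_cauchy_schwarz[of "x - x'" "p - q"] mult_left_mono[OF _ norm_ge_zero[of "x - x'"]]
        by (meson order_trans)
    qed
    have "(x - x') \<bullet> (b - a) \<le> (x - x') \<bullet> ((y1 - a) - (y2' - b))"
      using mono[OF y(1) y(4)] by (simp add: inner_simps)
    also have "\<dots> \<le> norm (x - x') * (norm (b - a) / 3)" by (rule cs[OF y(5) y(8)])
    finally have 1: "(x - x') \<bullet> (b - a) \<le> norm (x - x') * (norm (b - a) / 3)" .
    have "- ((x - x') \<bullet> (b - a)) \<le> (x - x') \<bullet> ((y2 - b) - (y1' - a))"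
      using mono[OF y(2) y(3)] by (simp add: inner_simps)
    also have "\<dots> \<le> norm (x - x') * (norm (b - a) / 3)" by (rule cs[OF y(6) y(7)])
    finally show "\<bar>(x - x') \<bullet> (b - a)\<bar> \<le> 1/3 * norm (b - a) * norm (x - x')"
      using 1 by (simp add: abs_le_iff mult.commute)
  qed (use that in auto)
  have "negligible (\<Union>(a, b) \<in> D \<times> D - Id. E a b)"
    using D(1) neg by (intro negligible_countable_Union) (auto intro: countable_subset[OF _ countable_SIGMA])
  moreover have "{x. \<exists>y1 y2. (x, y1) \<in> \<Gamma> \<and> (x, y2) \<in> \<Gamma> \<and> y1 \<noteq> y2} \<subseteq> (\<Union>(a, b) \<in> D \<times> D - Id. E a b)"
  proof
    fix x assume "x \<in> {x. \<exists>y1 y2. (x, y1) \<in> \<Gamma> \<and> (x, y2) \<in> \<Gamma> \<and> y1 \<noteq> y2}"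
    then obtain y1 y2 where y: "(x, y1) \<in> \<Gamma>" "(x, y2) \<in> \<Gamma>" "y1 \<noteq> y2" by blast
    \<comment> \<open>If \<open>a\<close> and \<open>b\<close> are within \<open>r\<close> of
      \<open>y1\<close> and \<open>y2\<close>, then \<open>norm (b - a) \<ge> 8 * r - 2 * r\<close>,
      so \<open>r\<close> is at most a sixth of \<open>norm (b - a)\<close>.\<close>
    define r where "r = norm (y2 - y1) / 8"
    have r: "r > 0" using y(3) by (simp add: r_def)
    obtain a where a: "a \<in> D" "dist y1 a < r" using D(2)[of "ball y1 r"] r by auto
    obtain b where b: "b \<in> D" "dist y2 b < r" using D(2)[of "ball y2 r"] r by auto
    have "y2 - y1 = (b - a) + ((y2 - b) - (y1 - a))" by simp
    then have "norm (y2 - y1) \<le> norm (b - a) + (norm (y2 - b) + norm (y1 - a))"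
      using norm_triangle_ineq[of "b - a" "(y2 - b) - (y1 - a)"] norm_triangle_ineq4[of "y2 - b" "y1 - a"]
      by simp
    then have "6 * r \<le> norm (b - a)" using a(2) b(2) by (simp add: r_def dist_norm)
    then have "(x, y1) \<in> \<Gamma> \<and> (x, y2) \<in> \<Gamma> \<and> norm (y1 - a) \<le> norm (b - a) / 6 \<and>
        norm (y2 - b) \<le> norm (b - a) / 6" "a \<noteq> b"
      using y a b r by (auto simp: dist_norm)
    then have "x \<in> E a b" "a \<noteq> b" unfolding E_def by blast+
    then show "x \<in> (\<Union>(a, b) \<in> D \<times> D - Id. E a b)" using a b by auto
  qed
  ultimately show ?thesis by (rule negligible_subset)
qed

section \<open>Duality for optimal plans on a compact set\<close>

lemma integrable_continuous_compact:
  fixes g :: "'a::{second_countable_topology} \<Rightarrow> real"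
  assumes M: "prob_space M" "sets M = sets borel" and C: "compact C" "AE x in M. x \<in> C"
    and g: "continuous_on UNIV g"
  shows "integrable M g"
proof -
  interpret prob_space M by (rule M(1))
  obtain B where B: "\<And>x. x \<in> C \<Longrightarrow> norm (g x) \<le> B"
    using compact_continuous_image[OF continuous_on_subset[OF g subset_UNIV] C(1)]
    by (meson bounded_iff compact_imp_bounded imageI)
  show ?thesis
  proof (rule integrable_const_bound)
    show "AE x in M. norm (g x) \<le> B" using C(2) by eventually_elim (rule B)
    show "g \<in> borel_measurable M"
      by (intro measurable_borel_sets[OF M(2)] borel_measurable_continuous_onI g)
  qed
qed

lemma coupling_AE:
  fixes \<mu> \<nu> :: "'a::euclidean_space measure"
  assumes "\<gamma> \<in> couplings \<mu> \<nu>" "supp \<mu> \<subseteq> K" "supp \<nu> \<subseteq> K"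
  shows "AE p in \<gamma>. p \<in> supp \<gamma>" "AE p in \<gamma>. p \<in> K \<times> K" "supp \<gamma> \<subseteq> K \<times> K"
proof -
  show ae: "AE p in \<gamma>. p \<in> supp \<gamma>" by (rule AE_in_supp[OF couplingsD(2)[OF assms(1)]])
  show s: "supp \<gamma> \<subseteq> K \<times> K" using supp_coupling_subset[OF assms(1)] assms(2,3) by blast
  show "AE p in \<gamma>. p \<in> K \<times> K" using ae by eventually_elim (use s in blast)
qed

lemma coupling_integral:
  fixes \<mu> \<nu> :: "'a::euclidean_space measure" and \<phi> \<psi> :: "'a \<Rightarrow> real"
  assumes \<gamma>: "\<gamma> \<in> couplings \<mu> \<nu>" and K: "compact K" "supp \<mu> \<subseteq> K" "supp \<nu> \<subseteq> K"
    and \<phi>: "continuous_on UNIV \<phi>" and \<psi>: "continuous_on UNIV \<psi>"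
  shows "(LINT p|\<gamma>. \<phi> (fst p) + \<psi> (snd p)) = (LINT x|\<mu>. \<phi> x) + (LINT y|\<nu>. \<psi> y)"
proof -
  note D = couplingsD[OF \<gamma>]
  note cK = compact_Times[OF K(1) K(1)]
  have m: "fst \<in> borel_measurable \<gamma>" "snd \<in> borel_measurable \<gamma>"
    by (intro measurable_borel_sets[OF D(2)]; simp)+
  have "(LINT p|\<gamma>. \<phi> (fst p) + \<psi> (snd p)) = (LINT p|\<gamma>. \<phi> (fst p)) + (LINT p|\<gamma>. \<psi> (snd p))"
    by (intro Bochner_Integration.integral_add integrable_continuous_compact[OF D(1,2) cK coupling_AE(2)[OF \<gamma> K(2,3)]]
        continuous_on_compose2[OF \<phi>] continuous_on_compose2[OF \<psi>] continuous_intros) auto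
  also have "(LINT p|\<gamma>. \<phi> (fst p)) = (LINT x|\<mu>. \<phi> x)"
    unfolding D(3)[symmetric] by (rule integral_distr[symmetric, OF m(1)]) (intro borel_measurable_continuous_onI \<phi>)
  also have "(LINT p|\<gamma>. \<psi> (snd p)) = (LINT x|\<nu>. \<psi> x)"
    unfolding D(4)[symmetric] by (rule integral_distr[symmetric, OF m(2)]) (intro borel_measurable_continuous_onI \<psi>)
  finally show ?thesis .
qed

lemma continuous_sqdist: "continuous_on UNIV (\<lambda>p::'a::euclidean_space \<times> 'a. sqdist (fst p) (snd p))"
  by (intro continuous_intros)

text \<open>Kantorovich duality with attainment: the plan is concentrated on its support, where the
  sum of the potentials equals the cost. The potentials are defined on \<open>K\<close> and extended
  by Tietze's theorem, since only bounded continuous functions on the whole space can be tested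
  against weak convergence; the Lipschitz bounds and the inequality remain confined to
  \<open>K\<close>.\<close>

lemma Opt_potentials:
  fixes \<mu> \<nu> :: "'a::euclidean_space measure"
  assumes \<gamma>: "\<gamma> \<in> Opt \<mu> \<nu>" and K: "compact K" "supp \<mu> \<subseteq> K" "supp \<nu> \<subseteq> K"
    and R: "\<And>x. x \<in> K \<Longrightarrow> norm x \<le> R"
  obtains \<phi> \<psi> :: "'a \<Rightarrow> real" where "continuous_on UNIV \<phi>" "continuous_on UNIV \<psi>"
    "\<And>x x'. x \<in> K \<Longrightarrow> x' \<in> K \<Longrightarrow> \<bar>\<phi> x - \<phi> x'\<bar> \<le> 4 * R * norm (x - x')"
    "\<And>y y'. y \<in> K \<Longrightarrow> y' \<in> K \<Longrightarrow> \<bar>\<psi> y - \<psi> y'\<bar> \<le> 4 * R * norm (y - y')"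
    "\<And>x. \<bar>\<phi> x\<bar> \<le> 12 * R\<^sup>2" "\<And>y. \<bar>\<psi> y\<bar> \<le> 12 * R\<^sup>2"
    "\<And>x y. x \<in> K \<Longrightarrow> y \<in> K \<Longrightarrow> \<phi> x + \<psi> y \<le> sqdist x y"
    "\<And>p. p \<in> supp \<gamma> \<Longrightarrow> \<phi> (fst p) + \<psi> (snd p) = sqdist (fst p) (snd p)"
    "(LINT p|\<gamma>. sqdist (fst p) (snd p)) = (LINT x|\<mu>. \<phi> x) + (LINT y|\<nu>. \<psi> y)"
proof -
  have coup: "\<gamma> \<in> couplings \<mu> \<nu>" using \<gamma> by (simp add: Opt_def)
  note D = couplingsD[OF coup] and C = coupling_AE[OF coup K(2,3)]
  interpret prob_space \<gamma> by (rule D(1))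
  have ne: "supp \<gamma> \<noteq> {}"
  proof
    assume "supp \<gamma> = {}"
    then have "AE p in \<gamma>. False" using C(1) by simp
    then show False by simp
  qed
  have RAE: "AE p in \<gamma>. norm (fst p) \<le> R \<and> norm (snd p) \<le> R"
    using C(2) by eventually_elim (use R in auto)
  have R0: "0 \<le> R"
  proof -
    obtain p where "p \<in> supp \<gamma>" using ne by blast
    then have "fst p \<in> K" using C(3) by (auto simp: mem_Times_iff)
    from R[OF this] show ?thesis using norm_ge_zero[of "fst p"] by linarith
  qed
  obtain \<phi> \<psi> :: "'a \<Rightarrow> real" where
    lip: "\<And>x x'. x \<in> K \<Longrightarrow> x' \<in> K \<Longrightarrow> \<bar>\<phi> x - \<phi> x'\<bar> \<le> 4 * R * norm (x - x')"
    "\<And>y y'. y \<in> K \<Longrightarrow> y' \<in> K \<Longrightarrow> \<bar>\<psi> y - \<psi> y'\<bar> \<le> 4 * R * norm (y - y')" and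
    bd: "\<And>x. x \<in> K \<Longrightarrow> \<bar>\<phi> x\<bar> \<le> 12 * R\<^sup>2" "\<And>y. y \<in> K \<Longrightarrow> \<bar>\<psi> y\<bar> \<le> 12 * R\<^sup>2" and
    le: "\<And>x y. x \<in> K \<Longrightarrow> y \<in> K \<Longrightarrow> \<phi> x + \<psi> y \<le> sqdist x y" and
    eq: "\<And>x y. (x, y) \<in> supp \<gamma> \<Longrightarrow> \<phi> x + \<psi> y = sqdist x y"
    by (rule kantorovich_potentials[OF C(3) ne R Opt_supp_cyclically_monotone[OF \<gamma> RAE]],
        assumption, assumption, blast, rule that)
  have cont: "continuous_on K f" if "\<And>x x'. x \<in> K \<Longrightarrow> x' \<in> K \<Longrightarrow> \<bar>f x - f x'\<bar> \<le> 4 * R * norm (x - x')" for f :: "'a \<Rightarrow> real"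
    by (rule lipschitz_on_continuous_on[of "4 * R"], rule lipschitz_onI) (use that R0 in \<open>auto simp: dist_norm\<close>)
  have clK: "closedin (top_of_set UNIV) K" using compact_imp_closed[OF K(1)] by simp
  obtain \<phi>' where \<phi>': "continuous_on UNIV \<phi>'" "\<And>x. x \<in> K \<Longrightarrow> \<phi>' x = \<phi> x" "\<And>x. norm (\<phi>' x) \<le> 12 * R\<^sup>2"
    by (rule Tietze[OF cont[OF lip(1)] clK, of "12 * R\<^sup>2"]) (use bd in auto)
  obtain \<psi>' where \<psi>': "continuous_on UNIV \<psi>'" "\<And>x. x \<in> K \<Longrightarrow> \<psi>' x = \<psi> x" "\<And>x. norm (\<psi>' x) \<le> 12 * R\<^sup>2"
    by (rule Tietze[OF cont[OF lip(2)] clK, of "12 * R\<^sup>2"]) (use bd in auto)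
  have eq': "\<phi>' (fst p) + \<psi>' (snd p) = sqdist (fst p) (snd p)" if "p \<in> supp \<gamma>" for p
  proof -
    have "fst p \<in> K" "snd p \<in> K" using C(3) that by (auto simp: mem_Times_iff)
    then show ?thesis using eq[of "fst p" "snd p"] that \<phi>'(2) \<psi>'(2) by simp
  qed
  have "(LINT p|\<gamma>. sqdist (fst p) (snd p)) = (LINT p|\<gamma>. \<phi>' (fst p) + \<psi>' (snd p))"
  proof (rule integral_cong_AE)
    show "(\<lambda>p. sqdist (fst p) (snd p)) \<in> borel_measurable \<gamma>"
      by (intro measurable_borel_sets[OF D(2)] borel_measurable_continuous_onI continuous_sqdist)
    show "(\<lambda>p. \<phi>' (fst p) + \<psi>' (snd p)) \<in> borel_measurable \<gamma>"
      by (intro measurable_borel_sets[OF D(2)] borel_measurable_continuous_onI continuous_on_add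
          continuous_on_compose2[OF \<phi>'(1)] continuous_on_compose2[OF \<psi>'(1)] continuous_intros) auto
    show "AE p in \<gamma>. sqdist (fst p) (snd p) = \<phi>' (fst p) + \<psi>' (snd p)"
      using C(1) by eventually_elim (simp add: eq')
  qed
  also have "\<dots> = (LINT x|\<mu>. \<phi>' x) + (LINT y|\<nu>. \<psi>' y)"
    by (rule coupling_integral[OF coup K \<phi>'(1) \<psi>'(1)])
  finally have int: "(LINT p|\<gamma>. sqdist (fst p) (snd p)) = (LINT x|\<mu>. \<phi>' x) + (LINT y|\<nu>. \<psi>' y)" .
  show thesis
    by (rule that[OF \<phi>'(1) \<psi>'(1) _ _ _ _ _ eq' int]) (use lip le \<phi>' \<psi>' in auto)
qed

section \<open>Stability of optimal plans\<close>

lemma coupling_marginals: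
  assumes "\<gamma> \<in> couplings \<mu> \<nu>"
  shows "prob_space \<mu>" "sets \<mu> = sets borel" "prob_space \<nu>" "sets \<nu> = sets borel"
proof -
  note D = couplingsD[OF assms]
  interpret prob_space \<gamma> by (rule D(1))
  have "fst \<in> borel_measurable \<gamma>" "snd \<in> borel_measurable \<gamma>"
    by (intro measurable_borel_sets[OF D(2)]; simp)+
  from this[THEN prob_space_distr] show "prob_space \<mu>" "prob_space \<nu>" using D(3,4) by auto
  show "sets \<mu> = sets borel" "sets \<nu> = sets borel" using D(3,4) by auto
qed

lemma integral_le_add_const:
  fixes \<phi> \<psi> :: "'a::second_countable_topology \<Rightarrow> real"
  assumes M: "prob_space M" "sets M = sets borel" and K: "compact K" "AE x in M. x \<in> K"
    and c: "continuous_on UNIV \<phi>" "continuous_on UNIV \<psi>" and le: "\<And>x. x \<in> K \<Longrightarrow> \<phi> x \<le> \<psi> x + e"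
  shows "(LINT x|M. \<phi> x) \<le> (LINT x|M. \<psi> x) + e"
proof -
  interpret prob_space M by (rule M(1))
  note int = integrable_continuous_compact[OF M K]
  have "(LINT x|M. \<phi> x) \<le> (LINT x|M. \<psi> x + e)"
  proof (rule integral_mono_AE[OF int[OF c(1)]])
    show "integrable M (\<lambda>x. \<psi> x + e)" using int[OF c(2)] by simp
    show "AE x in M. \<phi> x \<le> \<psi> x + e" using K(2) by eventually_elim (rule le)
  qed
  also have "\<dots> = (LINT x|M. \<psi> x) + e" using int[OF c(2)] by (simp add: prob_space)
  finally show ?thesis .
qed

lemma continuous_extension_real:
  fixes f :: "'a::euclidean_space \<Rightarrow> real"
  assumes K: "compact K" and f: "continuous_on K f"
  obtains g B where "continuous_on UNIV g" "\<And>x. x \<in> K \<Longrightarrow> g x = f x" "\<And>x. \<bar>g x\<bar> \<le> B"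
proof -
  obtain B0 where B0: "\<And>x. x \<in> K \<Longrightarrow> norm (f x) \<le> B0"
    using compact_continuous_image[OF f K] by (meson bounded_iff compact_imp_bounded imageI)
  define B where "B = max 0 B0"
  have "closedin (top_of_set UNIV) K" using compact_imp_closed[OF K] by simp
  then obtain g where "continuous_on UNIV g" "\<And>x. x \<in> K \<Longrightarrow> g x = f x" "\<And>x. x \<in> UNIV \<Longrightarrow> norm (g x) \<le> B"
    by (rule Tietze[OF f, of UNIV B]) (use B0 in \<open>force simp: B_def\<close>)+
  then show thesis using that by auto
qed

lemma weakly_convergesD:
  fixes f :: "'a::topological_space \<Rightarrow> real"
  assumes "weakly_converges M L" "continuous_on UNIV f" "\<And>x. \<bar>f x\<bar> \<le> B"
  shows "(\<lambda>N. LINT x|M N. f x) \<longlonglongrightarrow> (LINT x|L. f x)"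
  using assms unfolding weakly_converges_def by (auto simp: bounded_iff)

text \<open>Along a subsequence that violates the claim, the potentials converge uniformly on
  \<open>K\<close> to a pair that still satisfies
  \<open>\<phi> x + \<psi> y \<le> sqdist x y\<close>. The optimal costs are dual values and hence
  converge to a dual value of the limit problem, which cannot exceed the cost of any coupling
  \<open>\<gamma>\<close> of the limit marginals.\<close>

lemma Opt_cost_limsup:
  fixes \<mu> \<nu> :: "'a::euclidean_space measure"
  assumes K: "compact K" "supp \<mu> \<subseteq> K" "supp \<nu> \<subseteq> K" and \<gamma>: "\<gamma> \<in> couplings \<mu> \<nu>"
    and KN: "\<And>N. supp (\<mu>N N) \<subseteq> K" "\<And>N. supp (\<nu>N N) \<subseteq> K" and \<gamma>N: "\<And>N. \<gamma>N N \<in> Opt (\<mu>N N) (\<nu>N N)"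
    and conv: "weakly_converges \<mu>N \<mu>" "weakly_converges \<nu>N \<nu>" and e: "e > 0"
  shows "\<forall>\<^sub>F N in sequentially. (LINT p|\<gamma>N N. sqdist (fst p) (snd p)) < (LINT p|\<gamma>. sqdist (fst p) (snd p)) + e"
proof (rule ccontr)
  assume "\<not> ?thesis"
  then obtain r where r: "strict_mono (r :: nat \<Rightarrow> nat)"
    "\<And>n. \<not> (LINT p|\<gamma>N (r n). sqdist (fst p) (snd p)) < (LINT p|\<gamma>. sqdist (fst p) (snd p)) + e"
    using not_eventually_sequentiallyD by blast
  obtain R0 where R0: "\<And>x. x \<in> K \<Longrightarrow> norm x \<le> R0" using compact_imp_bounded[OF K(1)] bounded_iff by metis
  define R where "R = max 0 R0"
  have R: "\<And>x. x \<in> K \<Longrightarrow> norm x \<le> R" "0 \<le> R" using R0 by (fastforce simp: R_def)+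
  define Q where "Q N q \<longleftrightarrow> continuous_on UNIV (fst q) \<and> continuous_on UNIV (snd q) \<and>
    (\<forall>x\<in>K. \<forall>x'\<in>K. \<bar>fst q x - fst q x'\<bar> \<le> 4 * R * norm (x - x')) \<and>
    (\<forall>x\<in>K. \<forall>x'\<in>K. \<bar>snd q x - snd q x'\<bar> \<le> 4 * R * norm (x - x')) \<and>
    (\<forall>x. \<bar>fst q x\<bar> \<le> 12 * R\<^sup>2) \<and> (\<forall>x. \<bar>snd q x\<bar> \<le> 12 * R\<^sup>2) \<and>
    (\<forall>x\<in>K. \<forall>y\<in>K. fst q x + snd q y \<le> sqdist x y) \<and>
    (LINT p|\<gamma>N N. sqdist (fst p) (snd p)) = (LINT x|\<mu>N N. fst q x) + (LINT y|\<nu>N N. snd q y)"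
    for N and q :: "('a \<Rightarrow> real) \<times> ('a \<Rightarrow> real)"
  have "\<exists>q. Q N q" for N
  proof (rule Opt_potentials[OF \<gamma>N[of N] K(1) KN(1)[of N] KN(2)[of N] R(1)])
    fix \<phi> \<psi> :: "'a \<Rightarrow> real"
    assume "continuous_on UNIV \<phi>" "continuous_on UNIV \<psi>"
      "\<And>x x'. x \<in> K \<Longrightarrow> x' \<in> K \<Longrightarrow> \<bar>\<phi> x - \<phi> x'\<bar> \<le> 4 * R * norm (x - x')"
      "\<And>x x'. x \<in> K \<Longrightarrow> x' \<in> K \<Longrightarrow> \<bar>\<psi> x - \<psi> x'\<bar> \<le> 4 * R * norm (x - x')"
      "\<And>x. \<bar>\<phi> x\<bar> \<le> 12 * R\<^sup>2" "\<And>x. \<bar>\<psi> x\<bar> \<le> 12 * R\<^sup>2"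
      "\<And>x y. x \<in> K \<Longrightarrow> y \<in> K \<Longrightarrow> \<phi> x + \<psi> y \<le> sqdist x y"
      "(LINT p|\<gamma>N N. sqdist (fst p) (snd p)) = (LINT x|\<mu>N N. \<phi> x) + (LINT y|\<nu>N N. \<psi> y)"
    then have "Q N (\<phi>, \<psi>)" by (simp add: Q_def)
    then show "\<exists>q. Q N q" by blast
  qed
  then obtain q where q: "\<And>N. Q N (q N)" using choice[of Q] by blast
  \<comment> \<open>Both potentials are packed into one map, so that a single application of
    Arzela-Ascoli extracts a common subsequence.\<close>
  define f where "f n x = (fst (q (r n)) x, snd (q (r n)) x)" for n x
  have fnorm: "norm (f n x) \<le> 24 * R\<^sup>2" for n x
  proof -
    have "\<bar>fst (q (r n)) x\<bar> \<le> 12 * R\<^sup>2" "\<bar>snd (q (r n)) x\<bar> \<le> 12 * R\<^sup>2"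
      using q[of "r n"] by (simp_all add: Q_def)
    then show ?thesis
      using norm_Pair_le[of "fst (q (r n)) x" "snd (q (r n)) x"] by (simp add: f_def)
  qed
  have flip: "norm (f n x - f n y) \<le> 8 * R * norm (x - y)" if "x \<in> K" "y \<in> K" for n x y
  proof -
    have "\<bar>fst (q (r n)) x - fst (q (r n)) y\<bar> \<le> 4 * R * norm (x - y)"
      "\<bar>snd (q (r n)) x - snd (q (r n)) y\<bar> \<le> 4 * R * norm (x - y)"
      using q[of "r n"] that by (simp_all add: Q_def)
    then show ?thesis
      using norm_Pair_le[of "fst (q (r n)) x - fst (q (r n)) y" "snd (q (r n)) x - snd (q (r n)) y"]
      by (simp add: f_def)
  qed
  have equi: "\<exists>d. 0 < d \<and> (\<forall>n y. y \<in> K \<and> norm (x - y) < d \<longrightarrow> norm (f n x - f n y) < e)"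
    if "x \<in> K" "0 < e" for x e
  proof (intro exI[of _ "e / (8 * R + 1)"] conjI allI impI)
    show pos: "0 < e / (8 * R + 1)" using R(2) that by (intro divide_pos_pos) auto
    fix n y assume y: "y \<in> K \<and> norm (x - y) < e / (8 * R + 1)"
    have "norm (f n x - f n y) \<le> 8 * R * norm (x - y)" using flip that y by blast
    also have "\<dots> \<le> (8 * R + 1) * norm (x - y)" by (intro mult_right_mono) auto
    also have "\<dots> < (8 * R + 1) * (e / (8 * R + 1))" using y R(2) by (intro mult_strict_left_mono) auto
    also have "\<dots> = e" using R(2) by simp
    finally show "norm (f n x - f n y) < e" .
  qed
  have "\<exists>g k. continuous_on K g \<and> strict_mono (k :: nat \<Rightarrow> nat) \<and>
     (\<forall>e>0. \<exists>N. \<forall>n x. n \<ge> N \<and> x \<in> K \<longrightarrow> norm (f (k n) x - g x) < e)"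
    by (rule Arzela_Ascoli[of K f "24 * R\<^sup>2", OF K(1) fnorm equi]) blast+
  then obtain g k where g: "continuous_on K g" "strict_mono (k :: nat \<Rightarrow> nat)"
     "\<And>e. e > 0 \<Longrightarrow> \<exists>N. \<forall>n x. n \<ge> N \<and> x \<in> K \<longrightarrow> norm (f (k n) x - g x) < e" by blast
  obtain \<phi> B1 where \<phi>: "continuous_on UNIV \<phi>" "\<And>x. x \<in> K \<Longrightarrow> \<phi> x = fst (g x)" "\<And>x. \<bar>\<phi> x\<bar> \<le> B1"
    by (rule continuous_extension_real[OF K(1) continuous_on_fst[OF g(1)]], rule that)
  obtain \<psi> B2 where \<psi>: "continuous_on UNIV \<psi>" "\<And>x. x \<in> K \<Longrightarrow> \<psi> x = snd (g x)" "\<And>x. \<bar>\<psi> x\<bar> \<le> B2"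
    by (rule continuous_extension_real[OF K(1) continuous_on_snd[OF g(1)]], rule that)
  define s where "s n = r (k n)" for n
  have s: "strict_mono s" using r(1) g(2) by (simp add: s_def strict_mono_def)
  have near: "\<exists>N. \<forall>n\<ge>N. \<forall>x\<in>K. \<bar>fst (q (s n)) x - \<phi> x\<bar> < \<epsilon> \<and> \<bar>snd (q (s n)) x - \<psi> x\<bar> < \<epsilon>"
    if \<epsilon>: "\<epsilon> > 0" for \<epsilon>
  proof -
    obtain N where N: "\<And>n x. n \<ge> N \<Longrightarrow> x \<in> K \<Longrightarrow> norm (f (k n) x - g x) < \<epsilon>" using g(3)[OF \<epsilon>] by blast
    show ?thesis
    proof (intro exI[of _ N] allI impI ballI conjI)
      fix n x assume nx: "N \<le> n" "x \<in> K"
      show "\<bar>fst (q (s n)) x - \<phi> x\<bar> < \<epsilon>"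
        using le_less_trans[OF norm_fst_le[of "fst (f (k n) x - g x)" "snd (f (k n) x - g x)", unfolded prod.collapse] N[OF nx]]
          \<phi>(2)[OF nx(2)] by (simp add: f_def s_def)
      show "\<bar>snd (q (s n)) x - \<psi> x\<bar> < \<epsilon>"
        using le_less_trans[OF norm_snd_le[of "snd (f (k n) x - g x)" "fst (f (k n) x - g x)", unfolded prod.collapse] N[OF nx]]
          \<psi>(2)[OF nx(2)] by (simp add: f_def s_def)
    qed
  qed
  have le: "\<phi> x + \<psi> y \<le> sqdist x y" if "x \<in> K" "y \<in> K" for x y
  proof (rule field_le_epsilon)
    fix \<epsilon> :: real assume "\<epsilon> > 0"
    then obtain N where N: "\<And>x. x \<in> K \<Longrightarrow> \<bar>fst (q (s N)) x - \<phi> x\<bar> < \<epsilon> / 2 \<and> \<bar>snd (q (s N)) x - \<psi> x\<bar> < \<epsilon> / 2"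
      using near[of "\<epsilon> / 2"] by auto
    have "fst (q (s N)) x + snd (q (s N)) y \<le> sqdist x y" using q[of "s N"] that by (simp add: Q_def)
    then show "\<phi> x + \<psi> y \<le> sqdist x y + \<epsilon>" using N[OF that(1)] N[OF that(2)] by linarith
  qed
  \<comment> \<open>Four errors of size \<open>\<epsilon>\<close> will arise, one from uniform
    approximation and one from weak convergence for each of the two potentials.\<close>
  define \<epsilon> where "\<epsilon> = e / 8"
  have \<epsilon>: "\<epsilon> > 0" using e by (simp add: \<epsilon>_def)
  obtain N1 where N1: "\<And>n x. n \<ge> N1 \<Longrightarrow> x \<in> K \<Longrightarrow> \<bar>fst (q (s n)) x - \<phi> x\<bar> < \<epsilon> \<and> \<bar>snd (q (s n)) x - \<psi> x\<bar> < \<epsilon>"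
    using near[OF \<epsilon>] by blast
  have "\<forall>\<^sub>F n in sequentially. (LINT x|\<mu>N (s n). \<phi> x) < (LINT x|\<mu>. \<phi> x) + \<epsilon>"
    using order_tendstoD(2)[OF LIMSEQ_subseq_LIMSEQ[OF weakly_convergesD[OF conv(1) \<phi>(1,3)] s]] \<epsilon>
    by (simp add: comp_def)
  moreover have "\<forall>\<^sub>F n in sequentially. (LINT x|\<nu>N (s n). \<psi> x) < (LINT x|\<nu>. \<psi> x) + \<epsilon>"
    using order_tendstoD(2)[OF LIMSEQ_subseq_LIMSEQ[OF weakly_convergesD[OF conv(2) \<psi>(1,3)] s]] \<epsilon>
    by (simp add: comp_def)
  ultimately have "\<forall>\<^sub>F n in sequentially. n \<ge> N1 \<and> (LINT x|\<mu>N (s n). \<phi> x) < (LINT x|\<mu>. \<phi> x) + \<epsilon> \<and>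
      (LINT x|\<nu>N (s n). \<psi> x) < (LINT x|\<nu>. \<psi> x) + \<epsilon>"
    using eventually_ge_at_top[of N1] by eventually_elim simp
  then obtain n where n: "n \<ge> N1" "(LINT x|\<mu>N (s n). \<phi> x) < (LINT x|\<mu>. \<phi> x) + \<epsilon>"
      "(LINT x|\<nu>N (s n). \<psi> x) < (LINT x|\<nu>. \<psi> x) + \<epsilon>"
    by (auto simp: eventually_sequentially)
  have coupN: "\<gamma>N (s n) \<in> couplings (\<mu>N (s n)) (\<nu>N (s n))" using \<gamma>N[of "s n"] by (simp add: Opt_def)
  note mN = coupling_marginals[OF coupN]
  have inK: "AE x in \<mu>N (s n). x \<in> K" "AE x in \<nu>N (s n). x \<in> K"
    using AE_in_supp[OF mN(2)] AE_in_supp[OF mN(4)] KN[of "s n"] by (auto elim!: eventually_mono)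
  have qs: "continuous_on UNIV (fst (q (s n)))" "continuous_on UNIV (snd (q (s n)))"
    "(LINT p|\<gamma>N (s n). sqdist (fst p) (snd p)) = (LINT x|\<mu>N (s n). fst (q (s n)) x) + (LINT y|\<nu>N (s n). snd (q (s n)) y)"
    using q[of "s n"] by (simp_all add: Q_def)
  have "(LINT x|\<mu>N (s n). fst (q (s n)) x) \<le> (LINT x|\<mu>N (s n). \<phi> x) + \<epsilon>"
    by (rule integral_le_add_const[OF mN(1,2) K(1) inK(1) qs(1) \<phi>(1)]) (use N1[OF n(1)] in fastforce)
  moreover have "(LINT x|\<nu>N (s n). snd (q (s n)) x) \<le> (LINT x|\<nu>N (s n). \<psi> x) + \<epsilon>"
    by (rule integral_le_add_const[OF mN(3,4) K(1) inK(2) qs(2) \<psi>(1)]) (use N1[OF n(1)] in fastforce)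
  moreover have "(LINT x|\<mu>. \<phi> x) + (LINT x|\<nu>. \<psi> x) \<le> (LINT p|\<gamma>. sqdist (fst p) (snd p)) + 0"
    unfolding coupling_integral[OF \<gamma> K \<phi>(1) \<psi>(1), symmetric]
  proof (rule integral_le_add_const[OF couplingsD(1,2)[OF \<gamma>] compact_Times[OF K(1) K(1)] coupling_AE(2)[OF \<gamma> K(2,3)]])
    show "continuous_on UNIV (\<lambda>p. \<phi> (fst p) + \<psi> (snd p))"
      by (intro continuous_on_add continuous_on_compose2[OF \<phi>(1)] continuous_on_compose2[OF \<psi>(1)] continuous_intros) auto
  qed (use le continuous_sqdist in auto)
  ultimately have "(LINT p|\<gamma>N (s n). sqdist (fst p) (snd p)) < (LINT p|\<gamma>. sqdist (fst p) (snd p)) + 4 * \<epsilon>"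
    using n(2,3) qs(3) by linarith
  moreover have "4 * \<epsilon> < e" using e by (simp add: \<epsilon>_def)
  ultimately show False using r(2)[of "k n"] by (simp add: s_def)
qed

text \<open>By uniform continuity on the compact product, functions of \<open>y\<close> belonging to
  nearby \<open>x\<close> are uniformly close, and hence so are their infima.\<close>

lemma continuous_on_INF_compact:
  fixes g :: "'a::metric_space \<times> 'b::metric_space \<Rightarrow> real"
  assumes K: "compact A" "compact C" "C \<noteq> {}" and g: "continuous_on (A \<times> C) g"
  shows "continuous_on A (\<lambda>x. INF y\<in>C. g (x, y))"
    and "\<And>x. x \<in> A \<Longrightarrow> bdd_below ((\<lambda>y. g (x, y)) ` C)"
proof -
  have cAC: "compact (A \<times> C)" using K by (intro compact_Times)
  show bdd: "bdd_below ((\<lambda>y. g (x, y)) ` C)" if "x \<in> A" for x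
  proof -
    have "bdd_below (g ` (A \<times> C))"
      using compact_continuous_image[OF g cAC] by (intro bounded_imp_bdd_below compact_imp_bounded)
    then show ?thesis by (rule bdd_below_mono) (use that in auto)
  qed
  have uc: "uniformly_continuous_on (A \<times> C) g" by (rule compact_uniformly_continuous[OF g cAC])
  show "continuous_on A (\<lambda>x. INF y\<in>C. g (x, y))"
    unfolding continuous_on_iff
  proof (intro ballI allI impI)
    fix x and e :: real assume x: "x \<in> A" and e: "e > 0"
    then obtain d where d: "d > 0" "\<And>p q. p \<in> A \<times> C \<Longrightarrow> q \<in> A \<times> C \<Longrightarrow> dist q p < d \<Longrightarrow> dist (g q) (g p) < e / 2"
      using uc unfolding uniformly_continuous_on_def by (meson half_gt_zero)
    have "dist (INF y\<in>C. g (x', y)) (INF y\<in>C. g (x, y)) < e" if x': "x' \<in> A" "dist x' x < d" for x'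
    proof -
      have "\<bar>(INF y\<in>C. g (x', y)) - (INF y\<in>C. g (x, y))\<bar> \<le> e / 2"
      proof (rule abs_cINF_diff_le[OF K(3) bdd[OF x'(1)] bdd[OF x]])
        fix y assume "y \<in> C"
        then have "dist (g (x', y)) (g (x, y)) < e / 2" using d(2)[of "(x, y)" "(x', y)"] x x' by (simp add: dist_Pair_Pair)
        then show "\<bar>g (x', y) - g (x, y)\<bar> \<le> e / 2" by (simp add: dist_real_def)
      qed
      then show ?thesis using e by (simp add: dist_real_def)
    qed
    with d(1) show "\<exists>d>0. \<forall>x'\<in>A. dist x' x < d \<longrightarrow> dist (INF y\<in>C. g (x', y)) (INF y\<in>C. g (x, y)) < e" by blast
  qed
qed

text \<open>With the potentials of the limit plan put \<open>h = |x - y|\<^sup>2 - \<phi> x - \<psi> y \<ge> 0\<close>. The integrals of \<open>h\<close>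
  against the plans tend to \<open>0\<close>, and \<open>f (x, y) \<le> M h (x, y) - G M x\<close> with
  \<open>G M x = (INF y. M h (x, y) - f (x, y))\<close>; as \<open>M \<rightarrow> \<infinity>\<close>, \<open>G M x \<rightarrow> - f (x, T x)\<close> at every \<open>x\<close> where the
  zero set of \<open>h\<close> is single-valued.\<close>

lemma Opt_stability_limsup:
  fixes \<mu> \<nu> :: "'a::euclidean_space measure" and f :: "'a \<times> 'a \<Rightarrow> real"
  assumes K: "compact K" "supp \<mu> \<subseteq> K" "supp \<nu> \<subseteq> K"
    and \<mu>: "\<mu> \<in> prob_measures" "absolutely_continuous lborel \<mu>"
    and T: "T \<in> borel_measurable borel" "distr \<mu> borel (\<lambda>x. (x, T x)) \<in> Opt \<mu> \<nu>"
    and KN: "\<And>N. supp (\<mu>N N) \<subseteq> K" "\<And>N. supp (\<nu>N N) \<subseteq> K" and \<gamma>N: "\<And>N. \<gamma>N N \<in> Opt (\<mu>N N) (\<nu>N N)"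
    and conv: "weakly_converges \<mu>N \<mu>" "weakly_converges \<nu>N \<nu>"
    and f: "continuous_on UNIV f" "\<And>p. \<bar>f p\<bar> \<le> B" and e: "e > 0"
  shows "\<forall>\<^sub>F N in sequentially. (LINT p|\<gamma>N N. f p) < (LINT x|\<mu>. f (x, T x)) + e"
proof -
  define \<gamma> where "\<gamma> = distr \<mu> borel (\<lambda>x. (x, T x))"
  have \<gamma>opt: "\<gamma> \<in> Opt \<mu> \<nu>" using T(2) by (simp add: \<gamma>_def)
  then have coup: "\<gamma> \<in> couplings \<mu> \<nu>" by (simp add: Opt_def)
  note D = couplingsD[OF coup] and C = coupling_AE[OF coup K(2,3)]
  have m\<mu>: "prob_space \<mu>" "sets \<mu> = sets borel" using \<mu>(1) by (auto simp: prob_measures_def)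
  interpret \<mu>: prob_space \<mu> by (rule m\<mu>(1))
  have Tm: "(\<lambda>x. (x, T x)) \<in> borel_measurable \<mu>"
    by (rule measurable_borel_sets[OF m\<mu>(2)]) (use T(1) in measurable)
  obtain R where R: "\<And>x. x \<in> K \<Longrightarrow> norm x \<le> R" using compact_imp_bounded[OF K(1)] bounded_iff by metis
  obtain \<phi> \<psi> :: "'a \<Rightarrow> real" where \<phi>: "continuous_on UNIV \<phi>" and \<psi>: "continuous_on UNIV \<psi>"
    and "\<And>x x'. x \<in> K \<Longrightarrow> x' \<in> K \<Longrightarrow> \<bar>\<phi> x - \<phi> x'\<bar> \<le> 4 * R * norm (x - x')"
    and "\<And>y y'. y \<in> K \<Longrightarrow> y' \<in> K \<Longrightarrow> \<bar>\<psi> y - \<psi> y'\<bar> \<le> 4 * R * norm (y - y')"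
    and bd: "\<And>x. \<bar>\<phi> x\<bar> \<le> 12 * R\<^sup>2" "\<And>y. \<bar>\<psi> y\<bar> \<le> 12 * R\<^sup>2"
    and le: "\<And>x y. x \<in> K \<Longrightarrow> y \<in> K \<Longrightarrow> \<phi> x + \<psi> y \<le> sqdist x y"
    and eq: "\<And>p. p \<in> supp \<gamma> \<Longrightarrow> \<phi> (fst p) + \<psi> (snd p) = sqdist (fst p) (snd p)"
    and cost: "(LINT p|\<gamma>. sqdist (fst p) (snd p)) = (LINT x|\<mu>. \<phi> x) + (LINT y|\<nu>. \<psi> y)"
    by (rule Opt_potentials[OF \<gamma>opt K R], assumption, rule that)
  define h where "h p = sqdist (fst p) (snd p) - (\<phi> (fst p) + \<psi> (snd p))" for p :: "'a \<times> 'a"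
  have hc: "continuous_on UNIV h"
    unfolding h_def
    by (intro continuous_on_diff continuous_sqdist continuous_on_add continuous_on_compose2[OF \<phi>]
        continuous_on_compose2[OF \<psi>] continuous_intros) auto
  have h0: "0 \<le> h p" if "p \<in> K \<times> K" for p using le that by (auto simp: h_def)
  have coupN: "\<gamma>N N \<in> couplings (\<mu>N N) (\<nu>N N)" for N using \<gamma>N by (simp add: Opt_def)
  note cKK = compact_Times[OF K(1) K(1)]
  note intN = integrable_continuous_compact[OF couplingsD(1,2)[OF coupN] cKK coupling_AE(2)[OF coupN KN]]
  \<comment> \<open>The integral of \<open>h\<close> is the cost of the plan minus the integrals of
    \<open>\<phi>\<close> and \<open>\<psi>\<close> over its marginals. The costs have upper limit
    at most that of \<open>\<gamma>\<close>, the marginal integrals converge, and the limits cancel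
    by duality.\<close>
  have hint: "\<forall>\<^sub>F N in sequentially. (LINT p|\<gamma>N N. h p) < \<epsilon>" if "\<epsilon> > 0" for \<epsilon>
  proof -
    have hN: "(LINT p|\<gamma>N N. h p) = (LINT p|\<gamma>N N. sqdist (fst p) (snd p)) - ((LINT x|\<mu>N N. \<phi> x) + (LINT y|\<nu>N N. \<psi> y))" for N
      unfolding h_def coupling_integral[OF coupN K(1) KN \<phi> \<psi>, symmetric]
      by (intro Bochner_Integration.integral_diff intN continuous_sqdist continuous_on_add continuous_on_compose2[OF \<phi>]
        continuous_on_compose2[OF \<psi>] continuous_intros) auto
    have "\<forall>\<^sub>F N in sequentially. (LINT p|\<gamma>N N. sqdist (fst p) (snd p)) < (LINT p|\<gamma>. sqdist (fst p) (snd p)) + \<epsilon> / 3"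
      using that by (intro Opt_cost_limsup[OF K coup KN \<gamma>N conv]) auto
    moreover have "\<forall>\<^sub>F N in sequentially. (LINT x|\<mu>. \<phi> x) - \<epsilon> / 3 < (LINT x|\<mu>N N. \<phi> x)"
      by (rule order_tendstoD(1)[OF weakly_convergesD[OF conv(1) \<phi> bd(1)]]) (use that in simp)
    moreover have "\<forall>\<^sub>F N in sequentially. (LINT x|\<nu>. \<psi> x) - \<epsilon> / 3 < (LINT x|\<nu>N N. \<psi> x)"
      by (rule order_tendstoD(1)[OF weakly_convergesD[OF conv(2) \<psi> bd(2)]]) (use that in simp)
    ultimately show ?thesis by eventually_elim (use cost in \<open>simp add: hN\<close>)
  qed
  define \<Gamma> where "\<Gamma> = {p \<in> K \<times> K. h p = 0}"
  have "negligible {x. \<exists>y1 y2. (x, y1) \<in> \<Gamma> \<and> (x, y2) \<in> \<Gamma> \<and> y1 \<noteq> y2}"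
  proof (rule negligible_multivalued_monotone)
    show "bounded (fst ` \<Gamma>)"
      by (rule bounded_subset[OF compact_imp_bounded[OF K(1)]]) (auto simp: \<Gamma>_def)
    fix x y x' y' assume *: "(x, y) \<in> \<Gamma>" "(x', y') \<in> \<Gamma>"
    \<comment> \<open>Equality of potentials and cost at two points, compared with the inequality
      for the crossed pairs, is monotonicity once the squares are expanded.\<close>
    then have "sqdist x y + sqdist x' y' = (\<phi> x + \<psi> y') + (\<phi> x' + \<psi> y)" by (simp add: \<Gamma>_def h_def)
    also have "\<dots> \<le> sqdist x y' + sqdist x' y" using * by (intro add_mono le) (auto simp: \<Gamma>_def)
    finally have "0 \<le> 2 * ((x - x') \<bullet> (y - y'))"
      by (simp add: power2_norm_eq_inner inner_simps inner_commute)
    then show "0 \<le> (x - x') \<bullet> (y - y')" by simp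
  qed
  \<comment> \<open>Absolute continuity concerns Borel null sets, while a negligible set is only
    Lebesgue null; \<open>Z\<close> is a Borel null set around it.\<close>
  then obtain Z where Z: "Z \<in> null_sets lborel" "{x. \<exists>y1 y2. (x, y1) \<in> \<Gamma> \<and> (x, y2) \<in> \<Gamma> \<and> y1 \<noteq> y2} \<subseteq> Z"
    unfolding negligible_iff_null_sets null_sets_completion_iff2 by blast
  have aeZ: "AE x in \<mu>. x \<notin> Z"
    using Z(1) \<mu>(2) unfolding absolutely_continuous_def by (intro AE_not_in) auto
  have "AE x in \<mu>. (x, T x) \<in> supp \<gamma>"
    using C(1) unfolding \<gamma>_def by (rule AE_distrD[OF Tm])
  with aeZ have good: "AE x in \<mu>. (x, T x) \<in> \<Gamma> \<and> (\<forall>y. (x, y) \<in> \<Gamma> \<longrightarrow> y = T x)"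
  proof eventually_elim
    case (elim x)
    then have "(x, T x) \<in> \<Gamma>" using C(3) eq[OF elim(2)] by (auto simp: \<Gamma>_def h_def)
    then show ?case using elim(1) Z(2) by blast
  qed
  have Kne: "K \<noteq> {}"
  proof
    assume "K = {}"
    then have "AE x in \<mu>. False" using good by (simp add: \<Gamma>_def)
    then show False by simp
  qed
  define G where "G M x = (INF y\<in>K. real M * h (x, y) - f (x, y))" for M :: nat and x
  have gc: "continuous_on (K \<times> K) (\<lambda>p. real M * h p - f p)" for M
    using continuous_on_subset[OF hc] continuous_on_subset[OF f(1)] by (intro continuous_intros) auto
  have Gbdd: "bdd_below ((\<lambda>y. real M * h (x, y) - f (x, y)) ` K)" if "x \<in> K" for M x
    using continuous_on_INF_compact(2)[OF K(1) K(1) Kne gc that] by simp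
  have Gle: "G M x \<le> real M * h (x, y) - f (x, y)" if "x \<in> K" "y \<in> K" for M x y
    unfolding G_def by (rule cINF_lower[OF Gbdd[OF that(1)] that(2)])
  have Gc: "continuous_on K (G M)" for M
    unfolding G_def using continuous_on_INF_compact(1)[OF K(1) K(1) Kne gc] by simp
  \<comment> \<open>\<open>G M\<close> is continuous on \<open>K\<close> only and must be extended
    to be tested against the marginals; \<open>snd q\<close> records a bound of the extension, which
    may depend on \<open>M\<close>.\<close>
  have "\<exists>q. continuous_on UNIV (fst q) \<and> (\<forall>x\<in>K. fst q x = G M x) \<and> (\<forall>x. \<bar>fst q x\<bar> \<le> snd q)" for M
  proof (rule continuous_extension_real[OF K(1) Gc[of M]])
    fix g :: "'a \<Rightarrow> real" and B
    assume "continuous_on UNIV g" "\<And>x. x \<in> K \<Longrightarrow> g x = G M x" "\<And>x. \<bar>g x\<bar> \<le> B"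
    then show ?thesis by (intro exI[of _ "(g, B)"]) simp
  qed
  then obtain q where q: "\<And>M. continuous_on UNIV (fst (q M)) \<and> (\<forall>x\<in>K. fst (q M) x = G M x) \<and>
      (\<forall>x. \<bar>fst (q M) x\<bar> \<le> snd (q M))"
    using choice[of "\<lambda>M q. continuous_on UNIV (fst q) \<and> (\<forall>x\<in>K. fst q x = G M x) \<and> (\<forall>x. \<bar>fst q x\<bar> \<le> snd q)"]
    by blast
  define G' where "G' M = fst (q M)" for M
  define b where "b M = snd (q M)" for M
  have G': "\<And>M. continuous_on UNIV (G' M)" "\<And>M x. x \<in> K \<Longrightarrow> G' M x = G M x" "\<And>M x. \<bar>G' M x\<bar> \<le> b M"
    using q by (simp_all add: G'_def b_def)
  have lim: "AE x in \<mu>. (\<lambda>M. G' M x) \<longlonglongrightarrow> - f (x, T x)"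
    using good
  proof eventually_elim
    case (elim x)
    then have x: "x \<in> K" "T x \<in> K" "h (x, T x) = 0" and uniq: "\<And>y. y \<in> K \<Longrightarrow> h (x, y) = 0 \<Longrightarrow> y = T x"
      by (auto simp: \<Gamma>_def)
    have "(\<lambda>M. G M x) \<longlonglongrightarrow> - f (x, T x)"
    proof (rule order_tendstoI)
      fix a assume "- f (x, T x) < a"
      then have "G M x < a" for M using Gle[OF x(1,2), of M] x(3) by simp
      then show "\<forall>\<^sub>F M in sequentially. G M x < a" by simp
    next
      fix a assume a: "a < - f (x, T x)"
      define a' where "a' = (a - f (x, T x)) / 2"
      have a': "a < a'" "a' < - f (x, T x)" using a by (auto simp: a'_def)
      define S where "S = {y \<in> K. - f (x, y) \<le> a'}"
      have hx: "continuous_on UNIV (\<lambda>y. h (x, y))" and fx: "continuous_on UNIV (\<lambda>y. f (x, y))"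
        by (rule continuous_on_compose2[OF hc] continuous_on_compose2[OF f(1)]; auto intro!: continuous_intros)+
      have "compact S"
      proof -
        have "closed {y. - f (x, y) \<le> a'}" by (intro closed_Collect_le continuous_on_minus fx continuous_on_const)
        from compact_Int_closed[OF K(1) this] show ?thesis by (simp add: S_def Collect_conj_eq)
      qed
      have "\<exists>\<delta>>0. \<forall>y\<in>S. \<delta> \<le> h (x, y)"
      proof (cases "S = {}")
        case True
        then show ?thesis by (intro exI[of _ 1]) auto
      next
        case False
        then obtain y0 where y0: "y0 \<in> S" "\<And>y. y \<in> S \<Longrightarrow> h (x, y0) \<le> h (x, y)"
          using continuous_attains_inf[OF \<open>compact S\<close> False continuous_on_subset[OF hx]] by blast
        have "y0 \<noteq> T x" using y0(1) a' by (auto simp: S_def)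
        then have "h (x, y0) \<noteq> 0" using uniq y0(1) by (auto simp: S_def)
        moreover have "0 \<le> h (x, y0)" using h0[of "(x, y0)"] x(1) y0(1) by (simp add: S_def)
        ultimately have "0 < h (x, y0)" by simp
        then show ?thesis using y0(2) by blast
      qed
      then obtain \<delta> where \<delta>: "\<delta> > 0" "\<And>y. y \<in> S \<Longrightarrow> \<delta> \<le> h (x, y)" by blast
      \<comment> \<open>On \<open>S\<close> the penalty \<open>real M * h (x, y)\<close> now exceeds
        \<open>2 * B\<close>, the largest possible gain of \<open>f\<close>; elsewhere in
        \<open>K\<close> the value already exceeds \<open>a'\<close>.\<close>
      obtain M0 :: nat where M0: "2 * B < real M0 * \<delta>" using reals_Archimedean3[OF \<delta>(1)] by blast
      have "a < G M x" if M: "M \<ge> M0" for M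
      proof -
        have "a' \<le> G M x"
          unfolding G_def
        proof (rule cINF_greatest[OF Kne])
          fix y assume y: "y \<in> K"
          have hy: "0 \<le> h (x, y)" using h0[of "(x, y)"] x(1) y by simp
          show "a' \<le> real M * h (x, y) - f (x, y)"
          proof (cases "y \<in> S")
            case True
            have "real M0 * \<delta> \<le> real M * h (x, y)"
              using M \<delta> True by (intro mult_mono) auto
            then show ?thesis using M0 f(2)[of "(x, y)"] f(2)[of "(x, T x)"] a' by linarith
          next
            case False
            then have "a' < - f (x, y)" using y by (simp add: S_def)
            moreover have "0 \<le> real M * h (x, y)" using hy by simp
            ultimately show ?thesis by linarith
          qed
        qed
        then show ?thesis using a' by simp
      qed
      then show "\<forall>\<^sub>F M in sequentially. a < G M x" by (auto simp: eventually_sequentially)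
    qed
    then show ?case using G'(2)[OF x(1)] by simp
  qed
  have Gm: "G' M \<in> borel_measurable \<mu>" for M
    by (intro measurable_borel_sets[OF m\<mu>(2)] borel_measurable_continuous_onI G')
  have fTm: "(\<lambda>x. f (x, T x)) \<in> borel_measurable \<mu>"
    by (rule measurable_compose[OF Tm]) (intro borel_measurable_continuous_onI f)
  have "(\<lambda>M. LINT x|\<mu>. G' M x) \<longlonglongrightarrow> (LINT x|\<mu>. - f (x, T x))"
  proof (rule integral_dominated_convergence[where w="\<lambda>_. B"])
    show "(\<lambda>x. - f (x, T x)) \<in> borel_measurable \<mu>" using fTm by simp
    show "AE x in \<mu>. norm (G' M x) \<le> B" for M
      using good
    proof eventually_elim
      case (elim x)
      then have x: "x \<in> K" "T x \<in> K" "h (x, T x) = 0" by (auto simp: \<Gamma>_def)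
      have "- B \<le> G M x"
        unfolding G_def
      proof (rule cINF_greatest[OF Kne])
        fix y assume "y \<in> K"
        then have "0 \<le> real M * h (x, y)" using h0[of "(x, y)"] x(1) by simp
        then show "- B \<le> real M * h (x, y) - f (x, y)" using f(2)[of "(x, y)"] by linarith
      qed
      moreover have "G M x \<le> B" using Gle[OF x(1,2), of M] x(3) f(2)[of "(x, T x)"] by simp
      ultimately show ?case using G'(2)[OF x(1)] by simp
    qed
  qed (use Gm lim in auto)
  then have "\<forall>\<^sub>F M in sequentially. (LINT x|\<mu>. - f (x, T x)) - e / 3 < (LINT x|\<mu>. G' M x)"
    by (rule order_tendstoD(1)) (use e in simp)
  then obtain M where M: "- (LINT x|\<mu>. f (x, T x)) - e / 3 < (LINT x|\<mu>. G' M x)"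
    by (auto simp: eventually_sequentially)
  have "\<forall>\<^sub>F N in sequentially. (LINT x|\<mu>. G' M x) - e / 3 < (LINT x|\<mu>N N. G' M x)"
    by (rule order_tendstoD(1)[OF weakly_convergesD[OF conv(1) G'(1,3)]]) (use e in simp)
  \<comment> \<open>\<open>M\<close> is fixed before \<open>N\<close>, so the penalty
    \<open>real M\<close> times the integral of \<open>h\<close> can be made at most
    \<open>e / 3\<close>; the added 1 covers \<open>M = 0\<close>.\<close>
  moreover have "\<forall>\<^sub>F N in sequentially. (LINT p|\<gamma>N N. h p) < e / (3 * (real M + 1))"
    by (rule hint) (use e in simp)
  ultimately show ?thesis
  proof eventually_elim
    case (elim N)
    have c0: "continuous_on UNIV (\<lambda>x::'a. 0::real)" by simp
    have GN: "(LINT p|\<gamma>N N. G' M (fst p)) = (LINT x|\<mu>N N. G' M x)"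
      using coupling_integral[OF coupN K(1) KN G'(1) c0, of N M] by simp
    have gcont: "continuous_on UNIV (\<lambda>p::'a \<times> 'a. G' M (fst p))"
      by (intro continuous_on_compose2[OF G'(1)] continuous_intros) auto
    have "(LINT p|\<gamma>N N. f p) \<le> (LINT p|\<gamma>N N. real M * h p - G' M (fst p)) + 0"
    proof (rule integral_le_add_const[OF couplingsD(1,2)[OF coupN] cKK coupling_AE(2)[OF coupN KN] f(1)])
      show "continuous_on UNIV (\<lambda>p. real M * h p - G' M (fst p))" by (intro continuous_intros hc gcont)
      fix p assume "p \<in> K \<times> K"
      then show "f p \<le> real M * h p - G' M (fst p) + 0"
        using Gle[of "fst p" "snd p" M] G'(2)[of "fst p" M] by (auto simp: mem_Times_iff)
    qed
    also have "\<dots> = real M * (LINT p|\<gamma>N N. h p) - (LINT x|\<mu>N N. G' M x)"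
      unfolding GN[symmetric] using intN[OF hc] intN[OF gcont] by simp
    also have "\<dots> < (LINT x|\<mu>. f (x, T x)) + e"
    proof -
      have "real M * (LINT p|\<gamma>N N. h p) \<le> real M * (e / (3 * (real M + 1)))"
        using elim(2) by (intro mult_left_mono) auto
      also have "\<dots> \<le> e / 3" using e by (simp add: field_simps)
      finally show ?thesis using M elim(1) by linarith
    qed
    finally show ?case .
  qed
qed

text \<open>The one-sided bound applied to \<open>f\<close> and to \<open>- f\<close>.\<close>

lemma Opt_stability:
  fixes \<mu> \<nu> :: "'a::euclidean_space measure"
  assumes K: "compact K" "supp \<mu> \<subseteq> K" "supp \<nu> \<subseteq> K"
    and \<mu>: "\<mu> \<in> prob_measures" "absolutely_continuous lborel \<mu>"
    and T: "T \<in> borel_measurable borel" "distr \<mu> borel (\<lambda>x. (x, T x)) \<in> Opt \<mu> \<nu>"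
    and KN: "\<And>N. supp (\<mu>N N) \<subseteq> K" "\<And>N. supp (\<nu>N N) \<subseteq> K" and \<gamma>N: "\<And>N. \<gamma>N N \<in> Opt (\<mu>N N) (\<nu>N N)"
    and conv: "weakly_converges \<mu>N \<mu>" "weakly_converges \<nu>N \<nu>"
  shows "weakly_converges \<gamma>N (distr \<mu> borel (\<lambda>x. (x, T x)))"
  unfolding weakly_converges_def
proof (intro allI impI, elim conjE)
  fix f :: "'a \<times> 'a \<Rightarrow> real" assume f: "continuous_on UNIV f" "bounded (range f)"
  then obtain B where B: "\<And>p. \<bar>f p\<bar> \<le> B" by (auto simp: bounded_iff)
  have sets: "sets \<mu> = sets borel" using \<mu>(1) by (simp add: prob_measures_def)
  have "(LINT p|distr \<mu> borel (\<lambda>x. (x, T x)). f p) = (LINT x|\<mu>. f (x, T x))"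
    by (rule integral_distr, rule measurable_borel_sets[OF sets])
      (use T(1) f(1) in \<open>auto intro!: borel_measurable_continuous_onI borel_measurable_Pair\<close>)
  moreover have "(\<lambda>N. LINT p|\<gamma>N N. f p) \<longlonglongrightarrow> (LINT x|\<mu>. f (x, T x))"
  proof (rule order_tendstoI)
    fix a assume "(LINT x|\<mu>. f (x, T x)) < a"
    then show "\<forall>\<^sub>F N in sequentially. (LINT p|\<gamma>N N. f p) < a"
      using Opt_stability_limsup[OF K \<mu> T KN \<gamma>N conv f(1) B, of "a - (LINT x|\<mu>. f (x, T x))"] by simp
  next
    fix a assume a: "a < (LINT x|\<mu>. f (x, T x))"
    have "\<forall>\<^sub>F N in sequentially. (LINT p|\<gamma>N N. - f p) < (LINT x|\<mu>. - f (x, T x)) + ((LINT x|\<mu>. f (x, T x)) - a)"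
      by (rule Opt_stability_limsup[OF K \<mu> T KN \<gamma>N conv, of "\<lambda>p. - f p" B])
        (use f(1) B a in \<open>auto intro: continuous_on_minus\<close>)
    then show "\<forall>\<^sub>F N in sequentially. a < (LINT p|\<gamma>N N. f p)" by simp
  qed
  ultimately show "(\<lambda>N. LINT p|\<gamma>N N. f p) \<longlonglongrightarrow> (LINT p|distr \<mu> borel (\<lambda>x. (x, T x)). f p)" by simp
qed

section \<open>Minimizers\<close>

text \<open>Points of the closure are replaced by nearby members \<open>x (j n)\<close> with errors
  tending to 0. The hypothesis handles indices \<open>j n\<close> that are unbounded; otherwise some
  index recurs infinitely often.\<close>

lemma compact_closure_range:
  fixes x :: "nat \<Rightarrow> 'a::metric_space"
  assumes sub: "\<And>r :: nat \<Rightarrow> nat. strict_mono r \<Longrightarrow> \<exists>s l. strict_mono s \<and> (\<lambda>n. x (r (s n))) \<longlonglongrightarrow> l"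
  shows "compact (closure (range x))"
  unfolding compact_def
proof (intro allI impI)
  fix f :: "nat \<Rightarrow> 'a" assume f: "\<forall>n. f n \<in> closure (range x)"
  have "\<exists>i. dist (x i) (f n) < inverse (real (Suc n))" for n
  proof -
    have "f n \<in> closure (range x)" using f by blast
    from closure_approachable[THEN iffD1, OF this, rule_format, of "inverse (real (Suc n))"]
    show ?thesis by auto
  qed
  then obtain j where j: "\<And>n. dist (x (j n)) (f n) < inverse (real (Suc n))" by metis
  have "\<exists>q l. strict_mono (q :: nat \<Rightarrow> nat) \<and> (\<lambda>n. x (j (q n))) \<longlonglongrightarrow> l"
  proof (cases "\<forall>N b. \<exists>n>N. b < j n")
    case True
    \<comment> \<open>The positions \<open>q n\<close> and the indices \<open>j (q n)\<close> are
      made to increase together, so that the first select a subsequence of \<open>f\<close> and the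
      second one of \<open>x\<close>.\<close>
    have "\<exists>q. \<forall>n. True \<and> (q n < q (Suc n) \<and> j (q n) < j (q (Suc n)))"
      by (rule dependent_nat_choice) (use True in auto)
    then obtain q where q: "\<And>n. q n < q (Suc n)" "\<And>n. j (q n) < j (q (Suc n))" by blast
    have sm: "strict_mono q" "strict_mono (\<lambda>n. j (q n))" using q by (auto intro: strict_monoI_Suc)
    obtain s l where s: "strict_mono s" "(\<lambda>n. x (j (q (s n)))) \<longlonglongrightarrow> l" using sub[OF sm(2)] by blast
    have "strict_mono (\<lambda>n. q (s n))" using sm(1) s(1) by (simp add: strict_mono_def)
    then show ?thesis using s(2) by blast
  next
    case False
    then obtain N b where Nb: "\<And>n. n > N \<Longrightarrow> j n \<le> b" by (meson not_less)
    have "finite (j ` {N<..})" by (rule finite_subset[of _ "{..b}"]) (use Nb in auto)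
    then obtain i where i: "infinite {n \<in> {N<..}. j n = j i}"
      using pigeonhole_infinite[of "{N<..}" j] infinite_Ioi by auto
    then obtain q where q: "strict_mono (q :: nat \<Rightarrow> nat)" "\<And>n. q n \<in> {n \<in> {N<..}. j n = j i}"
      using infinite_enumerate by blast
    then have "(\<lambda>n. x (j (q n))) = (\<lambda>n. x (j i))" by auto
    then have "(\<lambda>n. x (j (q n))) \<longlonglongrightarrow> x (j i)" by simp
    then show ?thesis using q(1) by blast
  qed
  then obtain q l where q: "strict_mono (q :: nat \<Rightarrow> nat)" and l: "(\<lambda>n. x (j (q n))) \<longlonglongrightarrow> l" by blast
  have "(\<lambda>n. inverse (real (Suc (q n)))) \<longlonglongrightarrow> 0"
    using LIMSEQ_subseq_LIMSEQ[OF LIMSEQ_inverse_real_of_nat q] by (simp add: comp_def)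
  then have "(\<lambda>n. dist (x (j (q n))) (f (q n))) \<longlonglongrightarrow> 0"
    by (rule Lim_null_comparison[rotated]) (use j in \<open>auto intro!: always_eventually less_imp_le\<close>)
  then have fq: "(\<lambda>n. f (q n)) \<longlonglongrightarrow> l"
  proof -
    assume d: "(\<lambda>n. dist (x (j (q n))) (f (q n))) \<longlonglongrightarrow> 0"
    have "(\<lambda>n. dist (x (j (q n))) (f (q n)) + dist (x (j (q n))) l) \<longlonglongrightarrow> 0"
      using l by (intro tendsto_add_zero d) (simp add: tendsto_dist_iff[symmetric])
    then have "(\<lambda>n. dist (f (q n)) l) \<longlonglongrightarrow> 0"
      by (rule Lim_null_comparison[rotated]) (simp add: dist_triangle3)
    then show ?thesis using tendsto_dist_iff by blast
  qed
  moreover have "l \<in> closure (range x)"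
    using closed_sequentially[OF closed_closure, of "\<lambda>n. f (q n)"] f fq by blast
  ultimately show "\<exists>l\<in>closure (range x). \<exists>r. strict_mono r \<and> (f \<circ> r) \<longlonglongrightarrow> l"
    using q by (auto simp: comp_def)
qed

text \<open>Preimages of open sets under \<open>x \<mapsto> x \<bullet> v\<close> are subbasic. Only
  this direction is called for: weak limits are given in the liminf inequality, while recovery
  sequences are constant.\<close>

lemma limitin_weak_topology:
  fixes w :: "nat \<Rightarrow> 'a::real_inner"
  assumes "limitin (subtopology weak_topology B) w u sequentially"
  shows "(\<lambda>N. w N \<bullet> v) \<longlonglongrightarrow> u \<bullet> v"
proof (rule topological_tendstoI)
  fix S :: "real set" assume S: "open S" "u \<bullet> v \<in> S"
  have "openin weak_topology ((\<lambda>x. x \<bullet> v) -` S)"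
    unfolding weak_topology_def
    by (rule topology_generated_by_Basis) (use S bounded_linear_inner_left in blast)
  then have "openin (subtopology weak_topology B) (B \<inter> (\<lambda>x. x \<bullet> v) -` S)"
    by (rule openin_subtopology_Int2)
  moreover have "u \<in> B \<inter> (\<lambda>x. x \<bullet> v) -` S"
    using assms S by (auto simp: limitin_def)
  ultimately have "\<forall>\<^sub>F N in sequentially. w N \<in> B \<inter> (\<lambda>x. x \<bullet> v) -` S"
    using assms unfolding limitin_def by blast
  then show "\<forall>\<^sub>F N in sequentially. w N \<bullet> v \<in> S" by eventually_elim simp
qed

lemma topspace_weak_topology: "topspace (weak_topology :: 'a::real_normed_vector topology) = UNIV"
proof -
  have "UNIV \<in> {f -` S | (f :: 'a \<Rightarrow> real) S. bounded_linear f \<and> open S}"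
    using bounded_linear_zero[where 'a='a and 'b=real] by blast
  then have "openin (weak_topology :: 'a topology) UNIV"
    unfolding weak_topology_def by (rule topology_generated_by_Basis)
  then show ?thesis by (metis openin_subset top.extremum_unique)
qed

section \<open>The misfit term and the direct method\<close>

context lipschitz_control_system
begin

text \<open>The data term is split off because it converges along weakly convergent controls,
  whereas the norm term is only lower semicontinuous.\<close>

definition misfit :: "((real ^ 'n) \<times> (real ^ 'n)) measure \<Rightarrow> (real ^ 'k) L2 \<Rightarrow> real" where
  "misfit \<gamma> u = (LINT p|\<gamma>. (norm (flow F u (fst p) - snd p))\<^sup>2)"

lemma functional_plan_eq: "functional_plan F \<beta> \<gamma> u = misfit \<gamma> u + \<beta> / 2 * (norm u)\<^sup>2"
  by (simp add: functional_plan_def misfit_def)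

lemma misfit_nonneg: "0 \<le> misfit \<gamma> u"
  unfolding misfit_def by (intro integral_nonneg_AE) simp

lemma integrand_continuous: "continuous_on UNIV (\<lambda>p. (norm (flow F u (fst p) - snd p))\<^sup>2)"
  by (intro continuous_intros continuous_on_compose2[OF flow_continuous]) auto

text \<open>Replacing \<open>w N\<close> by \<open>u\<close> changes the integrand uniformly little
  on \<open>K \<times> K\<close>, where all the measures are concentrated. What remains is a fixed
  integrand, to which weak convergence of the plans applies.\<close>

lemma misfit_converges:
  assumes K: "compact K"
    and \<gamma>: "\<And>N. prob_space (\<gamma> N)" "\<And>N. sets (\<gamma> N) = sets borel" "\<And>N. AE p in \<gamma> N. p \<in> K \<times> K"
    and \<gamma>': "prob_space \<gamma>'" "sets \<gamma>' = sets borel" "AE p in \<gamma>'. p \<in> K \<times> K"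
    and conv: "weakly_converges \<gamma> \<gamma>'"
    and R: "\<And>N. norm (w N) \<le> R" and weak: "\<And>v. (\<lambda>N. w N \<bullet> v) \<longlonglongrightarrow> u \<bullet> v"
  shows "(\<lambda>N. misfit (\<gamma> N) (w N)) \<longlonglongrightarrow> misfit \<gamma>' u"
proof -
  define c where "c v p = (norm (flow F v (fst p) - snd p))\<^sup>2" for v p
  have cc: "continuous_on UNIV (c v)" for v unfolding c_def by (rule integrand_continuous)
  note cKK = compact_Times[OF K K]
  \<comment> \<open>The integrand may be unbounded on the whole space, so weak convergence is tested
    with a bounded extension of its restriction to \<open>K \<times> K\<close>.\<close>
  obtain g B where g: "continuous_on UNIV g" "\<And>p. p \<in> K \<times> K \<Longrightarrow> g p = c u p" "\<And>p. \<bar>g p\<bar> \<le> B"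
    by (rule continuous_extension_real[OF cKK continuous_on_subset[OF cc[of u] subset_UNIV]], rule that)
  have ug: "misfit M u = (LINT p|M. g p)"
    if "sets M = sets borel" "AE p in M. p \<in> K \<times> K" for M
    unfolding misfit_def
  proof (rule integral_cong_AE)
    show "(\<lambda>p. (norm (flow F u (fst p) - snd p))\<^sup>2) \<in> borel_measurable M" "g \<in> borel_measurable M"
      by (intro measurable_borel_sets[OF that(1)] borel_measurable_continuous_onI g integrand_continuous)+
    show "AE p in M. (norm (flow F u (fst p) - snd p))\<^sup>2 = g p"
      using that(2) by eventually_elim (simp add: g(2) c_def)
  qed
  have lim: "(\<lambda>N. misfit (\<gamma> N) u) \<longlonglongrightarrow> misfit \<gamma>' u"
    using weakly_convergesD[OF conv g(1,3)] ug[OF \<gamma>(2,3)] ug[OF \<gamma>'(2,3)] by simp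
  have "continuous_on (K \<times> K) (\<lambda>p. flow F u (fst p) - snd p)"
    by (intro continuous_intros continuous_on_compose2[OF flow_continuous]) auto
  from compact_continuous_image[OF this cKK]
  obtain D0 where D0: "\<And>p. p \<in> K \<times> K \<Longrightarrow> norm (flow F u (fst p) - snd p) \<le> D0"
    by (meson bounded_iff compact_imp_bounded imageI)
  define D where "D = max 0 D0"
  have D: "0 \<le> D" "\<And>p. p \<in> K \<times> K \<Longrightarrow> norm (flow F u (fst p) - snd p) \<le> D"
    using D0 by (fastforce simp: D_def)+
  have "(\<lambda>N. misfit (\<gamma> N) (w N) - misfit (\<gamma> N) u) \<longlonglongrightarrow> 0"
  proof (rule tendstoI)
    fix e :: real assume e: "e > 0"
    \<comment> \<open>A difference of squares is at most
      \<open>\<epsilon> * (2 * D + \<epsilon>)\<close>; the cap 1 turns this into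
      \<open>\<epsilon> * (2 * D + 1)\<close>.\<close>
    define \<epsilon> where "\<epsilon> = min 1 (e / (2 * (2 * D + 1)))"
    have \<epsilon>: "0 < \<epsilon>" "\<epsilon> \<le> 1" using e D(1) by (auto simp: \<epsilon>_def)
    have \<epsilon>e: "\<epsilon> * (2 * D + 1) \<le> e / 2"
    proof -
      have "\<epsilon> * (2 * D + 1) \<le> e / (2 * (2 * D + 1)) * (2 * D + 1)"
        using D(1) by (intro mult_right_mono) (auto simp: \<epsilon>_def)
      also have "\<dots> = e / 2" using D(1) by (simp add: field_simps)
      finally show ?thesis .
    qed
    show "\<forall>\<^sub>F N in sequentially. dist (misfit (\<gamma> N) (w N) - misfit (\<gamma> N) u) 0 < e"
      using flow_weakly_uniformly_continuous[OF K R weak \<epsilon>(1)]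
    proof eventually_elim
      case (elim N)
      have close: "\<bar>c (w N) p - c u p\<bar> \<le> e / 2" if p: "p \<in> K \<times> K" for p
      proof -
        define a where "a = flow F (w N) (fst p) - snd p"
        define b where "b = flow F u (fst p) - snd p"
        have ab: "norm (a - b) \<le> \<epsilon>" using elim p by (auto simp: a_def b_def dist_norm)
        have b: "norm b \<le> D" using D(2)[OF p] by (simp add: b_def)
        have na: "\<bar>norm a - norm b\<bar> \<le> \<epsilon>" using norm_triangle_ineq3[of a b] ab by linarith
        have "\<bar>(norm a)\<^sup>2 - (norm b)\<^sup>2\<bar> = \<bar>norm a - norm b\<bar> * (norm a + norm b)"
          by (simp add: power2_eq_square square_diff_square_factored abs_mult mult.commute)
        also have "\<dots> \<le> \<epsilon> * (2 * D + 1)"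
          using na b \<epsilon> by (intro mult_mono) auto
        finally show ?thesis using \<epsilon>e by (simp add: c_def a_def b_def)
      qed
      note le = integral_le_add_const[OF \<gamma>(1)[of N] \<gamma>(2)[of N] cKK \<gamma>(3)[of N] cc cc]
      have "(LINT p|\<gamma> N. c (w N) p) \<le> (LINT p|\<gamma> N. c u p) + e / 2"
        by (rule le, drule close, linarith)
      moreover have "(LINT p|\<gamma> N. c u p) \<le> (LINT p|\<gamma> N. c (w N) p) + e / 2"
        by (rule le, drule close, linarith)
      ultimately show ?case using e by (simp add: misfit_def c_def dist_real_def abs_less_iff)
    qed
  qed
  from tendsto_add[OF this lim] show ?thesis by simp
qed

text \<open>The gap to \<open>a\<close> is divided equally: half may be lost in the misfit, which
  converges, and half in the norm term, which is weakly lower semicontinuous.\<close>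

lemma functional_plan_liminf:
  assumes lim: "(\<lambda>N. misfit (\<gamma> N) (w N)) \<longlonglongrightarrow> misfit \<gamma>' u" and weak: "\<And>v. (\<lambda>N. w N \<bullet> v) \<longlonglongrightarrow> u \<bullet> v"
    and \<beta>: "\<beta> > 0" and a: "a < functional_plan F \<beta> \<gamma>' u"
  shows "\<forall>\<^sub>F N in sequentially. a < functional_plan F \<beta> (\<gamma> N) (w N)"
proof -
  define e where "e = (functional_plan F \<beta> \<gamma>' u - a) / 2"
  have e: "e > 0" using a by (simp add: e_def)
  have "2 * e / \<beta> > 0" using e \<beta> by simp
  from norm_le_of_weak_limit[OF weak[of u] this]
  have "\<forall>\<^sub>F N in sequentially. (norm u)\<^sup>2 - 2 * e / \<beta> < (norm (w N))\<^sup>2" .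
  moreover have "\<forall>\<^sub>F N in sequentially. misfit \<gamma>' u - e < misfit (\<gamma> N) (w N)"
    using order_tendstoD(1)[OF lim] e by simp
  ultimately show ?thesis
  proof eventually_elim
    case (elim N)
    have "\<beta> / 2 * ((norm u)\<^sup>2 - 2 * e / \<beta>) < \<beta> / 2 * (norm (w N))\<^sup>2"
      using elim(1) \<beta> by (intro mult_strict_left_mono) auto
    then have "\<beta> / 2 * (norm u)\<^sup>2 - e < \<beta> / 2 * (norm (w N))\<^sup>2"
      using \<beta> by (simp add: right_diff_distrib)
    moreover have "2 * e = misfit \<gamma>' u + \<beta> / 2 * (norm u)\<^sup>2 - a"
      unfolding functional_plan_eq[symmetric] by (simp add: e_def)
    ultimately show ?case using elim(2) unfolding functional_plan_eq by linarith
  qed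
qed

text \<open>Coercivity: the misfit is nonnegative, so the value controls the norm.\<close>

lemma norm_le_of_functional_plan:
  assumes "\<beta> > 0" "functional_plan F \<beta> \<gamma> u \<le> Q"
  shows "norm u \<le> sqrt (2 * Q / \<beta>)"
proof -
  have "\<beta> / 2 * (norm u)\<^sup>2 \<le> Q" using assms(2) misfit_nonneg[of \<gamma> u] unfolding functional_plan_eq by linarith
  then have "(norm u)\<^sup>2 \<le> 2 * Q / \<beta>" using assms(1) by (simp add: field_simps)
  then show ?thesis by (simp add: real_le_rsqrt)
qed

text \<open>The direct method: a minimizing sequence is bounded by coercivity, and any weak limit of
  a subsequence is a minimizer by lower semicontinuity.\<close>

lemma minimizers_nonempty:
  assumes K: "compact K" and \<gamma>: "prob_space \<gamma>" "sets \<gamma> = sets borel" "AE p in \<gamma>. p \<in> K \<times> K" and \<beta>: "\<beta> > 0"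
  shows "minimizers (functional_plan F \<beta> \<gamma>) \<noteq> {}"
proof -
  define J where "J = functional_plan F \<beta> \<gamma>"
  have J0: "0 \<le> J u" for u using misfit_nonneg[of \<gamma> u] \<beta> by (simp add: J_def functional_plan_eq)
  define m where "m = Inf (range J)"
  have bdd: "bdd_below (range J)" by (rule bdd_belowI[of _ 0]) (use J0 in auto)
  have mle: "m \<le> J u" for u unfolding m_def using bdd by (auto intro: cInf_lower)
  have "\<exists>u. J u < m + inverse (real (Suc n))" for n
  proof -
    have "Inf (range J) < m + inverse (real (Suc n))" by (simp add: m_def)
    from cInf_lessD[OF _ this] show ?thesis by auto
  qed
  then obtain w where w: "\<And>n. J (w n) < m + inverse (real (Suc n))" by metis
  define R where "R = sqrt (2 * (m + 1) / \<beta>)"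
  have R: "norm (w n) \<le> R" for n
  proof -
    have "inverse (real (Suc n)) \<le> 1" by (simp add: field_simps)
    then have "J (w n) \<le> m + 1" using w[of n] by argo
    then show ?thesis unfolding R_def J_def by (rule norm_le_of_functional_plan[OF \<beta>])
  qed
  obtain r l where r: "strict_mono r" "\<And>v. (\<lambda>n. w (r n) \<bullet> v) \<longlonglongrightarrow> l \<bullet> v"
    by (rule bounded_imp_weakly_convergent_subsequence[of w, OF R], rule that)
  \<comment> \<open>Existence for a single plan uses the convergence lemma with the constant
    sequence of plans.\<close>
  have lim: "(\<lambda>n. misfit \<gamma> (w (r n))) \<longlonglongrightarrow> misfit \<gamma> l"
    by (rule misfit_converges[OF K \<gamma> \<gamma> _ R r(2)]) (simp add: weakly_converges_def)
  have Jw: "(\<lambda>n. m + inverse (real (Suc (r n)))) \<longlonglongrightarrow> m + 0"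
    using LIMSEQ_subseq_LIMSEQ[OF LIMSEQ_inverse_real_of_nat r(1)] by (intro tendsto_add) (simp_all add: comp_def)
  have "J l \<le> m"
  proof (rule ccontr)
    assume "\<not> J l \<le> m"
    then have a: "m < (m + J l) / 2" "(m + J l) / 2 < J l" by auto
    have "\<forall>\<^sub>F n in sequentially. (m + J l) / 2 < J (w (r n))"
      using functional_plan_liminf[OF lim r(2) \<beta>] a(2) unfolding J_def by blast
    moreover have "\<forall>\<^sub>F n in sequentially. m + inverse (real (Suc (r n))) < (m + J l) / 2"
      by (rule order_tendstoD(2)[OF Jw]) (use a(1) in simp)
    ultimately have "\<forall>\<^sub>F n in sequentially. False"
    proof eventually_elim
      case (elim n)
      then show ?case using w[of "r n"] by argo
    qed
    then show False by simp
  qed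
  then have "l \<in> minimizers J" using mle order_trans unfolding minimizers_def by blast
  then show ?thesis by (auto simp: J_def)
qed

text \<open>Comparison with the zero control bounds the minimizers, so a subsequence converges
  weakly to some \<open>l\<close>. The values converge to that of \<open>l\<close>: from below by
  lower semicontinuity, from above by comparing \<open>w\<close> with the fixed control
  \<open>l\<close>. It is stated for arbitrary convergent plans so that it also applies along
  subsequences.\<close>

lemma minimizers_subsequence:
  assumes K: "compact K" and \<beta>: "\<beta> > 0"
    and \<gamma>: "\<And>N. prob_space (\<gamma> N)" "\<And>N. sets (\<gamma> N) = sets borel" "\<And>N. AE p in \<gamma> N. p \<in> K \<times> K"
    and \<gamma>': "prob_space \<gamma>'" "sets \<gamma>' = sets borel" "AE p in \<gamma>'. p \<in> K \<times> K"
    and conv: "weakly_converges \<gamma> \<gamma>'"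
    and min: "\<And>N. w N \<in> minimizers (functional_plan F \<beta> (\<gamma> N))"
  obtains s l where "strict_mono (s :: nat \<Rightarrow> nat)" "(\<lambda>n. w (s n)) \<longlonglongrightarrow> l"
    "l \<in> minimizers (functional_plan F \<beta> \<gamma>')"
    "(\<lambda>n. functional_plan F \<beta> (\<gamma> (s n)) (w (s n))) \<longlonglongrightarrow> functional_plan F \<beta> \<gamma>' l"
proof -
  define J where "J N = functional_plan F \<beta> (\<gamma> N)" for N
  define J' where "J' = functional_plan F \<beta> \<gamma>'"
  have minJ: "J N (w N) \<le> J N v" for N v using min[of N] by (simp add: minimizers_def J_def)
  have fixed: "(\<lambda>N. misfit (\<gamma> N) v) \<longlonglongrightarrow> misfit \<gamma>' v" for v
    by (rule misfit_converges[OF K \<gamma> \<gamma>' conv, of "\<lambda>_. v" "norm v"]) auto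
  have Jfixed: "(\<lambda>N. J N v) \<longlonglongrightarrow> J' v" for v
    unfolding J_def J'_def functional_plan_eq by (intro tendsto_intros fixed)
  obtain Q where "\<forall>N. norm (J N 0) \<le> Q"
    using BseqE[OF convergent_imp_Bseq[OF convergentI[OF Jfixed[of 0]]]] by blast
  then have Q: "J N 0 \<le> Q" for N using abs_le_D1 by (metis real_norm_def)
  define R where "R = sqrt (2 * Q / \<beta>)"
  have R: "norm (w N) \<le> R" for N
    unfolding R_def using minJ[of N 0] Q[of N] unfolding J_def
    by (intro norm_le_of_functional_plan[OF \<beta>, of "\<gamma> N"]) linarith
  obtain s l where s: "strict_mono (s :: nat \<Rightarrow> nat)" and weak: "\<And>v. (\<lambda>n. w (s n) \<bullet> v) \<longlonglongrightarrow> l \<bullet> v"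
    by (rule bounded_imp_weakly_convergent_subsequence[of w, OF R], rule that)
  have conv': "weakly_converges (\<lambda>n. \<gamma> (s n)) \<gamma>'"
    using conv LIMSEQ_subseq_LIMSEQ[OF _ s] unfolding weakly_converges_def comp_def by blast
  have lim: "(\<lambda>n. misfit (\<gamma> (s n)) (w (s n))) \<longlonglongrightarrow> misfit \<gamma>' l"
    by (rule misfit_converges[OF K \<gamma> \<gamma>' conv' R weak])
  have Jsub: "(\<lambda>n. J (s n) v) \<longlonglongrightarrow> J' v" for v
    using LIMSEQ_subseq_LIMSEQ[OF Jfixed s] by (simp add: comp_def)
  have Jlim: "(\<lambda>n. J (s n) (w (s n))) \<longlonglongrightarrow> J' l"
  proof (rule order_tendstoI)
    fix a assume "a < J' l"
    then show "\<forall>\<^sub>F n in sequentially. a < J (s n) (w (s n))"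
      unfolding J_def J'_def by (rule functional_plan_liminf[OF lim weak \<beta>])
  next
    fix a assume "J' l < a"
    from order_tendstoD(2)[OF Jsub this] show "\<forall>\<^sub>F n in sequentially. J (s n) (w (s n)) < a"
      by eventually_elim (use minJ le_less_trans in blast)
  qed
  have "J' l \<le> J' v" for v by (rule LIMSEQ_le[OF Jlim Jsub]) (use minJ in auto)
  then have lmin: "l \<in> minimizers J'" by (simp add: minimizers_def)
  \<comment> \<open>Values and misfits both converge; their difference isolates the norms, whose
    convergence upgrades weak to strong convergence.\<close>
  have "(\<lambda>n. (J (s n) (w (s n)) - misfit (\<gamma> (s n)) (w (s n))) * (2 / \<beta>)) \<longlonglongrightarrow> (J' l - misfit \<gamma>' l) * (2 / \<beta>)"
    by (intro tendsto_intros Jlim lim)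
  then have "(\<lambda>n. (norm (w (s n)))\<^sup>2) \<longlonglongrightarrow> (norm l)\<^sup>2"
    using \<beta> by (simp add: J_def J'_def functional_plan_eq)
  then have "(\<lambda>n. w (s n)) \<longlonglongrightarrow> l" by (rule weak_convergence_imp_strong[OF weak])
  with s lmin Jlim show thesis using that unfolding J_def J'_def by blast
qed

end

lemma Inf_eq_minimizer:
  fixes G :: "'a \<Rightarrow> real"
  assumes "u \<in> minimizers G"
  shows "(INF v. G v) = G u"
  using assms by (intro cInf_eq_minimum) (auto simp: minimizers_def)

lemma lipschitz_fields_imp_control_system:
  fixes F :: "'k::finite \<Rightarrow> real ^ 'n \<Rightarrow> real ^ 'n"
  assumes "\<And>i. \<exists>L. L-lipschitz_on UNIV (F i)"
  obtains \<Lambda> where "lipschitz_control_system F \<Lambda>"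
proof -
  obtain L where L: "\<And>i. (L i)-lipschitz_on UNIV (F i)" using assms by metis
  have L0: "0 \<le> L i" for i using L lipschitz_on_nonneg by blast
  have "lipschitz_control_system F (\<Sum>i\<in>UNIV. L i)"
  proof
    show "0 \<le> (\<Sum>i\<in>UNIV. L i)" using L0 by (simp add: sum_nonneg)
    show "continuous_on UNIV (F i)" for i using L lipschitz_on_continuous_on by blast
    fix w :: "real ^ 'k" and x y
    have "norm (\<Sum>i\<in>UNIV. (w $ i) *\<^sub>R (F i x - F i y)) \<le> (\<Sum>i\<in>UNIV. norm w * (L i * norm (x - y)))"
    proof (intro sum_norm_le)
      fix i
      have "norm (F i x - F i y) \<le> L i * norm (x - y)"
        using lipschitz_onD[OF L, of x y i] by (simp add: dist_norm)
      then show "norm ((w $ i) *\<^sub>R (F i x - F i y)) \<le> norm w * (L i * norm (x - y))"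
        unfolding norm_scaleR using component_le_norm_cart[of w i] by (intro mult_mono) auto
    qed
    also have "\<dots> = (\<Sum>i\<in>UNIV. L i) * norm w * norm (x - y)"
      by (simp add: sum_distrib_left sum_distrib_right mult_ac)
    finally show "norm (\<Sum>i\<in>UNIV. (w $ i) *\<^sub>R (F i x - F i y)) \<le> (\<Sum>i\<in>UNIV. L i) * norm w * norm (x - y)" .
  qed
  then show thesis by (rule that)
qed

text \<open>Minima are written as infima together with nonempty sets of minimizers; \<open>C\<close>
  ranges over all constants with the property that defines the set of bounded controls;
  precompactness is compactness of the closure.\<close>

theorem theorem3p6:
  fixes F :: "'k::finite \<Rightarrow> real ^ 'n \<Rightarrow> real ^ 'n"
    and \<beta> :: real
    and K :: "(real ^ 'n) set"
    and \<mu> \<nu> :: "(real ^ 'n) measure"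
    and \<mu>N \<nu>N :: "nat \<Rightarrow> (real ^ 'n) measure"
    and \<gamma>N :: "nat \<Rightarrow> ((real ^ 'n) \<times> (real ^ 'n)) measure"
    and T :: "real ^ 'n \<Rightarrow> real ^ 'n"
    and FN :: "nat \<Rightarrow> (real ^ 'k) L2 \<Rightarrow> real"
    and Finf :: "(real ^ 'k) L2 \<Rightarrow> real"
  assumes F_smooth: "\<And>i. smooth (F i)"
    and F_lipschitz: "\<And>i. \<exists>L. L-lipschitz_on UNIV (F i)"
    and \<beta>: "\<beta> > 0"
    and K: "compact K"
    and \<mu>: "\<mu> \<in> prob_measures" "supp \<mu> \<subseteq> K" "absolutely_continuous lborel \<mu>"
    and \<nu>: "\<nu> \<in> prob_measures" "supp \<nu> \<subseteq> K"
    and \<mu>N: "\<And>N. N \<ge> 1 \<Longrightarrow> \<mu>N N \<in> prob_measures \<and> supp (\<mu>N N) \<subseteq> K"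
    and \<nu>N: "\<And>N. N \<ge> 1 \<Longrightarrow> \<nu>N N \<in> prob_measures \<and> supp (\<nu>N N) \<subseteq> K"
    and \<mu>N_conv: "weakly_converges \<mu>N \<mu>"
    and \<nu>N_conv: "weakly_converges \<nu>N \<nu>"
    and \<gamma>N: "\<And>N. N \<ge> 1 \<Longrightarrow> \<gamma>N N \<in> Opt (\<mu>N N) (\<nu>N N)"
    and T: "is_optimal_map \<mu> \<nu> T"
    and FN_eq: "\<And>N. N \<ge> 1 \<Longrightarrow> FN N = functional_plan F \<beta> (\<gamma>N N)"
    and Finf_eq: "Finf = functional_map F \<beta> \<mu> T"
  shows "(\<forall>C>0. (\<forall>N\<ge>1. minimizers (FN N) \<subseteq> bounded_controls C \<beta>) \<and>
                minimizers Finf \<subseteq> bounded_controls C \<beta> \<longrightarrow>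
            Gamma_converges (subtopology weak_topology (bounded_controls C \<beta>))
              (\<lambda>N u. ereal (FN N u)) (\<lambda>u. ereal (Finf u))) \<and>
         ((\<forall>N\<ge>1. minimizers (FN N) \<noteq> {}) \<and> minimizers Finf \<noteq> {} \<and>
            (\<lambda>N. INF u. FN N u) \<longlonglongrightarrow> (INF u. Finf u)) \<and>
         (\<forall>uhat. (\<forall>N\<ge>1. uhat N \<in> minimizers (FN N)) \<longrightarrow>
            compact (closure (uhat ` {1..})) \<and>
            (\<forall>r u. strict_mono r \<and> (uhat \<circ> r) \<longlonglongrightarrow> u \<longrightarrow> u \<in> minimizers Finf))"
proof -
  obtain \<Lambda> where "lipschitz_control_system F \<Lambda>" 
    by (rule lipschitz_fields_imp_control_system[of F, OF F_lipschitz], rule that)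
  then interpret lipschitz_control_system F \<Lambda> .
  define \<gamma>' where "\<gamma>' = distr \<mu> borel (\<lambda>x. (x, T x))"
  \<comment> \<open>The assumptions concern indices \<open>N \<ge> 1\<close>, so all sequences are
    shifted by one and shifted back at the end.\<close>
  define g where "g N = \<gamma>N (Suc N)" for N
  have Tm: "T \<in> borel_measurable borel" and \<gamma>'opt: "\<gamma>' \<in> Opt \<mu> \<nu>"
    using T by (auto simp: is_optimal_map_def \<gamma>'_def)
  have gopt: "g N \<in> Opt (\<mu>N (Suc N)) (\<nu>N (Suc N))" for N using \<gamma>N by (simp add: g_def)
  have KN: "supp (\<mu>N (Suc N)) \<subseteq> K" "supp (\<nu>N (Suc N)) \<subseteq> K" for N using \<mu>N \<nu>N by simp_all
  have conv\<mu>: "weakly_converges (\<lambda>N. \<mu>N (Suc N)) \<mu>" and conv\<nu>: "weakly_converges (\<lambda>N. \<nu>N (Suc N)) \<nu>"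
    using \<mu>N_conv \<nu>N_conv LIMSEQ_Suc unfolding weakly_converges_def by blast+
  have conv: "weakly_converges g \<gamma>'"
    unfolding \<gamma>'_def
    by (rule Opt_stability[OF K \<mu>(2) \<nu>(2) \<mu>(1,3) Tm \<gamma>'opt[unfolded \<gamma>'_def] KN gopt conv\<mu> conv\<nu>])
  have coup: "g N \<in> couplings (\<mu>N (Suc N)) (\<nu>N (Suc N))" for N using gopt by (simp add: Opt_def)
  have coup': "\<gamma>' \<in> couplings \<mu> \<nu>" using \<gamma>'opt by (simp add: Opt_def)
  note g = couplingsD(1,2)[OF coup] coupling_AE(2)[OF coup KN]
  note g' = couplingsD(1,2)[OF coup'] coupling_AE(2)[OF coup' \<mu>(2) \<nu>(2)]
  have FN: "FN (Suc N) = functional_plan F \<beta> (g N)" for N using FN_eq by (simp add: g_def)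
  \<comment> \<open>Change of variables under \<open>x \<mapsto> (x, T x)\<close> writes the limit
    functional as the functional of a plan.\<close>
  have Finf: "Finf = functional_plan F \<beta> \<gamma>'"
  proof
    fix u
    have "sets \<mu> = sets borel" using \<mu>(1) by (simp add: prob_measures_def)
    then have "(\<lambda>x. (x, T x)) \<in> borel_measurable \<mu>"
      by (rule measurable_borel_sets) (use Tm in measurable)
    then have "(LINT p|\<gamma>'. (norm (flow F u (fst p) - snd p))\<^sup>2) = (LINT x|\<mu>. (norm (flow F u x - T x))\<^sup>2)"
      unfolding \<gamma>'_def
      by (subst integral_distr) (auto intro!: borel_measurable_continuous_onI integrand_continuous)
    then show "Finf u = functional_plan F \<beta> \<gamma>' u"
      by (simp add: Finf_eq functional_map_def functional_plan_def)
  qed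
  note sub = minimizers_subsequence[OF K \<beta>]
  have Gamma: "Gamma_converges (subtopology weak_topology (bounded_controls C \<beta>))
      (\<lambda>N u. ereal (FN N u)) (\<lambda>u. ereal (Finf u))" for C
    unfolding Gamma_converges_def
  proof (intro conjI ballI allI impI, elim conjE)
    fix u :: "(real ^ 'k) L2" and w
    assume wB: "\<forall>N. w N \<in> topspace (subtopology weak_topology (bounded_controls C \<beta>))"
      and lim: "limitin (subtopology weak_topology (bounded_controls C \<beta>)) w u sequentially"
    have R: "norm (w N) \<le> sqrt (C / \<beta>)" for N
      using wB by (simp add: topspace_weak_topology bounded_controls_def real_le_rsqrt)
    have weak: "(\<lambda>N. w (Suc N) \<bullet> v) \<longlonglongrightarrow> u \<bullet> v" for v
      using limitin_weak_topology[OF lim, of v] by (rule LIMSEQ_Suc)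
    have mis: "(\<lambda>N. misfit (g N) (w (Suc N))) \<longlonglongrightarrow> misfit \<gamma>' u"
      by (rule misfit_converges[OF K g g' conv R weak])
    show "ereal (Finf u) \<le> liminf (\<lambda>N. ereal (FN N (w N)))"
      unfolding le_Liminf_iff
    proof (intro allI impI)
      fix y assume y: "y < ereal (Finf u)"
      have "\<forall>\<^sub>F N in sequentially. y < ereal (FN (Suc N) (w (Suc N)))"
      proof (cases y)
        case (real a)
        then have "\<forall>\<^sub>F N in sequentially. a < functional_plan F \<beta> (g N) (w (Suc N))"
          using y unfolding Finf by (intro functional_plan_liminf[OF mis weak \<beta>]) simp
        then show ?thesis by eventually_elim (simp add: real FN)
      qed (use y in auto)
      then show "\<forall>\<^sub>F N in sequentially. y < ereal (FN N (w N))"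
        by (rule eventually_sequentially_Suc[THEN iffD1])
    qed
  next
    fix u :: "(real ^ 'k) L2"
    assume u: "u \<in> topspace (subtopology weak_topology (bounded_controls C \<beta>))"
    have "(\<lambda>N. misfit (g N) u) \<longlonglongrightarrow> misfit \<gamma>' u"
      by (rule misfit_converges[OF K g g' conv, of "\<lambda>_. u" "norm u"]) auto
    then have "(\<lambda>N. FN (Suc N) u) \<longlonglongrightarrow> Finf u"
      unfolding FN Finf functional_plan_eq by (intro tendsto_intros)
    then have "(\<lambda>N. ereal (FN N u)) \<longlonglongrightarrow> ereal (Finf u)"
      by (intro tendsto_ereal) (rule LIMSEQ_imp_Suc)
    then have "limsup (\<lambda>N. ereal (FN N u)) = ereal (Finf u)"
      by (intro lim_imp_Limsup) auto
    then show "\<exists>w. (\<forall>N. w N \<in> topspace (subtopology weak_topology (bounded_controls C \<beta>))) \<and>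
        limitin (subtopology weak_topology (bounded_controls C \<beta>)) w u sequentially \<and>
        limsup (\<lambda>N. ereal (FN N (w N))) \<le> ereal (Finf u)"
      \<comment> \<open>The constant sequence is a recovery sequence, because the functionals
        converge pointwise.\<close>
      using u by (intro exI[of _ "\<lambda>_. u"]) (simp add: limitin_const)
  qed
  have ne: "minimizers (FN (Suc N)) \<noteq> {}" for N
    unfolding FN by (rule minimizers_nonempty[OF K g \<beta>])
  have ne1: "minimizers (FN N) \<noteq> {}" if "N \<ge> 1" for N
    using ne[of "N - 1"] that by simp
  have ne': "minimizers Finf \<noteq> {}" unfolding Finf by (rule minimizers_nonempty[OF K g' \<beta>])
  have inf_conv: "(\<lambda>N. INF u. FN N u) \<longlonglongrightarrow> (INF u. Finf u)"
  \<comment> \<open>If convergence failed, some subsequence of the minimal values would stay at a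
    distance \<open>e\<close> from the limit; a further subsequence of minimizers contradicts
    this.\<close>
  proof (rule LIMSEQ_imp_Suc, rule ccontr)
    assume neg: "\<not> (\<lambda>N. INF u. FN (Suc N) u) \<longlonglongrightarrow> (INF u. Finf u)"
    obtain w where w: "\<And>N. w N \<in> minimizers (FN (Suc N))"
      using choice[of "\<lambda>N u. u \<in> minimizers (FN (Suc N))"] ne by blast
    from neg obtain e where e: "e > 0"
      "\<not> (\<forall>\<^sub>F N in sequentially. dist (INF u. FN (Suc N) u) (INF u. Finf u) < e)"
      unfolding tendsto_iff by blast
    then obtain r where r: "strict_mono (r :: nat \<Rightarrow> nat)"
      "\<And>n. \<not> dist (INF u. FN (Suc (r n)) u) (INF u. Finf u) < e"
      using not_eventually_sequentiallyD by blast
    have convr: "weakly_converges (\<lambda>n. g (r n)) \<gamma>'"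
      using conv LIMSEQ_subseq_LIMSEQ[OF _ r(1)] unfolding weakly_converges_def comp_def by blast
    have wmin: "w (r n) \<in> minimizers (functional_plan F \<beta> (g (r n)))" for n using w[of "r n"] by (simp add: FN)
    obtain s l where "strict_mono (s :: nat \<Rightarrow> nat)" and "(\<lambda>n. w (r (s n))) \<longlonglongrightarrow> l"
      and l: "l \<in> minimizers (functional_plan F \<beta> \<gamma>')"
      and lim: "(\<lambda>n. functional_plan F \<beta> (g (r (s n))) (w (r (s n)))) \<longlonglongrightarrow> functional_plan F \<beta> \<gamma>' l"
      by (rule sub[OF g g' convr wmin], rule that)
    have "(INF u. Finf u) = functional_plan F \<beta> \<gamma>' l" using Inf_eq_minimizer[OF l] by (simp add: Finf)
    moreover have "(INF u. FN (Suc (r (s n))) u) = functional_plan F \<beta> (g (r (s n))) (w (r (s n)))" for n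
      using Inf_eq_minimizer[OF w] by (simp add: FN)
    ultimately have "(\<lambda>n. INF u. FN (Suc (r (s n))) u) \<longlonglongrightarrow> (INF u. Finf u)" using lim by simp
    from tendstoD[OF this e(1)] obtain n where "dist (INF u. FN (Suc (r (s n))) u) (INF u. Finf u) < e"
      by (auto simp: eventually_sequentially)
    then show False using r(2) by blast
  qed
  have strong: "compact (closure (uhat ` {1..})) \<and>
      (\<forall>r u. strict_mono r \<and> (uhat \<circ> r) \<longlonglongrightarrow> u \<longrightarrow> u \<in> minimizers Finf)"
    if uhat: "\<forall>N\<ge>1. uhat N \<in> minimizers (FN N)" for uhat
  proof -
    define w where "w N = uhat (Suc N)" for N
    have wmin: "w N \<in> minimizers (functional_plan F \<beta> (g N))" for N using uhat by (simp add: w_def flip: FN)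
    have converging: "\<exists>s l. strict_mono s \<and> (\<lambda>n. w (r (s n))) \<longlonglongrightarrow> l \<and> l \<in> minimizers Finf"
      if r: "strict_mono r" for r :: "nat \<Rightarrow> nat"
    proof -
      have convr: "weakly_converges (\<lambda>n. g (r n)) \<gamma>'"
        using conv LIMSEQ_subseq_LIMSEQ[OF _ r] unfolding weakly_converges_def comp_def by blast
      show ?thesis
        by (rule sub[OF g g' convr wmin]) (unfold Finf, blast)
    qed
    have "compact (closure (range w))"
      by (rule compact_closure_range) (use converging in blast)
    moreover have "range w = uhat ` {1..}"
    proof -
      have "range Suc = {1..}" by (auto simp: image_iff Suc_le_eq gr0_conv_Suc)
      then show ?thesis unfolding w_def by (metis image_image)
    qed
    moreover have "u \<in> minimizers Finf" if r: "strict_mono r" and lim: "(uhat \<circ> r) \<longlonglongrightarrow> u" for r u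
    proof -
      \<comment> \<open>The subsequence may start at the unconstrained index 0. Dropping its first
        term makes \<open>r (Suc n)\<close> positive, so it can be expressed in the shifted indices
        of \<open>w\<close>.\<close>
      define r' where "r' n = r (Suc n) - 1" for n
      have rS: "r (Suc n) = Suc (r' n)" for n
        using strict_monoD[OF r, of n "Suc n"] by (simp add: r'_def)
      have "strict_mono r'"
      proof (rule strict_monoI_Suc)
        fix n
        have "Suc (r' n) < Suc (r' (Suc n))" unfolding rS[symmetric] using r by (simp add: strict_mono_def)
        then show "r' n < r' (Suc n)" by simp
      qed
      then obtain s l where s: "strict_mono s" "(\<lambda>n. w (r' (s n))) \<longlonglongrightarrow> l" "l \<in> minimizers Finf"
        using converging by blast
      have "(\<lambda>n. w (r' n)) \<longlonglongrightarrow> u"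
        using LIMSEQ_Suc[OF lim] by (simp add: rS w_def)
      then have "(\<lambda>n. w (r' (s n))) \<longlonglongrightarrow> u"
        using LIMSEQ_subseq_LIMSEQ[OF _ s(1)] by (simp add: comp_def)
      then show ?thesis using s(2,3) LIMSEQ_unique by blast
    qed
    ultimately show ?thesis by auto
  qed
  show ?thesis
  proof (intro conjI allI impI)
    show "Gamma_converges (subtopology weak_topology (bounded_controls C \<beta>))
      (\<lambda>N u. ereal (FN N u)) (\<lambda>u. ereal (Finf u))" for C by (rule Gamma)
    show "minimizers (FN N) \<noteq> {}" if "1 \<le> N" for N by (rule ne1[OF that])
    show "minimizers Finf \<noteq> {}" by (rule ne')
    show "(\<lambda>N. INF u. FN N u) \<longlonglongrightarrow> (INF u. Finf u)" by (rule inf_conv)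
    fix uhat assume u: "\<forall>N\<ge>1. uhat N \<in> minimizers (FN N)"
    show "compact (closure (uhat ` {1..}))" using strong[OF u] by blast
    show "u \<in> minimizers Finf" if "strict_mono r \<and> (uhat \<circ> r) \<longlonglongrightarrow> u" for r u using strong[OF u] that by blast
  qed
qed

end
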